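(* Let $V$ be a simple euclidean Jordan algebra of dimension $n$, rank $r=2$ and odd Peirce constant $d$. Then, for every $f\in\mathcal S(V)$, as identities of meromorphic functions of $s\in\mathbb C$, $$ \begin{bmatrix} Z_{+}(\widehat f, s) \\ Z_{-}(\widehat f, s) \end{bmatrix} =2\sqrt 2\, (2\pi)^{-2(s+\frac n2)}\, \Gamma_{\Omega}\Big(s+\frac{n}{2}\Big)\, \mathbf{A}(s) \begin{bmatrix} Z_+ \big(f, -s-\frac{n}{2}\big) \\ Z_-\big(f, -s-\frac{n}{2}\big) \end{bmatrix}, $$ where: If $d\equiv 1\pmod 4$, $$\mathbf{A}(s)=\begin{bmatrix} \sin\Big(\frac{\pi }{2}(s+\frac{n+1}{2})\Big) \cos\Big(\frac{\pi }{2}(s+\frac{n}{2})\Big) & -\sin\Big(\frac{\pi }{2}(s+\frac{n+1}{2})\Big) \sin\Big(\frac{\pi }{2}(s+\frac{n}{2})\Big)\\ \cos\Big(\frac{\pi }{2}(s+\frac{n+1}{2})\Big) \cos\Big(\frac{\pi }{2}(s+\frac{n}{2})\Big)& \cos\Big(\frac{\pi }{2}(s+\frac{n+1}{2})\Big) \sin\Big(\frac{\pi }{2}(s+\frac{n}{2})\Big) \end{bmatrix};$$ If $d\equiv 3\pmod 4$, $$\mathbf{A}(s)=\begin{bmatrix} \cos\Big(\frac{\pi }{2}(s+\frac{n+1}{2})\Big) \cos\Big(\frac{\pi }{2}(s+\frac{n}{2})\Big) & \cos\Big(\frac{\pi }{2}(s+\frac{n+1}{2})\Big) \sin\Big(\frac{\pi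 }{2}(s+\frac{n}{2})\Big)\\ \sin\Big(\frac{\pi }{2}(s+\frac{n+1}{2})\Big) \cos\Big(\frac{\pi }{2}(s+\frac{n}{2})\Big)& -\sin\Big(\frac{\pi }{2}(s+\frac{n+1}{2})\Big) \sin\Big(\frac{\pi }{2}(s+\frac{n}{2})\Big) \end{bmatrix}.$$
   Context: $V$ is a simple euclidean (i.e. formally real) Jordan algebra with unit; $r$ is its rank, $\operatorname{tr}$ and ${\bf det}$ its Jordan trace and Jordan determinant, $\tau(x,y)=\operatorname{tr}(xy)$ its (positive definite) trace form. Given a Jordan frame $c_1,\dots,c_r$, the Peirce spaces are $V_{ij}=\{x: c_ix=\frac12 x,\ c_jx=\frac12x\}$ for $i<j$, and $d$ is their common dimension, so $n=r+\frac d2 r(r-1)$ (thus $n=d+2$ when $r=2$). For $s\in\mathbb C$ and $x$ invertible, ${\bf det}(x)^{s,+}=|{\bf det}(x)|^s$ and ${\bf det}(x)^{s,-}=\operatorname{sign}({\bf det}(x))|{\bf det}(x)|^s$. For $f$ in the Schwartz space $\mathcal S(V)$ and $\varepsilon\in\{+,-\}$, $Z_\varepsilon(f,s)=\int_V f(x)\,{\bf det}(x)^{s,\varepsilon}\,dx$, where $dx$ is the Lebesgue measure normalized by the inner product $\tau$. The integral converges for $\operatorname{Re}s>0$ and extends meromorphically in $s$ to $\mathbb C$; the extension is denoted by the same symbol. The Fourier transform is $\widehat f(x)=\int_V e^{2i\pi\langle x,y\rangle}f(y)\,dy$ with $\langle x,y\rangle=\tau(x,y)$. The Gindikin gamma function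 is $\Gamma_\Omega(s)=(2\pi)^{\frac{n-r}{2}}\prod_{j=1}^r\Gamma\left(s-(j-1)\frac d2\right)$ (here $r=2$). *)

theory Defs
  imports "HOL-Complex_Analysis.Complex_Analysis" "HOL-Computational_Algebra.Polynomial"
begin

section \<open>Euclidean Jordan algebras\<close>

text \<open>
  The Jordan product is written \<open>*\<close> and the unit \<open>1\<close>; the product is not associative, and
  powers are the ones of class \<^class>\<open>power\<close>, i.e. \<open>x ^ Suc k = x * x ^ k\<close>.
\<close>

class jordan_algebra = real_vector + power +
  assumes jordan_mult_commute: "x * y = y * x"
    and jordan_distrib_right: "(x + y) * z = x * z + y * z"
    and jordan_scaleR_left: "(a *\<^sub>R x) * y = a *\<^sub>R (x * y)"
    and jordan_identity: "(x * x) * (x * y) = x * ((x * x) * y)"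
    and jordan_unit: "1 * x = x"

text \<open>
  Class \<^class>\<open>euclidean_space\<close> provides finite dimension and topology. Its inner product is
  auxiliary and unrelated to the product; the inner product attached to the algebra is the trace
  form \<open>jtau\<close> below, and only this one enters the Lebesgue measure and the Fourier transform.
\<close>

class euclidean_jordan_algebra = jordan_algebra + euclidean_space +
  assumes jordan_formally_real: "x * x + y * y = 0 \<Longrightarrow> x = 0 \<and> y = 0"

class simple_euclidean_jordan_algebra = euclidean_jordan_algebra +
  assumes jordan_simple:
    "0 \<in> I \<Longrightarrow> (\<And>x y. x \<in> I \<Longrightarrow> y \<in> I \<Longrightarrow> x + y \<in> I) \<Longrightarrow>
     (\<And>a x. x \<in> I \<Longrightarrow> a *\<^sub>R x \<in> I) \<Longrightarrow> (\<And>x y. x \<in> I \<Longrightarrow> y * x \<in> I) \<Longrightarrow>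
     I = {0} \<or> I = UNIV"


section \<open>Rank, trace and determinant\<close>

definition jpoly :: "real poly \<Rightarrow> 'a::jordan_algebra \<Rightarrow> 'a" where
  "jpoly p x = (\<Sum>i\<le>degree p. coeff p i *\<^sub>R x ^ i)"

definition jminpoly :: "'a::jordan_algebra \<Rightarrow> real poly" where
  "jminpoly x = (THE p. lead_coeff p = 1 \<and> jpoly p x = 0 \<and>
     (\<forall>q. q \<noteq> 0 \<and> jpoly q x = 0 \<longrightarrow> degree p \<le> degree q))"

definition jrank :: "'a::euclidean_jordan_algebra itself \<Rightarrow> nat" where
  "jrank _ = Max (range (\<lambda>x::'a. degree (jminpoly x)))"

text \<open>
  At a regular element \<open>x\<close> (one whose minimal polynomial has degree \<open>r\<close>) the minimal polynomial is
  \<open>X^r - tr(x) X^(r-1) + ... + (-1)^r det(x)\<close>. Trace and determinant are the polynomial functions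
  on the whole algebra determined by this on the dense set of regular elements.
\<close>

definition jtr :: "'a::euclidean_jordan_algebra \<Rightarrow> real" where
  "jtr = (THE p. real_polynomial_function p \<and>
     (\<forall>x. degree (jminpoly x) = jrank TYPE('a) \<longrightarrow>
        p x = - coeff (jminpoly x) (jrank TYPE('a) - 1)))"

definition jdet :: "'a::euclidean_jordan_algebra \<Rightarrow> real" where
  "jdet = (THE p. real_polynomial_function p \<and>
     (\<forall>x. degree (jminpoly x) = jrank TYPE('a) \<longrightarrow>
        p x = (-1) ^ jrank TYPE('a) * coeff (jminpoly x) 0))"

definition jtau :: "'a::euclidean_jordan_algebra \<Rightarrow> 'a \<Rightarrow> real" where
  "jtau x y = jtr (x * y)"


section \<open>Jordan frames and the Peirce constant\<close>

definition jidempotent :: "'a::jordan_algebra \<Rightarrow> bool" where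
  "jidempotent c \<longleftrightarrow> c * c = c"

definition jprimitive :: "'a::jordan_algebra \<Rightarrow> bool" where
  "jprimitive c \<longleftrightarrow> jidempotent c \<and> c \<noteq> 0 \<and>
     \<not> (\<exists>a b. jidempotent a \<and> jidempotent b \<and> a \<noteq> 0 \<and> b \<noteq> 0 \<and> a * b = 0 \<and> c = a + b)"

definition jordan_frame :: "(nat \<Rightarrow> 'a::euclidean_jordan_algebra) \<Rightarrow> bool" where
  "jordan_frame c \<longleftrightarrow>
     (\<forall>i\<in>{1..jrank TYPE('a)}. jprimitive (c i)) \<and>
     (\<forall>i\<in>{1..jrank TYPE('a)}. \<forall>j\<in>{1..jrank TYPE('a)}. i \<noteq> j \<longrightarrow> c i * c j = 0) \<and>
     (\<Sum>i=1..jrank TYPE('a). c i) = 1"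

definition peirce_space :: "(nat \<Rightarrow> 'a::jordan_algebra) \<Rightarrow> nat \<Rightarrow> nat \<Rightarrow> 'a set" where
  "peirce_space c i j = {x. c i * x = (1/2) *\<^sub>R x \<and> c j * x = (1/2) *\<^sub>R x}"

text \<open>
  For simple algebras the dimension of the off-diagonal Peirce spaces depends neither on the frame
  nor on the indices. The description determines the constant only if the rank is at least 2.
\<close>

definition peirce_const :: "'a::euclidean_jordan_algebra itself \<Rightarrow> nat" where
  "peirce_const _ = (THE d. \<forall>c::nat \<Rightarrow> 'a. jordan_frame c \<longrightarrow>
     (\<forall>i j. 1 \<le> i \<and> i < j \<and> j \<le> jrank TYPE('a) \<longrightarrow> dim (peirce_space c i j) = d))"


section \<open>Lebesgue measure, Schwartz space and Fourier transform\<close>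

text \<open>
  Lebesgue measure normalized by the trace form: the image of \<^const>\<open>lborel\<close> under a linear
  isometry from the inner product of the type to the trace form. It does not depend on the choice
  of the isometry.
\<close>

definition jlebesgue :: "'a::euclidean_jordan_algebra measure" where
  "jlebesgue = distr lborel borel
     (SOME T::'a \<Rightarrow> 'a. linear T \<and> (\<forall>x y. jtau (T x) (T y) = x \<bullet> y))"

primrec iter_deriv ::
  "'a::real_normed_vector list \<Rightarrow> ('a \<Rightarrow> 'b::real_normed_vector) \<Rightarrow> 'a \<Rightarrow> 'b" where
  "iter_deriv [] f = f"
| "iter_deriv (v # vs) f = (\<lambda>x. frechet_derivative (iter_deriv vs f) (at x) v)"

definition schwartz :: "('a::euclidean_space \<Rightarrow> complex) \<Rightarrow> bool" where
  "schwartz f \<longleftrightarrow> (\<forall>vs. (\<forall>x. iter_deriv vs f differentiable (at x)) \<and>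
     (\<forall>k::nat. bounded (range (\<lambda>x. norm x ^ k *\<^sub>R iter_deriv vs f x))))"

definition jfourier ::
  "('a::euclidean_jordan_algebra \<Rightarrow> complex) \<Rightarrow> 'a \<Rightarrow> complex" where
  "jfourier f x =
     (LINT y|jlebesgue. exp (2 * \<i> * of_real pi * of_real (jtau x y)) * f y)"


section \<open>Local zeta integrals and the Gindikin gamma function\<close>

datatype parity = Plus | Minus

primrec jdet_powr :: "parity \<Rightarrow> complex \<Rightarrow> 'a::euclidean_jordan_algebra \<Rightarrow> complex" where
  "jdet_powr Plus s x = of_real \<bar>jdet x\<bar> powr s"
| "jdet_powr Minus s x = of_real (sgn (jdet x)) * of_real \<bar>jdet x\<bar> powr s"

text \<open>
  The meromorphic extension to the whole plane; \<^const>\<open>nicely_meromorphic_on\<close> fixes the values at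
  removable singularities (by continuity) and at poles (to be 0), so the extension is unique as a
  function.
\<close>

definition jzeta ::
  "parity \<Rightarrow> ('a::euclidean_jordan_algebra \<Rightarrow> complex) \<Rightarrow> complex \<Rightarrow> complex" where
  "jzeta \<epsilon> f = (THE Z. Z nicely_meromorphic_on UNIV \<and>
     (\<forall>s. Re s > 0 \<longrightarrow> Z s = (LINT x|jlebesgue. f x * jdet_powr \<epsilon> s x)))"

definition gindikin_gamma :: "'a::euclidean_jordan_algebra itself \<Rightarrow> complex \<Rightarrow> complex" where
  "gindikin_gamma _ s =
     of_real ((2 * pi) powr ((real DIM('a) - real (jrank TYPE('a))) / 2)) *
     (\<Prod>j=1..jrank TYPE('a).
        Gamma (s - (of_nat j - 1) * (of_nat (peirce_const TYPE('a)) / 2)))"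

text \<open>Meant for odd \<open>d\<close>, so that the second case is \<open>d \<equiv> 3 (mod 4)\<close>.\<close>

definition zeta_matrix :: "nat \<Rightarrow> nat \<Rightarrow> complex \<Rightarrow> complex^2^2" where
  "zeta_matrix n d s =
     (let \<alpha> = of_real pi / 2 * (s + (of_nat n + 1) / 2);
          \<beta> = of_real pi / 2 * (s + of_nat n / 2)
      in if d mod 4 = 1
         then vector [vector [sin \<alpha> * cos \<beta>, - (sin \<alpha> * sin \<beta>)],
                      vector [cos \<alpha> * cos \<beta>, cos \<alpha> * sin \<beta>]]
         else vector [vector [cos \<alpha> * cos \<beta>, cos \<alpha> * sin \<beta>],
                      vector [sin \<alpha> * cos \<beta>, - (sin \<alpha> * sin \<beta>)]])"

end

theory Submission
  imports Defs "HOL-Probability.Probability"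
begin

text \<open>
  In rank two, \<open>V = \<real>1 \<oplus> W\<close> with \<open>W\<close> a Euclidean space, so \<open>det\<close> is a quadratic form \<open>Q\<close> of signature
  \<open>(1, n - 1)\<close> and \<open>d = n - 2\<close>. Put \<open>F\<^sub>h(t) = \<integral> h exp (i \<pi> t Q)\<close>. Integrating \<open>|t|\<^sup>-\<^sup>s\<^sup>-\<^sup>1 F\<^sub>h(t)\<close> over the two
  half-lines gives, in a strip to the left of \<open>Re s = 0\<close>, combinations of \<open>Z\<^sub>+(h, s)\<close> and \<open>Z\<^sub>-(h, s)\<close> with explicit
  coefficients. The Fourier transform of a Gaussian relates \<open>F\<close> for the Fourier transform of \<open>g\<close> at \<open>t\<close> to \<open>F\<^sub>g\<close> at
  \<open>- 4 / t\<close>, with a factor of size \<open>|t|\<^sup>-\<^sup>n\<^sup>/\<^sup>2\<close>. Hence these Mellin integrals converge on the whole strip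
  \<open>- n / 2 < Re s < 0\<close>, and substituting \<open>t\<close> by \<open>4 / t\<close> turns them into those of \<open>g\<close> at \<open>- s - n / 2\<close>. As \<open>n \<ge> 3\<close>,
  the half-planes where the zeta integrals of the two functions converge are linked by this strip, so gluing yields
  the meromorphic continuation and the functional equation together.
\<close>

subsection \<open>Holomorphic parameter integrals\<close>

text \<open>The double integrals behind both exchanges of integration are not absolutely convergent,
  so each exchange is made with a convergence factor and followed by a dominated limit. Gluing needs
  open overlaps; hence the zeta integrals are shown to converge for Re s > -1/4, not only for Re s >
  0. On a line parallel to the unit the form splits into two linear factors, and the exponent -1/4
  leaves at worst the locally integrable |u|^(-1/2). The decay of F_h at infinity, which stationary
  phase would give, is read off from the transformation formula, because the dual integral is
  bounded. The 4 in 4 / t arises because det is half of a form with coefficients 1 and -1 in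
  coordinates orthonormal for the trace form: the unit has length sqrt 2. The Gaussian integral
  contributes a phase of angle pi (n - 2) / 4. As n - 2 = d is odd, its cosine and sine have modulus
  1 / sqrt 2; this produces the factor sqrt 2 and lets the coefficients collapse to the products in
  A(s), while d mod 4 decides whether the two have equal or opposite signs.\<close>

lemma difference_quotient_bound:
  fixes f :: "complex \<Rightarrow> complex"
  assumes hol: "f holomorphic_on cball s r" and r: "r > 0"
    and B: "\<And>z. z \<in> cball s r \<Longrightarrow> norm (f z) \<le> B"
    and h: "h \<in> cball s (r/2)"
  shows "norm (f h - f s) \<le> (2 * B / r) * norm (h - s)"
proof (rule field_differentiable_bound[where S = "cball s (r/2)" and f' = "deriv f"])
  show "convex (cball s (r/2))" by simp
  show "h \<in> cball s (r/2)" by fact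
  show "s \<in> cball s (r/2)" using r by simp
  fix z assume z: "z \<in> cball s (r/2)"
  have "dist s w < r" if "dist z w < r/2" for w
    using z that dist_triangle[of s w z] by simp
  then have sub: "ball z (r/2) \<subseteq> ball s r" by auto
  have sub': "cball z (r/2) \<subseteq> cball s r"
  proof
    fix w assume "w \<in> cball z (r/2)"
    then show "w \<in> cball s r" using z dist_triangle[of s w z] by simp
  qed
  have "z \<in> ball s r" using z r by auto
  then have "f field_differentiable (at z)"
    using holomorphic_on_subset[OF hol ball_subset_cball]
    by (meson holomorphic_on_imp_differentiable_at open_ball)
  then show "(f has_field_derivative deriv f z) (at z within cball s (r/2))"
    using DERIV_deriv_iff_field_differentiable has_field_derivative_at_within by blast
  \<comment> \<open>Cauchy's estimate on a circle of radius r / 2. The bound is linear in B, so a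
    dominating function for an integrand also dominates its difference quotients up to the factor 2
    / r.\<close>
  have "norm ((deriv ^^ 1) f z) \<le> fact 1 * B / (r/2) ^ 1"
  proof (rule Cauchy_inequality)
    show "f holomorphic_on ball z (r/2)"
      using hol sub' ball_subset_cball holomorphic_on_subset by blast
    show "continuous_on (cball z (r/2)) f"
      using hol sub' holomorphic_on_imp_continuous_on continuous_on_subset by blast
    show "0 < r/2" using r by simp
    fix x assume "norm (z - x) = r/2"
    then show "norm (f x) \<le> B" using sub' B by (auto simp: dist_norm subset_iff)
  qed
  then show "norm (deriv f z) \<le> 2 * B / r" by (simp add: field_simps)
qed

text \<open>Domination is asked of the integrand alone, locally uniformly in s, and not of its
  derivative: Cauchy's estimate carries it over to the difference quotients, and dominated
  convergence along sequences then gives the complex derivative.\<close>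

lemma holomorphic_on_integral_param:
  fixes \<phi> :: "complex \<Rightarrow> 'b \<Rightarrow> complex"
  assumes hol: "\<And>x. x \<in> space M \<Longrightarrow> (\<lambda>s. \<phi> s x) holomorphic_on U"
    and meas: "\<And>s. s \<in> U \<Longrightarrow> \<phi> s \<in> borel_measurable M"
    and dom: "\<And>s. s \<in> U \<Longrightarrow> \<exists>r>0. \<exists>w. cball s r \<subseteq> U \<and> integrable M w \<and>
       (\<forall>z\<in>cball s r. \<forall>x\<in>space M. norm (\<phi> z x) \<le> w x)"
  shows "(\<lambda>s. \<integral>x. \<phi> s x \<partial>M) holomorphic_on U"
proof (rule holomorphic_onI)
  fix s assume "s \<in> U"
  obtain r w where r: "r > 0" and sub: "cball s r \<subseteq> U" and w: "integrable M w"
    and bd: "\<And>z x. z \<in> cball s r \<Longrightarrow> x \<in> space M \<Longrightarrow> norm (\<phi> z x) \<le> w x"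
    using dom[OF \<open>s \<in> U\<close>] by blast
  have int: "integrable M (\<phi> z)" if "z \<in> cball s r" for z
    by (rule Bochner_Integration.integrable_bound[OF w])
       (use that sub meas bd in \<open>fastforce intro: AE_I2 order_trans[OF _ abs_ge_self]\<close>)+
  define D where "D x = deriv (\<lambda>s. \<phi> s x) s" for x
  have sin: "s \<in> interior U"
    using sub r by (meson ball_subset_cball centre_in_ball interiorI open_ball subset_trans)
  have der: "((\<lambda>z. \<phi> z x) has_field_derivative D x) (at s)" if "x \<in> space M" for x
    unfolding D_def
    by (rule holomorphic_derivI[OF holomorphic_on_subset[OF hol[OF that]], of "interior U"])
       (use sin in \<open>auto intro: interior_subset[THEN subsetD]\<close>)
  have "((\<lambda>h. ((\<integral>x. \<phi> (s + h) x \<partial>M) - (\<integral>x. \<phi> s x \<partial>M)) / h) \<longlongrightarrow> (\<integral>x. D x \<partial>M)) (at 0)"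
    unfolding LIMSEQ_SEQ_conv[symmetric]
  proof safe
    fix S :: "nat \<Rightarrow> complex"
    assume S: "\<forall>n. S n \<noteq> 0" "S \<longlonglongrightarrow> 0"
    have "eventually (\<lambda>n. norm (S n) < r/2) sequentially"
      using S(2) r by (metis half_gt_zero order_tendstoD(2) tendsto_norm_zero)
    then obtain N where N: "\<And>n. n \<ge> N \<Longrightarrow> norm (S n) < r/2"
      by (auto simp: eventually_sequentially)
    \<comment> \<open>Dropping the first N terms keeps every s + T n in the half disc where the
      quotient bound applies.\<close>
    define T where "T n = S (n + N)" for n
    have T: "T n \<noteq> 0" "norm (T n) < r/2" "s + T n \<in> cball s (r/2)" "s + T n \<in> cball s r" "s \<in> cball s r" for n
      using S N[of "n+N"] r by (auto simp: T_def dist_norm)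
    have Tlim: "T \<longlonglongrightarrow> 0" unfolding T_def using S(2) by (rule LIMSEQ_ignore_initial_segment)
    have lim: "(\<lambda>n. (\<phi> (s + T n) x - \<phi> s x) / T n) \<longlonglongrightarrow> D x" if "x \<in> space M" for x
    proof -
      have "((\<lambda>h. (\<phi> (s + h) x - \<phi> s x) / h) \<longlongrightarrow> D x) (at 0)"
        using der[OF that] by (simp add: DERIV_def)
      then show ?thesis using T(1) Tlim
        unfolding LIMSEQ_SEQ_conv[symmetric] by blast
    qed
    have me: "(\<lambda>x. (\<phi> (s + T n) x - \<phi> s x) / T n) \<in> borel_measurable M" for n
    proof -
      have "s \<in> U" "s + T n \<in> U" using T(4)[of n] T(5) sub by blast+
      then show ?thesis using meas by (intro borel_measurable_diff borel_measurable_divide) auto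
    qed
    have "(\<lambda>n. \<integral>x. (\<phi> (s + T n) x - \<phi> s x) / T n \<partial>M) \<longlonglongrightarrow> (\<integral>x. D x \<partial>M)"
    proof (rule integral_dominated_convergence[where w = "\<lambda>x. 2 / r * w x"])
      show "D \<in> borel_measurable M"
        by (rule borel_measurable_LIMSEQ_metric[OF me lim])
      show "\<And>n. (\<lambda>x. (\<phi> (s + T n) x - \<phi> s x) / T n) \<in> borel_measurable M" by (rule me)
      show "integrable M (\<lambda>x. 2 / r * w x)" using w by simp
      show "AE x in M. (\<lambda>n. (\<phi> (s + T n) x - \<phi> s x) / T n) \<longlonglongrightarrow> D x"
        using lim by (auto intro: AE_I2)
      show "AE x in M. norm ((\<phi> (s + T n) x - \<phi> s x) / T n) \<le> 2 / r * w x" for n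
      proof (rule AE_I2)
        fix x assume x: "x \<in> space M"
        have "norm (\<phi> (s + T n) x - \<phi> s x) \<le> (2 * w x / r) * norm (s + T n - s)"
          by (rule difference_quotient_bound[where f = "\<lambda>z. \<phi> z x"])
             (use r bd x T sub hol[OF x] in \<open>auto intro: holomorphic_on_subset\<close>)
        then show "norm ((\<phi> (s + T n) x - \<phi> s x) / T n) \<le> 2 / r * w x"
          using T(1)[of n] by (simp add: norm_divide field_simps)
      qed
    qed
    moreover have "(\<integral>x. (\<phi> (s + T n) x - \<phi> s x) / T n \<partial>M)
        = ((\<integral>x. \<phi> (s + T n) x \<partial>M) - (\<integral>x. \<phi> s x \<partial>M)) / T n" for n
      using int T(4,5) by simp
    ultimately have "(\<lambda>n. ((\<integral>x. \<phi> (s + T n) x \<partial>M) - (\<integral>x. \<phi> s x \<partial>M)) / T n) \<longlonglongrightarrow> (\<integral>x. D x \<partial>M)"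
      by (simp only:)
    then have "(\<lambda>n. ((\<integral>x. \<phi> (s + S (n+N)) x \<partial>M) - (\<integral>x. \<phi> s x \<partial>M)) / S (n+N)) \<longlonglongrightarrow> (\<integral>x. D x \<partial>M)"
      unfolding T_def .
    then show "(\<lambda>n. ((\<integral>x. \<phi> (s + S n) x \<partial>M) - (\<integral>x. \<phi> s x \<partial>M)) / S n) \<longlonglongrightarrow> (\<integral>x. D x \<partial>M)"
      by (rule LIMSEQ_offset)
  qed
  then have "((\<lambda>s. \<integral>x. \<phi> s x \<partial>M) has_field_derivative (\<integral>x. D x \<partial>M)) (at s)"
    by (simp add: DERIV_def)
  then show "(\<lambda>s. \<integral>x. \<phi> s x \<partial>M) field_differentiable (at s within U)"
    using field_differentiable_at_within field_differentiable_def by blast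
qed

section \<open>Gamma and Gaussian integrals with a complex parameter\<close>

lemma identity_on_right_half_plane:
  fixes f g :: "complex \<Rightarrow> complex"
  assumes "f holomorphic_on {z. Re z > 0}" "g holomorphic_on {z. Re z > 0}"
    and "\<And>c. c > 0 \<Longrightarrow> f (of_real c) = g (of_real c)" "Re z > 0"
  shows "f z = g z"
proof -
  have "f z - g z = 0"
  proof (rule analytic_continuation[where f = "\<lambda>z. f z - g z" and w = z and S = "{z. Re z > 0}" and U = "of_real ` {0<..}" and \<xi> = 1])
    show "connected {z. 0 < Re z}" by (intro convex_connected convex_halfspace_Re_gt)
    show "1 islimpt complex_of_real ` {0<..}"
      unfolding islimpt_approachable
    proof safe
      fix e :: real assume "e > 0"
      then show "\<exists>x'\<in>complex_of_real ` {0<..}. x' \<noteq> 1 \<and> dist x' 1 < e"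
        by (intro bexI[of _ "of_real (1 + e/2)"]) (auto simp: dist_norm intro!: image_eqI[of _ _ "1 + e/2"])
    qed
  qed (use assms in \<open>auto intro!: holomorphic_intros simp: open_halfspace_Re_gt\<close>)
  then show ?thesis by simp
qed

lemma integrable_lborel_iff_absolutely_integrable:
  fixes f :: "real \<Rightarrow> real"
  assumes "f \<in> borel_measurable borel"
  shows "integrable lborel f \<longleftrightarrow> f absolutely_integrable_on UNIV"
  using assms by (simp add: set_integrable_def integrable_completion)

text \<open>Euler's integral after t = exp x. All Mellin integrals below are written in this way,
  over the whole line, which turns the multiplicative Haar measure into Lebesgue measure.\<close>

lemma Gamma_integral_exp_one:
  assumes "p > (0::real)"
  shows "integrable lborel (\<lambda>x. exp (p * x - exp x))" "(\<integral>x. exp (p * x - exp x) \<partial>lborel) = Gamma p"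
proof -
  define f where "f t = t powr (p - 1) / exp t" for t :: real
  have "(f has_integral Gamma p) {0..}" unfolding f_def by (rule Gamma_integral_real[OF assms])
  moreover have "negligible {x \<in> {0..} - {0<..}. f x \<noteq> 0}"
    by (rule negligible_subset[of "{0}"]) auto
  moreover have "negligible {x \<in> {0<..} - {0..}. f x \<noteq> 0}"
    by (rule negligible_subset[of "{0}"]) auto
  ultimately have f: "(f has_integral Gamma p) {0<..}"
    using has_integral_spike_set_eq[of "{0..}" "{0<..}" f "Gamma p"] by blast
  have "f absolutely_integrable_on {0<..}"
    by (rule nonnegative_absolutely_integrable_1) (use f in \<open>auto simp: f_def\<close>)
  moreover have "range exp = {0::real<..}"
    by (auto simp: image_iff) (metis exp_ln)
  ultimately have "f absolutely_integrable_on range exp \<and> integral (range exp) f = Gamma p"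
    using f by (simp add: integral_unique)
  then have 1: "(\<lambda>x. \<bar>exp x\<bar> * f (exp x)) absolutely_integrable_on UNIV \<and>
      integral UNIV (\<lambda>x. \<bar>exp x\<bar> * f (exp x)) = Gamma p"
    by (subst has_absolute_integral_change_of_variables_1'[where g = exp and f = f])
       (auto intro!: derivative_eq_intros simp: inj_on_def)
  have 2: "\<bar>exp x\<bar> * f (exp x) = exp (p * x - exp x)" for x
  proof -
    have "exp x * (exp x powr (p - 1)) = exp (p * x)"
      by (simp add: powr_def exp_add[symmetric] algebra_simps)
    then show ?thesis by (simp add: f_def exp_diff)
  qed
  have m: "(\<lambda>x. exp (p * x - exp x)) \<in> borel_measurable borel" by measurable
  show i: "integrable lborel (\<lambda>x. exp (p * x - exp x))"
    using 1 m unfolding 2 by (subst integrable_lborel_iff_absolutely_integrable) auto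
  show "(\<integral>x. exp (p * x - exp x) \<partial>lborel) = Gamma p"
    using 1 i unfolding 2 by (metis integral_lborel)
qed

lemma Gamma_integral_exp_real:
  assumes "p > (0::real)" "c > 0"
  shows "integrable lborel (\<lambda>x. exp (p * x - c * exp x))"
    "(\<integral>x. exp (p * x - c * exp x) \<partial>lborel) = Gamma p * c powr (-p)"
proof -
  have eq: "exp (p * (ln c + 1 * x) - exp (ln c + 1 * x)) = c powr p * exp (p * x - c * exp x)" for x
    using assms by (simp add: exp_add exp_diff powr_def algebra_simps)
  have "integrable lborel (\<lambda>x. exp (p * (ln c + 1 * x) - exp (ln c + 1 * x)))"
    by (rule lborel_integrable_real_affine[OF Gamma_integral_exp_one(1)[OF assms(1)]]) simp
  then show "integrable lborel (\<lambda>x. exp (p * x - c * exp x))"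
    unfolding eq using assms by simp
  have "Gamma p = \<bar>1\<bar> *\<^sub>R (\<integral>x. exp (p * (ln c + 1 * x) - exp (ln c + 1 * x)) \<partial>lborel)"
    unfolding Gamma_integral_exp_one(2)[OF assms(1), symmetric] by (rule lborel_integral_real_affine) simp
  then show "(\<integral>x. exp (p * x - c * exp x) \<partial>lborel) = Gamma p * c powr (-p)"
    unfolding eq using assms by (simp add: powr_minus field_simps)
qed

lemma norm_exp_Gamma_integrand:
  "norm (exp (a * of_real x - z * of_real (exp x))) = exp (Re a * x - Re z * exp x)"
  by simp

text \<open>Depending on the sign of x one of the two extreme exponents dominates; the sum covers
  both cases and gives a bound uniform for a in an interval.\<close>

lemma Gamma_integrand_le:
  fixes a b x :: real
  assumes "a0 \<le> a" "a \<le> a1" "b0 \<le> b"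
  shows "exp (a * x - b * exp x) \<le> exp (a0 * x - b0 * exp x) + exp (a1 * x - b0 * exp x)"
proof -
  have "b0 * exp x \<le> b * exp x" using assms by (simp add: mult_right_mono)
  moreover have "a * x \<le> a1 * x \<or> a * x \<le> a0 * x"
    using assms mult_right_mono[of a a1 x] mult_right_mono_neg[of a0 a x] by linarith
  ultimately have "a * x - b * exp x \<le> a1 * x - b0 * exp x \<or> a * x - b * exp x \<le> a0 * x - b0 * exp x"
    by linarith
  then have "exp (a * x - b * exp x) \<le> exp (a1 * x - b0 * exp x) \<or> exp (a * x - b * exp x) \<le> exp (a0 * x - b0 * exp x)"
    by (metis exp_le_cancel_iff)
  moreover have "exp (a1 * x - b0 * exp x) \<ge> 0" "exp (a0 * x - b0 * exp x) \<ge> 0" by simp_all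
  ultimately show ?thesis by linarith
qed

lemma Re_in_cball: "z \<in> cball s r \<Longrightarrow> Re s - r \<le> Re z \<and> Re z \<le> Re s + r"
  using abs_Re_le_cmod[of "s - z"] by (auto simp: dist_norm)

text \<open>Continuation in one variable at a time: for real exponent from real z to the half-plane,
  then in the exponent with z fixed.\<close>

lemma Gamma_integral_exp:
  assumes a: "Re a > 0" and z: "Re z > 0"
  shows "integrable lborel (\<lambda>x. exp (a * of_real x - z * of_real (exp x)))" (is ?I)
    "(\<integral>x. exp (a * of_real x - z * of_real (exp x)) \<partial>lborel) = Gamma a * z powr (-a)" (is ?E)
proof -
  show ?I
    by (rule Bochner_Integration.integrable_bound[OF Gamma_integral_exp_real(1)[OF a z]])
       (auto simp: norm_exp_Gamma_integrand)
  let ?G = "\<lambda>a z. \<integral>x. exp (a * complex_of_real x - z * of_real (exp x)) \<partial>lborel"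
  have holz: "?G a holomorphic_on {z. Re z > 0}" if a: "Re a > 0" for a
  proof (rule holomorphic_on_integral_param)
    fix s :: complex assume "s \<in> {z. Re z > 0}"
    then have s: "Re s > 0" by simp
    show "\<exists>r>0. \<exists>w. cball s r \<subseteq> {z. 0 < Re z} \<and> integrable lborel w \<and>
      (\<forall>z\<in>cball s r. \<forall>x\<in>space lborel. norm (exp (a * of_real x - z * of_real (exp x))) \<le> w x)"
    proof (intro exI conjI)
      show "Re s / 2 > 0" using s by simp
      show "cball s (Re s / 2) \<subseteq> {z. 0 < Re z}" using s Re_in_cball[of _ s "Re s/2"] by force
      show "integrable lborel (\<lambda>x. exp (Re a * x - Re s / 2 * exp x))"
        by (rule Gamma_integral_exp_real(1)) (use a s in auto)
      show "\<forall>z\<in>cball s (Re s/2). \<forall>x\<in>space lborel. norm (exp (a * of_real x - z * of_real (exp x))) \<le> exp (Re a * x - Re s / 2 * exp x)"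
        unfolding norm_exp_Gamma_integrand using s Re_in_cball[of _ s "Re s/2"]
        by (fastforce intro!: mult_right_mono)
    qed
  qed (auto intro!: holomorphic_intros)
  have hola: "(\<lambda>a. ?G a z) holomorphic_on {z. Re z > 0}" if z: "Re z > 0" for z
  proof (rule holomorphic_on_integral_param)
    fix s :: complex assume "s \<in> {z. Re z > 0}"
    then have s: "Re s > 0" by simp
    show "\<exists>r>0. \<exists>w. cball s r \<subseteq> {z. 0 < Re z} \<and> integrable lborel w \<and>
      (\<forall>a\<in>cball s r. \<forall>x\<in>space lborel. norm (exp (a * of_real x - z * of_real (exp x))) \<le> w x)"
    proof (intro exI conjI ballI)
      show "Re s / 2 > 0" using s by simp
      show "cball s (Re s / 2) \<subseteq> {z. 0 < Re z}" using s Re_in_cball[of _ s "Re s/2"] by force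
      show "integrable lborel (\<lambda>x. exp ((Re s - Re s / 2) * x - Re z * exp x) + exp ((Re s + Re s / 2) * x - Re z * exp x))"
        by (intro Bochner_Integration.integrable_add Gamma_integral_exp_real(1)) (use z s in auto)
      fix a x assume "a \<in> cball s (Re s / 2)"
      then show "norm (exp (a * of_real x - z * of_real (exp x))) \<le> exp ((Re s - Re s / 2) * x - Re z * exp x) + exp ((Re s + Re s / 2) * x - Re z * exp x)"
        unfolding norm_exp_Gamma_integrand
        by (intro Gamma_integrand_le) (use Re_in_cball[of a s "Re s/2"] in auto)
    qed
  qed (auto intro!: holomorphic_intros)
  have *: "?G (of_real p) z = Gamma (of_real p) * z powr (- of_real p)" if p: "p > 0" and z: "Re z > 0" for p z
  proof (rule identity_on_right_half_plane[OF holz _ _ z])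
    show "(\<lambda>z. Gamma (of_real p) * z powr - of_real p) holomorphic_on {z. 0 < Re z}"
      by (auto intro!: holomorphic_intros simp: complex_nonpos_Reals_iff)
    fix c :: real assume c: "c > 0"
    have "?G (of_real p) (of_real c) = (\<integral>x. complex_of_real (exp (p * x - c * exp x)) \<partial>lborel)"
      by (rule Bochner_Integration.integral_cong) (simp_all add: exp_of_real[symmetric])
    also have "\<dots> = of_real (Gamma p * c powr (-p))"
      using Gamma_integral_exp_real(2)[OF p c] by simp
    also have "\<dots> = Gamma (of_real p) * of_real c powr (- of_real p)"
      using c by (simp add: Gamma_complex_of_real powr_of_real[symmetric])
    finally show "?G (of_real p) (of_real c) = Gamma (of_real p) * of_real c powr (- of_real p)" .
  qed (use p in auto)
  show ?E
  proof (rule identity_on_right_half_plane[OF hola[OF z] _ _ a])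
    show "(\<lambda>a. Gamma a * z powr - a) holomorphic_on {z. 0 < Re z}"
      using z by (auto intro!: holomorphic_intros elim!: nonpos_Ints_cases)
  qed (rule *[OF _ z])
qed

lemma gaussian_integrable:
  assumes "c > (0::real)"
  shows "integrable lborel (\<lambda>x::real. exp (- pi * c * x\<^sup>2))"
proof -
  have "integrable lborel (\<lambda>x. sqrt (2*pi) * std_normal_density (0 + sqrt (2 * pi * c) * x))"
    by (intro lborel_integrable_real_affine[where c = "sqrt (2 * pi * c)"] integrable_mult_right
        integrable_normal_density) (use assms in auto)
  also have "(\<lambda>x. sqrt (2*pi) * std_normal_density (0 + sqrt (2 * pi * c) * x)) = (\<lambda>x. exp (- pi * c * x\<^sup>2))"
    using assms by (auto simp: std_normal_density_def power_mult_distrib real_sqrt_mult fun_eq_iff field_simps)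
  finally show ?thesis .
qed

text \<open>The characteristic function of the standard normal distribution, with scale k = sqrt (2
  pi c) and frequency t = 2 pi y / k.\<close>

lemma gaussian_fourier_real:
  fixes y c :: real
  assumes "c > 0"
  shows "(\<integral>x. exp (of_real (2 * pi * x * y) * \<i> - of_real (pi * c * x\<^sup>2)) \<partial>lborel)
    = of_real (c powr (-1/2) * exp (- pi * y\<^sup>2 / c))"
proof -
  define k where "k = sqrt (2 * pi * c)"
  have k: "k > 0" using assms by (simp add: k_def)
  define t where "t = 2 * pi * y / k"
  have "complex_of_real (exp (- (t\<^sup>2) / 2)) = char std_normal_distribution t"
    by (simp add: char_std_normal_distribution)
  also have "\<dots> = (\<integral>x. iexp (t * x) \<partial>density lborel std_normal_density)"
    by (simp add: char_def)
  also have "\<dots> = (\<integral>x. std_normal_density x *\<^sub>R iexp (t * x) \<partial>lborel)"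
    by (rule integral_density) auto
  also have "\<dots> = \<bar>k\<bar> *\<^sub>R (\<integral>x. std_normal_density (0 + k * x) *\<^sub>R iexp (t * (0 + k * x)) \<partial>lborel)"
    by (rule lborel_integral_real_affine) (use k in auto)
  also have "(\<lambda>x. std_normal_density (0 + k * x) *\<^sub>R iexp (t * (0 + k * x)))
     = (\<lambda>x. (1 / sqrt (2 * pi)) *\<^sub>R exp (of_real (2 * pi * x * y) * \<i> - of_real (pi * c * x\<^sup>2)))"
  proof
    fix x
    have e: "(k * x)\<^sup>2 / 2 = pi * c * x\<^sup>2" using assms by (simp add: k_def power_mult_distrib)
    have e2: "t * (0 + k * x) = 2 * pi * x * y" using k by (simp add: t_def)
    have "std_normal_density (0 + k * x) = 1 / sqrt (2 * pi) * exp (- (pi * c * x\<^sup>2))"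
      by (simp add: std_normal_density_def e[symmetric])
    then show "std_normal_density (0 + k * x) *\<^sub>R iexp (t * (0 + k * x)) =
       (1 / sqrt (2 * pi)) *\<^sub>R exp (of_real (2 * pi * x * y) * \<i> - of_real (pi * c * x\<^sup>2))"
      unfolding e2 by (simp only: exp_diff exp_minus exp_of_real scaleR_conv_of_real of_real_mult of_real_inverse)
        (simp add: field_simps exp_of_real[symmetric])
  qed
  finally have "complex_of_real (exp (- (t\<^sup>2) / 2)) = (k / sqrt (2 * pi)) *\<^sub>R
     (\<integral>x. exp (of_real (2 * pi * x * y) * \<i> - of_real (pi * c * x\<^sup>2)) \<partial>lborel)"
    using k by simp
  moreover have "k / sqrt (2 * pi) = c powr (1/2)" using assms
    by (simp add: k_def real_sqrt_mult powr_half_sqrt)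
  moreover have "- (t\<^sup>2) / 2 = - pi * y\<^sup>2 / c"
    using assms by (simp add: t_def k_def power_divide power_mult_distrib field_simps power2_eq_square)
  ultimately have "of_real (exp (- pi * y\<^sup>2 / c)) = of_real (c powr (1/2)) *
     (\<integral>x. exp (of_real (2 * pi * x * y) * \<i> - of_real (pi * c * x\<^sup>2)) \<partial>lborel)"
    by (simp add: scaleR_conv_of_real)
  then show ?thesis using assms by (simp add: powr_minus field_simps flip: of_real_mult)
qed

lemma norm_gaussian_integrand:
  "norm (exp (of_real (2 * pi * x * y) * \<i> - of_real pi * z * of_real (x\<^sup>2))) = exp (- pi * Re z * x\<^sup>2)"
  by simp

lemma gaussian_fourier:
  fixes y :: real
  assumes z: "Re z > 0"
  shows "integrable lborel (\<lambda>x. exp (of_real (2 * pi * x * y) * \<i> - of_real pi * z * of_real (x\<^sup>2)))"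
   "(\<integral>x. exp (of_real (2 * pi * x * y) * \<i> - of_real pi * z * of_real (x\<^sup>2)) \<partial>lborel)
      = z powr (-1/2) * exp (- of_real pi * of_real (y\<^sup>2) / z)" (is ?E)
proof -
  show "integrable lborel (\<lambda>x. exp (of_real (2 * pi * x * y) * \<i> - of_real pi * z * of_real (x\<^sup>2)))"
    by (rule Bochner_Integration.integrable_bound[OF gaussian_integrable[OF z]])
       (auto simp: norm_gaussian_integrand)
  show ?E
  proof (rule identity_on_right_half_plane[OF _ _ _ z])
    show "(\<lambda>z. \<integral>x. exp (of_real (2 * pi * x * y) * \<i> - of_real pi * z * of_real (x\<^sup>2)) \<partial>lborel) holomorphic_on {z. 0 < Re z}"
    proof (rule holomorphic_on_integral_param)
      fix s :: complex assume "s \<in> {z. Re z > 0}"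
      then have s: "Re s > 0" by simp
      show "\<exists>r>0. \<exists>w. cball s r \<subseteq> {z. 0 < Re z} \<and> integrable lborel w \<and>
        (\<forall>z\<in>cball s r. \<forall>x\<in>space lborel. norm (exp (of_real (2 * pi * x * y) * \<i> - of_real pi * z * of_real (x\<^sup>2))) \<le> w x)"
      proof (intro exI conjI ballI)
        show "Re s / 2 > 0" using s by simp
        show "cball s (Re s / 2) \<subseteq> {z. 0 < Re z}" using s Re_in_cball[of _ s "Re s/2"] by force
        show "integrable lborel (\<lambda>x. exp (- pi * (Re s/2) * x\<^sup>2))"
          by (rule gaussian_integrable) (use s in auto)
        fix z x assume "z \<in> cball s (Re s / 2)"
        then have "Re s / 2 \<le> Re z" using Re_in_cball[of z s "Re s/2"] by simp
        then have "pi * (Re s / 2) * x\<^sup>2 \<le> pi * Re z * x\<^sup>2"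
          by (intro mult_right_mono mult_left_mono) auto
        then show "norm (exp (of_real (2 * pi * x * y) * \<i> - of_real pi * z * of_real (x\<^sup>2))) \<le> exp (- pi * (Re s/2) * x\<^sup>2)"
          unfolding norm_gaussian_integrand by simp
      qed
    qed (auto intro!: holomorphic_intros)
    show "(\<lambda>z. z powr (-1/2) * exp (- of_real pi * of_real (y\<^sup>2) / z)) holomorphic_on {z. 0 < Re z}"
      by (auto intro!: holomorphic_intros simp: complex_nonpos_Reals_iff)
    fix c :: real assume c: "c > 0"
    have "of_real c powr (-1/2) = complex_of_real (c powr (-1/2))"
      using c powr_of_real[of c "-1/2"] by simp
    moreover have "exp (- of_real pi * of_real (y\<^sup>2) / of_real c) = complex_of_real (exp (- pi * y\<^sup>2 / c))"
      by (simp flip: exp_of_real)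
    ultimately show "(\<integral>x. exp (of_real (2 * pi * x * y) * \<i> - of_real pi * of_real c * of_real (x\<^sup>2)) \<partial>lborel) =
        of_real c powr (-1/2) * exp (- of_real pi * of_real (y\<^sup>2) / of_real c)"
      using gaussian_fourier_real[OF c, of y] by simp
  qed
qed

subsection \<open>Lebesgue measure and a quadratic form of Lorentz signature\<close>

lemma nn_integral_lborel_translate:
  fixes f :: "'a::euclidean_space \<Rightarrow> ennreal"
  assumes [measurable]: "f \<in> borel_measurable borel"
  shows "(\<integral>\<^sup>+x. f (c + x) \<partial>lborel) = (\<integral>\<^sup>+x. f x \<partial>lborel)"
proof -
  have "(\<integral>\<^sup>+x. f x \<partial>lborel) = (\<integral>\<^sup>+x. f x \<partial>distr lborel borel ((+) c))"
    by (simp add: lborel_distr_plus)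
  also have "\<dots> = (\<integral>\<^sup>+x. f (c + x) \<partial>lborel)" by (rule nn_integral_distr) auto
  finally show ?thesis by simp
qed

lemma linear_borel_measurable:
  fixes T :: "'a::euclidean_space \<Rightarrow> 'b::euclidean_space"
  shows "linear T \<Longrightarrow> T \<in> borel_measurable borel"
  by (intro borel_measurable_continuous_onI linear_continuous_on) (simp add: linear_conv_bounded_linear)

text \<open>Uniqueness of Haar measure: both orders of integration of
  \<open>indicator A (U x + y) * indicator (cball 0 1) x\<close> are computed by translation invariance.\<close>

lemma lborel_distr_orthogonal:
  fixes U :: "'a::euclidean_space \<Rightarrow> 'a"
  assumes U: "orthogonal_transformation U"
  shows "distr lborel borel U = lborel"
proof (rule measure_eqI)
  fix A assume "A \<in> sets (distr lborel borel U)"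
  then have A[measurable]: "A \<in> sets borel" by simp
  have lin: "linear U" and nrm: "\<And>x. norm (U x) = norm x"
    using U by (auto simp: orthogonal_transformation)
  obtain V where V: "orthogonal_transformation V" "\<And>x. U (V x) = x" "\<And>x. V (U x) = x"
    using U orthogonal_transformation_inv[OF U] orthogonal_transformation_bij[OF U]
    by (metis bij_inv_eq_iff)
  have linV: "linear V" using V(1) by (auto simp: orthogonal_transformation)
  have [measurable]: "U \<in> borel_measurable borel" "V \<in> borel_measurable borel"
    using lin linV linear_borel_measurable by auto
  let ?B = "cball (0::'a) 1"
  have [measurable]: "?B \<in> sets borel" by simp
  define b where "b = emeasure lborel ?B"
  have b: "b \<noteq> 0" "b \<noteq> \<top>"
  proof -
    show "b \<noteq> \<top>" unfolding b_def using emeasure_lborel_cball_finite[of 0 1] by (simp add: less_top)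
    have "measure lborel ?B > 0" by (rule content_cball_pos) simp
    then show "b \<noteq> 0" unfolding b_def by (metis measure_eq_emeasure_eq_ennreal[of 0] ennreal_0 less_irrefl order_refl)
  qed
  let ?I = "\<integral>\<^sup>+y. \<integral>\<^sup>+x. indicator A (U x + y) * indicator ?B x \<partial>lborel \<partial>lborel :: ennreal"
  have "?I = (\<integral>\<^sup>+x. \<integral>\<^sup>+y. indicator A (U x + y) * indicator ?B x \<partial>lborel \<partial>lborel)"
    by (rule lborel_pair.Fubini'[symmetric]) measurable
  also have "\<dots> = (\<integral>\<^sup>+x. emeasure lborel A * indicator ?B x \<partial>lborel)"
    by (subst nn_integral_multc) (auto simp: nn_integral_lborel_translate)
  also have "\<dots> = emeasure lborel A * b" by (subst nn_integral_cmult) (auto simp: b_def)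
  finally have 1: "?I = emeasure lborel A * b" .
  \<comment> \<open>With V the inverse of U, translating x by - V y moves y from the set A to the
    ball. As U is an isometry, the remaining integral over y is the volume of a ball around U x,
    which is b.\<close>
  have "?I = (\<integral>\<^sup>+y. \<integral>\<^sup>+x. indicator A (U x) * indicator ?B (- V y + x) \<partial>lborel \<partial>lborel)"
  proof (rule nn_integral_cong)
    fix y
    have "(\<integral>\<^sup>+x. indicator A (U x + y) * indicator ?B x \<partial>lborel :: ennreal)
        = (\<integral>\<^sup>+x. indicator A (U (- V y + x) + y) * indicator ?B (- V y + x) \<partial>lborel)"
      by (rule nn_integral_lborel_translate[symmetric]) measurable
    also have "\<dots> = (\<integral>\<^sup>+x. indicator A (U x) * indicator ?B (- V y + x) \<partial>lborel)"
      by (simp only: linear_add[OF lin] linear_neg[OF lin] V) simp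
    finally show "(\<integral>\<^sup>+x. indicator A (U x + y) * indicator ?B x \<partial>lborel :: ennreal) = \<dots>" .
  qed
  also have "\<dots> = (\<integral>\<^sup>+x. \<integral>\<^sup>+y. indicator A (U x) * indicator ?B (- V y + x) \<partial>lborel \<partial>lborel)"
    by (rule lborel_pair.Fubini'[symmetric]) measurable
  also have "\<dots> = (\<integral>\<^sup>+x. indicator A (U x) * b \<partial>lborel)"
  proof (rule nn_integral_cong)
    fix x
    have ind: "indicator ?B (- V y + x) = (indicator (cball (U x) 1) y :: ennreal)" for y
    proof -
      have "norm (- V y + x) = norm (U (- V y + x))" by (simp add: nrm)
      also have "\<dots> = norm (U x - y)" by (simp only: linear_add[OF lin] linear_neg[OF lin] V) simp
      finally have "(- V y + x \<in> ?B) = (y \<in> cball (U x) 1)" by (simp only: mem_cball dist_norm diff_0 norm_minus_cancel)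
      then show ?thesis by (simp only: indicator_def)
    qed
    have "(\<integral>\<^sup>+y. indicator A (U x) * indicator ?B (- V y + x) \<partial>lborel)
        = indicator A (U x) * emeasure lborel (cball (U x) 1)"
      unfolding ind by (rule nn_integral_cmult_indicator) simp
    also have "emeasure lborel (cball (U x) 1) = b"
    proof -
      have "emeasure lborel (cball (U x) 1) = (\<integral>\<^sup>+y. indicator (cball (U x) 1) y \<partial>lborel)" by simp
      also have "\<dots> = (\<integral>\<^sup>+y. indicator (cball (U x) 1) (U x + y) \<partial>lborel)"
        by (rule nn_integral_lborel_translate[symmetric]) (intro borel_measurable_indicator, simp)
      also have "\<dots> = (\<integral>\<^sup>+y. indicator ?B y \<partial>lborel)"
        by (rule nn_integral_cong) (auto simp: indicator_def dist_norm)
      finally show ?thesis by (simp add: b_def)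
    qed
    finally show "(\<integral>\<^sup>+y. indicator A (U x) * indicator ?B (- V y + x) \<partial>lborel) = indicator A (U x) * b" .
  qed
  also have "\<dots> = (\<integral>\<^sup>+x. indicator A (U x) \<partial>lborel) * b" by (rule nn_integral_multc) measurable
  also have "(\<integral>\<^sup>+x. indicator A (U x) \<partial>lborel) = (\<integral>\<^sup>+x. indicator A x \<partial>distr lborel borel U)"
    by (rule nn_integral_distr[symmetric]) auto
  also have "\<dots> = emeasure (distr lborel borel U) A" by simp
  finally have "emeasure (distr lborel borel U) A * b = emeasure lborel A * b" using 1 by simp
  then show "emeasure (distr lborel borel U) A = emeasure lborel A"
    using b ennreal_mult_cancel_left[of b "emeasure (distr lborel borel U) A" "emeasure lborel A"]
    by (simp add: mult.commute)
qed simp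

context
begin

interpretation product_sigma_finite "\<lambda>_. lborel :: real measure" by standard

lemma lborel_integral_prod:
  fixes f :: "'a::euclidean_space \<Rightarrow> real \<Rightarrow> complex"
  assumes int: "\<And>b. b \<in> Basis \<Longrightarrow> integrable lborel (f b)"
  shows "integrable lborel (\<lambda>x::'a. \<Prod>b\<in>Basis. f b (x \<bullet> b))"
    "(\<integral>x. (\<Prod>b\<in>Basis. f b (x \<bullet> b)) \<partial>(lborel :: 'a measure)) = (\<Prod>b\<in>Basis. \<integral>x. f b x \<partial>lborel)"
proof -
  have f[measurable]: "b \<in> Basis \<Longrightarrow> f b \<in> borel_measurable borel" for b
    using int borel_measurable_integrable by fastforce
  have F: "(\<lambda>x. \<Prod>b\<in>Basis. f b (x \<bullet> b)) \<in> borel_measurable (borel :: 'a measure)"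
  proof (rule borel_measurable_prod)
    fix b :: 'a assume "b \<in> Basis"
    then show "(\<lambda>x. f b (x \<bullet> b)) \<in> borel_measurable borel"
      using f[of b] by (intro measurable_compose[OF _ f]) auto
  qed
  have eq: "(\<Prod>b\<in>Basis. f b ((\<Sum>b\<in>Basis. g b *\<^sub>R b) \<bullet> b)) = (\<Prod>b\<in>Basis. f b (g b))" for g :: "'a \<Rightarrow> real"
    by (intro prod.cong) auto
  have m: "(\<lambda>g. \<Sum>b\<in>Basis. g b *\<^sub>R b) \<in> measurable (Pi\<^sub>M Basis (\<lambda>_. lborel)) (borel :: 'a measure)"
    by measurable
  show "integrable lborel (\<lambda>x::'a. \<Prod>b\<in>Basis. f b (x \<bullet> b))"
    apply (subst lborel_eq, subst integrable_distr_eq[OF m F])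
    unfolding eq by (rule product_integrable_prod) (use int in auto)
  show "(\<integral>x. (\<Prod>b\<in>Basis. f b (x \<bullet> b)) \<partial>(lborel :: 'a measure)) = (\<Prod>b\<in>Basis. \<integral>x. f b x \<partial>lborel)"
    apply (subst lborel_eq, subst integral_distr[OF m F])
    unfolding eq by (rule product_integral_prod) (use int in auto)
qed

text \<open>Fubini along the direction e: a bound on lines parallel to e that is uniform up to a
  product weight in the other coordinates reduces integrability to one variable.\<close>

lemma nn_integral_lborel_slice_le:
  fixes F :: "'a::euclidean_space \<Rightarrow> ennreal"
  assumes e: "e \<in> Basis" and F[measurable]: "F \<in> borel_measurable borel"
    and g[measurable]: "g \<in> borel_measurable borel"
    and slice: "\<And>z. z \<bullet> e = 0 \<Longrightarrow> (\<integral>\<^sup>+y. F (z + y *\<^sub>R e) \<partial>lborel) \<le> C * (\<Prod>b\<in>Basis - {e}. g (z \<bullet> b))"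
  shows "(\<integral>\<^sup>+x. F x \<partial>lborel) \<le> C * (\<integral>\<^sup>+y. g y \<partial>lborel) ^ (DIM('a) - 1)"
proof -
  have B: "insert e (Basis - {e}) = Basis" using e by auto
  have m: "(\<lambda>f. F (\<Sum>b\<in>Basis. f b *\<^sub>R b)) \<in> borel_measurable (Pi\<^sub>M (insert e (Basis - {e})) (\<lambda>_. lborel))"
    unfolding B by measurable
  have "(\<integral>\<^sup>+x. F x \<partial>lborel) = (\<integral>\<^sup>+f. F (\<Sum>b\<in>Basis. f b *\<^sub>R b) \<partial>Pi\<^sub>M (insert e (Basis - {e})) (\<lambda>_. lborel))"
    unfolding B by (subst lborel_eq) (simp add: nn_integral_distr)
  also have "\<dots> = (\<integral>\<^sup>+ x. (\<integral>\<^sup>+ y. F (\<Sum>b\<in>Basis. (x(e := y)) b *\<^sub>R b) \<partial>lborel) \<partial>(Pi\<^sub>M (Basis - {e}) (\<lambda>_. lborel)))"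
    by (rule product_nn_integral_insert) (use m in auto)
  also have "\<dots> \<le> (\<integral>\<^sup>+ x. C * (\<Prod>b\<in>Basis - {e}. g (x b)) \<partial>(Pi\<^sub>M (Basis - {e}) (\<lambda>_. lborel)))"
  proof (rule nn_integral_mono)
    fix x :: "'a \<Rightarrow> real"
    define z where "z = (\<Sum>b\<in>Basis - {e}. x b *\<^sub>R b)"
    have zb: "z \<bullet> b = (if b = e then 0 else x b)" if b: "b \<in> Basis" for b
    proof -
      have "z \<bullet> b = (\<Sum>i\<in>Basis - {e}. x i * (if i = b then 1 else 0))"
        unfolding z_def inner_sum_left using b by (intro sum.cong) (auto simp: inner_Basis)
      also have "\<dots> = (\<Sum>i\<in>Basis - {e}. if i = b then x i else 0)"
        by (intro sum.cong) auto
      also have "\<dots> = (if b = e then 0 else x b)" using b by (subst sum.delta) auto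
      finally show ?thesis .
    qed
    have "(\<Sum>b\<in>Basis. (x(e := y)) b *\<^sub>R b) = z + y *\<^sub>R e" for y
    proof -
      have "(\<Sum>b\<in>Basis. (x(e := y)) b *\<^sub>R b) = y *\<^sub>R e + (\<Sum>b\<in>Basis - {e}. (x(e := y)) b *\<^sub>R b)"
        by (subst sum.remove[OF _ e]) auto
      also have "(\<Sum>b\<in>Basis - {e}. (x(e := y)) b *\<^sub>R b) = z"
        unfolding z_def by (intro sum.cong) auto
      finally show ?thesis by simp
    qed
    then have "(\<integral>\<^sup>+ y. F (\<Sum>b\<in>Basis. (x(e := y)) b *\<^sub>R b) \<partial>lborel) = (\<integral>\<^sup>+y. F (z + y *\<^sub>R e) \<partial>lborel)" by simp
    also have "\<dots> \<le> C * (\<Prod>b\<in>Basis - {e}. g (z \<bullet> b))" by (rule slice) (simp add: zb e)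
    also have "(\<Prod>b\<in>Basis - {e}. g (z \<bullet> b)) = (\<Prod>b\<in>Basis - {e}. g (x b))"
      by (intro prod.cong) (auto simp: zb)
    finally show "(\<integral>\<^sup>+ y. F (\<Sum>b\<in>Basis. (x(e := y)) b *\<^sub>R b) \<partial>lborel) \<le> C * (\<Prod>b\<in>Basis - {e}. g (x b))" .
  qed
  also have "\<dots> = C * (\<Prod>b\<in>Basis - {e}. \<integral>\<^sup>+y. g y \<partial>lborel)"
    by (subst nn_integral_cmult, measurable) (subst product_nn_integral_prod, auto)
  also have "\<dots> = C * (\<integral>\<^sup>+y. g y \<partial>lborel) ^ (DIM('a) - 1)" using e by simp
  finally show ?thesis .
qed

end

section \<open>Integrability of small negative powers of the quadratic form\<close>

definition cauchy_weight :: "real \<Rightarrow> real" where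
  "cauchy_weight y = 1 / (1 + y\<^sup>2)"

lemma cauchy_weight_pos: "cauchy_weight y > 0" by (simp add: cauchy_weight_def add_pos_nonneg)

lemma cauchy_weight_le_1: "cauchy_weight y \<le> 1"
  by (simp add: cauchy_weight_def divide_le_eq add_pos_nonneg)

lemma cauchy_weight_measurable [measurable]: "cauchy_weight \<in> borel_measurable borel"
  unfolding cauchy_weight_def by measurable

lemma integrable_cauchy_weight: "integrable lborel cauchy_weight"
proof -
  have "set_integrable lborel (einterval (-\<infinity>) \<infinity>) (\<lambda>x. inverse (1 + x^2))"
    using integrable_inverse_1_plus_square by simp
  then have "integrable lborel (\<lambda>x::real. 1 / (1 + x\<^sup>2))"
    by (simp add: set_integrable_def inverse_eq_divide)
  then show ?thesis unfolding cauchy_weight_def .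
qed

lemma nn_integral_cauchy_weight_finite: "(\<integral>\<^sup>+y. cauchy_weight y \<partial>lborel) < \<infinity>"
  using integrable_cauchy_weight cauchy_weight_pos
  by (subst nn_integral_eq_integral) (auto intro: less_imp_le)

text \<open>A product and not a radial weight, so that it factors on lines parallel to a basis
  vector, as \<open>nn_integral_lborel_slice_le\<close> requires.\<close>

definition euclidean_weight :: "'a::euclidean_space \<Rightarrow> real" where
  "euclidean_weight x = (\<Prod>b\<in>Basis. cauchy_weight (x \<bullet> b))"

lemma euclidean_weight_pos: "euclidean_weight x > 0"
  unfolding euclidean_weight_def by (intro prod_pos) (simp add: cauchy_weight_pos)

lemma euclidean_weight_measurable [measurable]: "euclidean_weight \<in> borel_measurable borel"
  unfolding euclidean_weight_def by measurable

lemma integrable_euclidean_weight: "integrable lborel (euclidean_weight :: 'a::euclidean_space \<Rightarrow> real)"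
proof -
  have "(\<integral>\<^sup>+x. (\<Prod>b\<in>Basis. ennreal (cauchy_weight (x \<bullet> b))) \<partial>(lborel :: 'a measure)) = (\<Prod>b\<in>(Basis::'a set). (\<integral>\<^sup>+x. cauchy_weight x \<partial>lborel))"
    by (intro nn_integral_lborel_prod) auto
  also have "\<dots> < \<infinity>" using nn_integral_cauchy_weight_finite
    by (simp add: less_top[symmetric] power_eq_top_ennreal)
  finally show ?thesis
    unfolding integrable_iff_bounded using euclidean_weight_pos
    by (simp add: abs_of_pos) (simp add: euclidean_weight_def prod_ennreal less_imp_le[OF cauchy_weight_pos] abs_of_pos[OF prod_pos] cauchy_weight_pos)
qed

text \<open>No coordinate exceeds the norm. Hence decay of polynomial order 2 \<open>DIM('a)\<close>
  is enough to be dominated by the weight.\<close>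

lemma euclidean_weight_ge: "1 / (1 + (norm x)\<^sup>2) ^ DIM('a) \<le> euclidean_weight (x::'a::euclidean_space)"
proof -
  have "(\<Prod>b::'a\<in>Basis. 1 / (1 + (norm x)\<^sup>2)) \<le> euclidean_weight x"
    unfolding euclidean_weight_def
  proof (intro prod_mono conjI)
    fix b :: 'a assume b: "b \<in> Basis"
    have "(x \<bullet> b)\<^sup>2 \<le> (norm x)\<^sup>2" using Basis_le_norm[OF b, of x] by (metis abs_le_square_iff abs_norm_cancel)
    then show "1 / (1 + (norm x)\<^sup>2) \<le> cauchy_weight (x \<bullet> b)"
      unfolding cauchy_weight_def by (intro divide_left_mono) (auto intro!: mult_pos_pos add_pos_nonneg)
  qed auto
  then show ?thesis by (simp add: power_one_over)
qed

text \<open>The Jordan determinant of a rank-two algebra in coordinates orthonormal for the trace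
  form, with e corresponding to 1 / sqrt 2 (\<open>jdet_isometry\<close>); this explains the factor
  1/2.\<close>

definition lorentz :: "'a::euclidean_space \<Rightarrow> 'a \<Rightarrow> real" where
  "lorentz e x = ((x \<bullet> e)\<^sup>2 - (\<Sum>b\<in>Basis - {e}. (x \<bullet> b)\<^sup>2)) / 2"

lemma lorentz_measurable [measurable]: "lorentz e \<in> borel_measurable borel"
  unfolding lorentz_def by measurable

lemma lorentz_slice:
  assumes "e \<in> Basis" "z \<bullet> e = 0"
  obtains a where "a \<ge> 0" "\<And>y. lorentz e (z + y *\<^sub>R e) = (y\<^sup>2 - a\<^sup>2) / 2"
proof
  let ?a = "sqrt (\<Sum>b\<in>Basis - {e}. (z \<bullet> b)\<^sup>2)"
  show "?a \<ge> 0" by (simp add: sum_nonneg)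
  have "(\<Sum>b\<in>Basis - {e}. ((z + y *\<^sub>R e) \<bullet> b)\<^sup>2) = (\<Sum>b\<in>Basis - {e}. (z \<bullet> b)\<^sup>2)" for y
    using assms by (intro sum.cong) (auto simp: inner_add_left inner_Basis)
  then show "lorentz e (z + y *\<^sub>R e) = (y\<^sup>2 - ?a\<^sup>2) / 2" for y
    unfolding lorentz_def using assms by (simp add: inner_add_left sum_nonneg)
qed

text \<open>A line parallel to e meets the cone in at most two points, so the slice bound holds with
  constant 0. The weight 1 has infinite integral, but 0 times \<infinity> is 0 in
  \<open>ennreal\<close>.\<close>

lemma AE_lorentz_nonzero:
  fixes e :: "'a::euclidean_space"
  assumes e: "e \<in> Basis"
  shows "AE x in lborel. lorentz e x \<noteq> 0"
proof -
  have "(\<integral>\<^sup>+x. indicator {x. lorentz e x = 0} x \<partial>lborel) \<le> 0 * (\<integral>\<^sup>+y. 1 \<partial>(lborel :: real measure)) ^ (DIM('a) - 1)"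
  proof (rule nn_integral_lborel_slice_le[OF e])
    fix z :: 'a assume "z \<bullet> e = 0"
    then obtain a where a: "a \<ge> 0" "\<And>y. lorentz e (z + y *\<^sub>R e) = (y\<^sup>2 - a\<^sup>2) / 2"
      using lorentz_slice[OF e] by blast
    have "(\<integral>\<^sup>+ y. indicator {x. lorentz e x = 0} (z + y *\<^sub>R e) \<partial>lborel) = (\<integral>\<^sup>+ y. indicator {a, -a} y \<partial>lborel)"
      by (intro nn_integral_cong) (auto simp: indicator_def a power2_eq_iff)
    also have "\<dots> = 0" by (subst nn_integral_indicator) (auto simp: finite_imp_null_set_lborel[THEN null_setsD1])
    finally show "(\<integral>\<^sup>+ y. indicator {x. lorentz e x = 0} (z + y *\<^sub>R e) \<partial>lborel) \<le> 0 * (\<Prod>b\<in>Basis - {e}. 1)" by simp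
  qed auto
  then have "(\<integral>\<^sup>+x. indicator {x. lorentz e x = 0} x \<partial>lborel) = 0" by simp
  then have "AE x in lborel. indicator {x. lorentz e x = 0} x = (0::ennreal)"
    by (subst (asm) nn_integral_0_iff_AE) auto
  then show ?thesis by eventually_elim (auto simp: indicator_def split: if_splits)
qed

lemma nn_integral_powr_neg_half_finite:
  "(\<integral>\<^sup>+u. ennreal (\<bar>u\<bar> powr (-1/2)) * indicator {-1..1} u \<partial>lborel) < \<infinity>"
proof -
  have "((\<lambda>x::real. x powr (-1/2)) has_integral (1 powr (-1/2+1) / (-1/2+1))) {0..1}"
    by (rule has_integral_powr_from_0) auto
  then have fin: "(\<integral>\<^sup>+u. ennreal (u powr (-1/2)) * indicator {0..1} u \<partial>lborel) < \<infinity>"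
    by (subst nn_integral_has_integral_lebesgue') auto
  let ?f = "\<lambda>u::real. ennreal (u powr (-1/2)) * indicator {0..1} u"
  have "(\<integral>\<^sup>+u. ennreal (\<bar>u\<bar> powr (-1/2)) * indicator {-1..1} u \<partial>lborel)
     \<le> (\<integral>\<^sup>+u. ?f u + ?f (- u) \<partial>lborel)"
    by (intro nn_integral_mono) (auto simp: indicator_def)
  also have "\<dots> = (\<integral>\<^sup>+u. ?f u \<partial>lborel) + (\<integral>\<^sup>+u. ?f (- u) \<partial>lborel)" by (rule nn_integral_add) auto
  also have "(\<integral>\<^sup>+u. ?f (- u) \<partial>lborel) = (\<integral>\<^sup>+u. ?f u \<partial>distr lborel borel uminus)"
    by (rule nn_integral_distr[symmetric]) auto
  also have "\<dots> = (\<integral>\<^sup>+u. ?f u \<partial>lborel)" by (simp add: lborel_distr_uminus)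
  finally show ?thesis using fin by (simp add: ennreal_add_less_top order_le_less_trans)
qed

text \<open>The difference of squares is the product of y - a and y + a, hence at least m^2 in
  modulus for the smaller distance m. The exponent -1/4 thus becomes -1/2, which is integrable at 0.
  If y = a or y = - a, the left side vanishes because 0 \<open>powr\<close> anything is 0.\<close>

lemma powr_diff_squares_le:
  fixes a y :: real
  assumes "a \<ge> 0"
  shows "\<bar>(y\<^sup>2 - a\<^sup>2) / 2\<bar> powr (-1/4) \<le> 2 * (\<bar>- a + y\<bar> powr (-1/2) + \<bar>a + y\<bar> powr (-1/2))"
proof (cases "y = a \<or> y = - a")
  case False
  define m where "m = min \<bar>- a + y\<bar> \<bar>a + y\<bar>"
  have m: "m > 0" using False by (auto simp: m_def)
  have "m * m \<le> \<bar>- a + y\<bar> * \<bar>a + y\<bar>" by (intro mult_mono) (auto simp: m_def)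
  also have "\<dots> = \<bar>y\<^sup>2 - a\<^sup>2\<bar>" by (simp add: abs_mult[symmetric] power2_eq_square algebra_simps)
  finally have "m\<^sup>2 / 2 \<le> \<bar>(y\<^sup>2 - a\<^sup>2) / 2\<bar>" by (simp add: power2_eq_square)
  then have "\<bar>(y\<^sup>2 - a\<^sup>2) / 2\<bar> powr (-1/4) \<le> (m\<^sup>2 / 2) powr (-1/4)"
    by (intro powr_mono2') (use m in auto)
  also have "\<dots> = (m powr 2) powr (-1/4) / 2 powr (-1/4)" using m by (simp add: powr_divide)
  also have "(m powr 2) powr (-1/4) = m powr (2 * (-1/4))" by (rule powr_powr)
  also have "(2::real) * (-1/4) = -1/2" by simp
  also have "m powr (-1/2) / 2 powr (-1/4) = m powr (-1/2) * 2 powr (1/4)" by (simp add: powr_minus field_simps)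
  also have "\<dots> \<le> m powr (-1/2) * 2 powr 1" by (intro mult_left_mono powr_mono) auto
  also have "m powr (-1/2) \<le> \<bar>- a + y\<bar> powr (-1/2) + \<bar>a + y\<bar> powr (-1/2)"
    by (auto simp: m_def min_def)
  finally show ?thesis by simp
qed auto

text \<open>The point is that the bound does not involve a: near a singularity the weight is at most
  1 and the singular factor is translated to 0, farther away the singular factor is at most 1 and
  the weight is integrable.\<close>

lemma nn_integral_lorentz_slice_le:
  fixes a :: real
  assumes "a \<ge> 0"
  shows "(\<integral>\<^sup>+y. ennreal (\<bar>(y\<^sup>2 - a\<^sup>2) / 2\<bar> powr (-1/4) * cauchy_weight y) \<partial>lborel)
   \<le> 4 * ((\<integral>\<^sup>+u. ennreal (\<bar>u\<bar> powr (-1/2)) * indicator {-1..1} u \<partial>lborel) + (\<integral>\<^sup>+y. cauchy_weight y \<partial>lborel))"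
proof -
  let ?f = "\<lambda>u::real. ennreal (\<bar>u\<bar> powr (-1/2)) * indicator {-1..1} u"
  have b: "ennreal (\<bar>u\<bar> powr (-1/2) * cauchy_weight y) \<le> ?f u + ennreal (cauchy_weight y)" for u y
  proof (cases "u \<in> {-1..1}")
    case True
    have "\<bar>u\<bar> powr (-1/2) * cauchy_weight y \<le> \<bar>u\<bar> powr (-1/2) * 1"
      by (intro mult_left_mono cauchy_weight_le_1) auto
    then show ?thesis using True by (simp add: add_increasing2 ennreal_leI)
  next
    case False
    then have "\<bar>u\<bar> powr (-1/2) \<le> 1 powr (-1/2)" by (intro powr_mono2') auto
    then have "\<bar>u\<bar> powr (-1/2) * cauchy_weight y \<le> 1 * cauchy_weight y"
      by (intro mult_right_mono) (auto simp: less_imp_le[OF cauchy_weight_pos])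
    then show ?thesis using False by (simp add: ennreal_leI)
  qed
  have "(\<integral>\<^sup>+y. ennreal (\<bar>(y\<^sup>2 - a\<^sup>2) / 2\<bar> powr (-1/4) * cauchy_weight y) \<partial>lborel)
     \<le> (\<integral>\<^sup>+y. 2 * ((?f (-a + y) + cauchy_weight y) + (?f (a + y) + cauchy_weight y)) \<partial>lborel)"
  proof (rule nn_integral_mono)
    fix y
    have "\<bar>(y\<^sup>2 - a\<^sup>2) / 2\<bar> powr (-1/4) * cauchy_weight y
       \<le> 2 * (\<bar>- a + y\<bar> powr (-1/2) * cauchy_weight y + \<bar>a + y\<bar> powr (-1/2) * cauchy_weight y)"
      using mult_right_mono[OF powr_diff_squares_le[OF assms, of y] less_imp_le[OF cauchy_weight_pos[of y]]]
      by (simp add: algebra_simps)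
    then have "ennreal (\<bar>(y\<^sup>2 - a\<^sup>2) / 2\<bar> powr (-1/4) * cauchy_weight y)
       \<le> ennreal (2 * (\<bar>- a + y\<bar> powr (-1/2) * cauchy_weight y + \<bar>a + y\<bar> powr (-1/2) * cauchy_weight y))"
      by (rule ennreal_leI)
    also have "\<dots> = 2 * (ennreal (\<bar>- a + y\<bar> powr (-1/2) * cauchy_weight y) + ennreal (\<bar>a + y\<bar> powr (-1/2) * cauchy_weight y))"
      by (subst ennreal_mult) (auto simp: less_imp_le[OF cauchy_weight_pos] ennreal_plus[symmetric] simp del: ennreal_plus)
    also have "\<dots> \<le> 2 * ((?f (-a + y) + cauchy_weight y) + (?f (a + y) + cauchy_weight y))"
      by (intro mult_left_mono add_mono b) auto
    finally show "ennreal (\<bar>(y\<^sup>2 - a\<^sup>2) / 2\<bar> powr (-1/4) * cauchy_weight y) \<le> \<dots>" .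
  qed
  also have "\<dots> = 2 * (((\<integral>\<^sup>+y. ?f (-a + y) \<partial>lborel) + (\<integral>\<^sup>+y. cauchy_weight y \<partial>lborel)) + ((\<integral>\<^sup>+y. ?f (a + y) \<partial>lborel) + (\<integral>\<^sup>+y. cauchy_weight y \<partial>lborel)))"
    by (simp add: nn_integral_cmult nn_integral_add)
  also have "\<dots> = 2 * (((\<integral>\<^sup>+y. ?f y \<partial>lborel) + (\<integral>\<^sup>+y. cauchy_weight y \<partial>lborel)) + ((\<integral>\<^sup>+y. ?f y \<partial>lborel) + (\<integral>\<^sup>+y. cauchy_weight y \<partial>lborel)))"
    by (subst (1 2) nn_integral_lborel_translate[where f = ?f]) simp_all
  also have "\<dots> = 4 * ((\<integral>\<^sup>+u. ?f u \<partial>lborel) + (\<integral>\<^sup>+y. cauchy_weight y \<partial>lborel))"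
    by (simp add: mult_2[symmetric] mult.assoc[symmetric])
  finally show ?thesis .
qed

text \<open>The source of convergence of the zeta integrals slightly to the left of Re s = 0, and so
  of their overlap with the strip of the Mellin integrals.\<close>

lemma integrable_lorentz_powr_weight:
  fixes e :: "'a::euclidean_space"
  assumes e: "e \<in> Basis"
  shows "integrable lborel (\<lambda>x. \<bar>lorentz e x\<bar> powr (-1/4) * euclidean_weight x)"
proof -
  let ?C = "4 * ((\<integral>\<^sup>+u. ennreal (\<bar>u\<bar> powr (-1/2)) * indicator {-1..1} u \<partial>lborel) + (\<integral>\<^sup>+y. cauchy_weight y \<partial>lborel))"
  have C: "?C < \<infinity>" using nn_integral_powr_neg_half_finite nn_integral_cauchy_weight_finite
    by (simp add: ennreal_mult_less_top)
  have "(\<integral>\<^sup>+x. ennreal (\<bar>lorentz e x\<bar> powr (-1/4) * euclidean_weight x) \<partial>lborel)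
     \<le> ?C * (\<integral>\<^sup>+y. cauchy_weight y \<partial>lborel) ^ (DIM('a) - 1)"
  proof (rule nn_integral_lborel_slice_le[OF e])
    fix z :: 'a assume z: "z \<bullet> e = 0"
    then obtain a where a: "a \<ge> 0" "\<And>y. lorentz e (z + y *\<^sub>R e) = (y\<^sup>2 - a\<^sup>2) / 2"
      using lorentz_slice[OF e] by blast
    let ?P = "\<Prod>b\<in>Basis - {e}. cauchy_weight (z \<bullet> b)"
    have P: "?P \<ge> 0" by (intro prod_nonneg) (simp add: less_imp_le[OF cauchy_weight_pos])
    have w: "euclidean_weight (z + y *\<^sub>R e) = cauchy_weight y * ?P" for y
    proof -
      have "(\<Prod>b\<in>Basis - {e}. cauchy_weight ((z + y *\<^sub>R e) \<bullet> b)) = ?P"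
        using e by (intro prod.cong) (auto simp: inner_add_left inner_Basis)
      then show ?thesis unfolding euclidean_weight_def
        by (subst prod.remove[OF _ e]) (use e z in \<open>auto simp: inner_add_left\<close>)
    qed
    have "(\<integral>\<^sup>+ y. ennreal (\<bar>lorentz e (z + y *\<^sub>R e)\<bar> powr (-1/4) * euclidean_weight (z + y *\<^sub>R e)) \<partial>lborel)
       = (\<integral>\<^sup>+ y. ennreal (\<bar>(y\<^sup>2 - a\<^sup>2) / 2\<bar> powr (-1/4) * cauchy_weight y) * ennreal ?P \<partial>lborel)"
      unfolding a w using P by (intro nn_integral_cong) (simp add: ennreal_mult[symmetric] less_imp_le[OF cauchy_weight_pos] mult_ac)
    also have "\<dots> = (\<integral>\<^sup>+ y. ennreal (\<bar>(y\<^sup>2 - a\<^sup>2) / 2\<bar> powr (-1/4) * cauchy_weight y) \<partial>lborel) * ennreal ?P"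
      by (rule nn_integral_multc) measurable
    also have "\<dots> \<le> ?C * ennreal ?P"
      by (intro mult_right_mono nn_integral_lorentz_slice_le a) auto
    also have "ennreal ?P = (\<Prod>b\<in>Basis - {e}. ennreal (cauchy_weight (z \<bullet> b)))"
      by (rule prod_ennreal[symmetric]) (simp add: less_imp_le[OF cauchy_weight_pos])
    finally show "(\<integral>\<^sup>+ y. ennreal (\<bar>lorentz e (z + y *\<^sub>R e)\<bar> powr (-1/4) * euclidean_weight (z + y *\<^sub>R e)) \<partial>lborel)
       \<le> ?C * (\<Prod>b\<in>Basis - {e}. ennreal (cauchy_weight (z \<bullet> b)))" .
  qed auto
  also have "\<dots> < \<infinity>"
  proof -
    have "(\<integral>\<^sup>+y. cauchy_weight y \<partial>lborel) ^ (DIM('a) - 1) < \<infinity>"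
      using nn_integral_cauchy_weight_finite by (simp add: less_top[symmetric] power_eq_top_ennreal)
    then show ?thesis using C unfolding infinity_ennreal_def ennreal_mult_less_top by blast
  qed
  finally show ?thesis
    unfolding integrable_iff_bounded by (simp add: abs_mult less_imp_le[OF euclidean_weight_pos] abs_of_pos[OF euclidean_weight_pos])
qed

subsection \<open>Schwartz functions and the Fourier transform\<close>

text \<open>The property through which both a Schwartz function and its Fourier transform enter the
  zeta and theta integrals. It survives multiplication by bounded measurable functions, in
  particular by characters.\<close>

definition rapidly_decaying :: "('a::euclidean_space \<Rightarrow> complex) \<Rightarrow> bool" where
  "rapidly_decaying h \<longleftrightarrow> h \<in> borel_measurable borel \<and> (\<forall>k::nat. \<exists>C. \<forall>x. norm x ^ k * norm (h x) \<le> C)"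

lemma rapidly_decaying_measurable: "rapidly_decaying h \<Longrightarrow> h \<in> borel_measurable borel"
  by (simp add: rapidly_decaying_def)

lemma rapidly_decaying_bound:
  assumes "rapidly_decaying h"
  shows "\<exists>C\<ge>0. \<forall>x. norm (h x) * (1 + (norm x)\<^sup>2) ^ m \<le> C"
proof -
  obtain C0 where C0: "\<And>x. norm x ^ 0 * norm (h x) \<le> C0" using assms unfolding rapidly_decaying_def by blast
  obtain C1 where C1: "\<And>x. norm x ^ (2 * m) * norm (h x) \<le> C1" using assms unfolding rapidly_decaying_def by blast
  have "norm (h x) * (1 + (norm x)\<^sup>2) ^ m \<le> 2 ^ m * (\<bar>C0\<bar> + \<bar>C1\<bar>)" for x
  proof -
    have "(1 + (norm x)\<^sup>2) ^ m \<le> 2 ^ m * (1 + norm x ^ (2 * m))"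
    proof (cases "norm x \<le> 1")
      case True
      then have "1 + (norm x)\<^sup>2 \<le> 2" by (simp add: power_le_one)
      then have "(1 + (norm x)\<^sup>2) ^ m \<le> 2 ^ m" by (intro power_mono) auto
      then show ?thesis by (simp add: algebra_simps add_increasing2)
    next
      case False
      then have "1 + (norm x)\<^sup>2 \<le> 2 * (norm x)\<^sup>2" by simp
      then have "(1 + (norm x)\<^sup>2) ^ m \<le> (2 * (norm x)\<^sup>2) ^ m" by (intro power_mono) auto
      also have "\<dots> = 2 ^ m * norm x ^ (2 * m)" by (simp add: power_mult_distrib power_mult)
      finally show ?thesis by (simp add: algebra_simps add_increasing)
    qed
    then have "norm (h x) * (1 + (norm x)\<^sup>2) ^ m \<le> norm (h x) * (2 ^ m * (1 + norm x ^ (2 * m)))"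
      by (intro mult_left_mono) auto
    also have "\<dots> = 2 ^ m * (norm x ^ 0 * norm (h x) + norm x ^ (2 * m) * norm (h x))" by (simp add: algebra_simps)
    also have "\<dots> \<le> 2 ^ m * (\<bar>C0\<bar> + \<bar>C1\<bar>)"
      by (intro mult_left_mono add_mono order_trans[OF C0] order_trans[OF C1]) auto
    finally show ?thesis .
  qed
  then show ?thesis by (intro exI[of _ "2 ^ m * (\<bar>C0\<bar> + \<bar>C1\<bar>)"]) auto
qed

lemma rapidly_decaying_weight_bound:
  fixes h :: "'a::euclidean_space \<Rightarrow> complex"
  assumes "rapidly_decaying h"
  shows "\<exists>C\<ge>0. \<forall>x. norm (h x) * (1 + (norm x)\<^sup>2) ^ k \<le> C * euclidean_weight x"
proof -
  obtain C where C: "C \<ge> 0" "\<And>x. norm (h x) * (1 + (norm x)\<^sup>2) ^ (k + DIM('a)) \<le> C"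
    using rapidly_decaying_bound[OF assms] by blast
  have "norm (h x) * (1 + (norm x)\<^sup>2) ^ k \<le> C * euclidean_weight x" for x
  proof -
    have pos: "(1 + (norm x)\<^sup>2) ^ DIM('a) > 0" by (intro zero_less_power add_pos_nonneg) auto
    have "norm (h x) * (1 + (norm x)\<^sup>2) ^ k \<le> C * (1 / (1 + (norm x)\<^sup>2) ^ DIM('a))"
      using C(2)[of x] pos by (simp add: field_simps power_add)
    also have "\<dots> \<le> C * euclidean_weight x" by (intro mult_left_mono euclidean_weight_ge C)
    finally show ?thesis .
  qed
  then show ?thesis using C by blast
qed

lemma integrable_rapidly_decaying:
  assumes "rapidly_decaying h"
  shows "integrable lborel h"
proof -
  obtain C where C: "C \<ge> 0" "\<And>x. norm (h x) * (1 + (norm x)\<^sup>2) ^ 0 \<le> C * euclidean_weight x"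
    using rapidly_decaying_weight_bound[OF assms, of 0] by blast
  show ?thesis
  proof (rule Bochner_Integration.integrable_bound)
    show "integrable lborel (\<lambda>x. C * euclidean_weight x)" by (intro integrable_mult_right integrable_euclidean_weight)
    show "h \<in> borel_measurable lborel" using assms by (simp add: rapidly_decaying_def)
    show "AE x in lborel. norm (h x) \<le> norm (C * euclidean_weight x)"
      using C by (auto intro!: AE_I2 order_trans[OF _ abs_ge_self])
  qed
qed

lemma rapidly_decaying_dominated:
  assumes f: "rapidly_decaying f" and g: "g \<in> borel_measurable borel"
    and le: "\<And>x. norm (g x) \<le> K * norm (f x)" and K: "K \<ge> 0"
  shows "rapidly_decaying g"
  unfolding rapidly_decaying_def
proof (intro conjI allI g)
  fix k
  obtain C where C: "\<And>x. norm x ^ k * norm (f x) \<le> C" using f unfolding rapidly_decaying_def by blast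
  have "norm x ^ k * norm (g x) \<le> K * C" for x
  proof -
    have "norm x ^ k * norm (g x) \<le> norm x ^ k * (K * norm (f x))" by (intro mult_left_mono le) auto
    also have "\<dots> = K * (norm x ^ k * norm (f x))" by simp
    also have "\<dots> \<le> K * C" by (intro mult_left_mono C K)
    finally show ?thesis .
  qed
  then show "\<exists>C. \<forall>x. norm x ^ k * norm (g x) \<le> C" by blast
qed

lemma rapidly_decaying_add:
  assumes f: "rapidly_decaying f" and g: "rapidly_decaying g"
  shows "rapidly_decaying (\<lambda>x. f x + g x)"
  unfolding rapidly_decaying_def
proof (intro conjI allI)
  show "(\<lambda>x. f x + g x) \<in> borel_measurable borel" using f g by (auto simp: rapidly_decaying_def)
  fix k
  obtain C where C: "\<And>x. norm x ^ k * norm (f x) \<le> C" using f unfolding rapidly_decaying_def by blast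
  obtain D where D: "\<And>x. norm x ^ k * norm (g x) \<le> D" using g unfolding rapidly_decaying_def by blast
  have "norm x ^ k * norm (f x + g x) \<le> C + D" for x
  proof -
    have "norm x ^ k * norm (f x + g x) \<le> norm x ^ k * (norm (f x) + norm (g x))"
      by (intro mult_left_mono norm_triangle_ineq) auto
    then show ?thesis using C[of x] D[of x] by (simp add: distrib_left)
  qed
  then show "\<exists>C. \<forall>x. norm x ^ k * norm (f x + g x) \<le> C" by blast
qed

lemma iter_deriv_append: "iter_deriv (vs @ ws) f = iter_deriv vs (iter_deriv ws f)"
  by (induction vs) auto

lemma schwartz_iter_deriv: "schwartz f \<Longrightarrow> schwartz (iter_deriv ws f)"
  unfolding schwartz_def by (simp flip: iter_deriv_append)

lemma schwartz_frechet_derivative: "schwartz f \<Longrightarrow> schwartz (\<lambda>x. frechet_derivative f (at x) v)"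
  using schwartz_iter_deriv[of f "[v]"] by simp

lemma schwartz_differentiable: "schwartz f \<Longrightarrow> f differentiable (at x)"
  unfolding schwartz_def by (metis iter_deriv.simps(1))

lemma schwartz_measurable: "schwartz f \<Longrightarrow> f \<in> borel_measurable borel"
  by (intro borel_measurable_continuous_onI continuous_at_imp_continuous_on)
     (auto intro: differentiable_imp_continuous_within schwartz_differentiable)

lemma schwartz_rapidly_decaying:
  assumes "schwartz f"
  shows "rapidly_decaying f"
  unfolding rapidly_decaying_def
proof (intro conjI allI schwartz_measurable[OF assms])
  fix k :: nat
  have "bounded (range (\<lambda>x. norm x ^ k *\<^sub>R iter_deriv [] f x))" using assms unfolding schwartz_def by blast
  then obtain C where "\<And>x. norm (norm x ^ k *\<^sub>R f x) \<le> C" unfolding bounded_iff by auto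
  then show "\<exists>C. \<forall>x. norm x ^ k * norm (f x) \<le> C" by auto
qed

text \<open>Derivatives of the composite in directions vs are derivatives of f in directions T vs,
  taken at T x; injectivity bounds the norm of x by a multiple of that of T x.\<close>

lemma schwartz_compose_linear:
  fixes f :: "'a::euclidean_space \<Rightarrow> complex" and T :: "'a \<Rightarrow> 'a"
  assumes f: "schwartz f" and T: "linear T" "inj T"
  shows "schwartz (\<lambda>x. f (T x))"
proof -
  have bT: "bounded_linear T" using T linear_conv_bounded_linear by blast
  have eq: "iter_deriv vs (\<lambda>x. f (T x)) = (\<lambda>x. iter_deriv (map T vs) f (T x))" for vs
  proof (induction vs)
    case (Cons v vs)
    have "frechet_derivative (\<lambda>x. iter_deriv (map T vs) f (T x)) (at x) v =
      frechet_derivative (iter_deriv (map T vs) f) (at (T x)) (T v)" for x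
    proof -
      have "iter_deriv (map T vs) f differentiable (at (T x))" using f unfolding schwartz_def by blast
      then have "(iter_deriv (map T vs) f has_derivative frechet_derivative (iter_deriv (map T vs) f) (at (T x))) (at (T x))"
        by (simp add: frechet_derivative_works)
      from has_derivative_compose[OF bounded_linear_imp_has_derivative[OF bT] this]
      show ?thesis by (subst frechet_derivative_at[symmetric]) auto
    qed
    then show ?case by (simp add: Cons)
  qed simp
  obtain B where B: "B > 0" "\<And>x. B * norm x \<le> norm (T x)"
    using linear_inj_bounded_below_pos[OF T] by (auto simp: mult.commute)
  show ?thesis
    unfolding schwartz_def eq
  proof (intro allI conjI)
    fix vs :: "'a list" and x :: 'a
    have "iter_deriv (map T vs) f differentiable (at (T x))" using f unfolding schwartz_def by blast
    then show "(\<lambda>x. iter_deriv (map T vs) f (T x)) differentiable (at x)"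
      using has_derivative_compose[OF bounded_linear_imp_has_derivative[OF bT]] unfolding differentiable_def by blast
  next
    fix vs :: "'a list" and k :: nat
    have "bounded (range (\<lambda>x. norm x ^ k *\<^sub>R iter_deriv (map T vs) f x))" using f unfolding schwartz_def by blast
    then obtain C where C: "\<And>x. norm (norm x ^ k *\<^sub>R iter_deriv (map T vs) f x) \<le> C" unfolding bounded_iff by auto
    have "norm (norm x ^ k *\<^sub>R iter_deriv (map T vs) f (T x)) \<le> C / B ^ k" for x
    proof -
      have "(B * norm x) ^ k \<le> norm (T x) ^ k" using B by (intro power_mono) auto
      then have "(B * norm x) ^ k * norm (iter_deriv (map T vs) f (T x)) \<le> norm (T x) ^ k * norm (iter_deriv (map T vs) f (T x))"
        by (intro mult_right_mono) auto
      also have "\<dots> \<le> C" using C[of "T x"] by simp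
      finally show ?thesis using B(1) by (simp add: power_mult_distrib field_simps)
    qed
    then show "bounded (range (\<lambda>x. norm x ^ k *\<^sub>R iter_deriv (map T vs) f (T x)))" unfolding bounded_iff by blast
  qed
qed

lemma lborel_integral_translate:
  fixes f :: "'a::euclidean_space \<Rightarrow> complex"
  assumes "f \<in> borel_measurable borel"
  shows "(\<integral>x. f (c + x) \<partial>lborel) = (\<integral>x. f x \<partial>lborel)"
proof -
  have "(\<integral>x. f x \<partial>lborel) = (\<integral>x. f x \<partial>distr lborel borel ((+) c))" by (simp add: lborel_distr_plus)
  also have "\<dots> = (\<integral>x. f (c + x) \<partial>lborel)" by (rule integral_distr) (use assms in auto)
  finally show ?thesis by simp
qed

lemma lborel_integrable_translate:
  fixes f :: "'a::euclidean_space \<Rightarrow> complex"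
  assumes "integrable lborel f"
  shows "integrable lborel (\<lambda>x. f (c + x))"
proof -
  have "integrable (distr lborel borel ((+) c)) f" using assms by (simp add: lborel_distr_plus)
  then show ?thesis by (subst (asm) integrable_distr_eq) (use assms in auto)
qed

text \<open>A form of Peetre's inequality. It makes the domination of the difference quotients in
  \<open>integral_directional_derivative\<close> uniform in t.\<close>

lemma one_plus_norm_shift:
  fixes x v :: "'a::real_normed_vector"
  assumes "\<bar>t\<bar> \<le> 1"
  shows "1 + (norm x)\<^sup>2 \<le> (2 * (1 + (norm v)\<^sup>2)) * (1 + (norm (x + t *\<^sub>R v))\<^sup>2)"
proof -
  have "norm x \<le> norm (x + t *\<^sub>R v) + norm (t *\<^sub>R v)" using norm_triangle_ineq4[of "x + t *\<^sub>R v" "t *\<^sub>R v"] by simp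
  also have "norm (t *\<^sub>R v) \<le> norm v" using assms by (simp add: mult_left_le_one_le)
  finally have "norm x \<le> norm (x + t *\<^sub>R v) + norm v" by simp
  then have "(norm x)\<^sup>2 \<le> (norm (x + t *\<^sub>R v) + norm v)\<^sup>2" by (intro power_mono) auto
  also have "\<dots> \<le> 2 * (norm (x + t *\<^sub>R v))\<^sup>2 + 2 * (norm v)\<^sup>2"
    using sum_squares_bound[of "norm (x + t *\<^sub>R v)" "norm v"] by (simp add: power2_sum)
  finally have "1 + (norm x)\<^sup>2 \<le> 2 + 2 * (norm (x + t *\<^sub>R v))\<^sup>2 + 2 * (norm v)\<^sup>2" by simp
  moreover have "0 \<le> 2 * ((norm v)\<^sup>2 * (norm (x + t *\<^sub>R v))\<^sup>2)" by simp
  moreover have "(2 * (1 + (norm v)\<^sup>2)) * (1 + (norm (x + t *\<^sub>R v))\<^sup>2) =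
      2 + 2 * (norm (x + t *\<^sub>R v))\<^sup>2 + 2 * (norm v)\<^sup>2 + 2 * ((norm v)\<^sup>2 * (norm (x + t *\<^sub>R v))\<^sup>2)"
    by (simp add: algebra_simps)
  ultimately show ?thesis by linarith
qed

text \<open>The integral of the difference quotients vanishes by translation invariance.\<close>

lemma integral_directional_derivative:
  fixes h :: "'a::euclidean_space \<Rightarrow> complex"
  assumes der: "\<And>y. (h has_derivative h' y) (at y)" and h: "rapidly_decaying h"
    and D: "rapidly_decaying (\<lambda>y. h' y v)"
  shows "(\<integral>y. h' y v \<partial>lborel) = 0"
proof -
  obtain C where C: "C \<ge> 0" "\<And>y. norm (h' y v) * (1 + (norm y)\<^sup>2) ^ DIM('a) \<le> C"
    using rapidly_decaying_bound[OF D] by blast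
  define K where "K = C * (2 * (1 + (norm v)\<^sup>2)) ^ DIM('a)"
  have K: "norm (h' (y + t *\<^sub>R v) v) \<le> K * euclidean_weight y" if t: "\<bar>t\<bar> \<le> 1" for y t
  proof -
    have pos: "(1 + (norm z)\<^sup>2) ^ DIM('a) > 0" for z :: 'a by (intro zero_less_power add_pos_nonneg) auto
    have "norm (h' (y + t *\<^sub>R v) v) * (1 + (norm y)\<^sup>2) ^ DIM('a)
       \<le> norm (h' (y + t *\<^sub>R v) v) * ((2 * (1 + (norm v)\<^sup>2)) * (1 + (norm (y + t *\<^sub>R v))\<^sup>2)) ^ DIM('a)"
      by (intro mult_left_mono power_mono one_plus_norm_shift t) auto
    also have "\<dots> = (norm (h' (y + t *\<^sub>R v) v) * (1 + (norm (y + t *\<^sub>R v))\<^sup>2) ^ DIM('a)) * (2 * (1 + (norm v)\<^sup>2)) ^ DIM('a)"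
      by (simp add: power_mult_distrib mult_ac)
    also have "\<dots> \<le> K" unfolding K_def by (intro mult_right_mono C) auto
    finally have "norm (h' (y + t *\<^sub>R v) v) \<le> K * (1 / (1 + (norm y)\<^sup>2) ^ DIM('a))"
      using pos[of y] by (simp add: field_simps)
    also have "\<dots> \<le> K * euclidean_weight y"
      unfolding K_def by (intro mult_left_mono euclidean_weight_ge mult_nonneg_nonneg C) auto
    finally show ?thesis .
  qed
  define t where "t n = 1 / real (Suc n)" for n
  have t: "t n > 0" "t n \<le> 1" for n by (auto simp: t_def)
  have tl: "t \<longlonglongrightarrow> 0" unfolding t_def by (rule LIMSEQ_Suc[OF lim_1_over_n])
  define q where "q n y = (h (y + t n *\<^sub>R v) - h y) / of_real (t n)" for n y
  have line: "((\<lambda>s. h (y + s *\<^sub>R v)) has_vector_derivative h' (y + s *\<^sub>R v) v) (at s)" for y s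
  proof -
    have "((\<lambda>s. y + s *\<^sub>R v) has_derivative (\<lambda>r. r *\<^sub>R v)) (at s)" by (auto intro!: derivative_eq_intros)
    from has_derivative_compose[OF this der]
    have "((\<lambda>s. h (y + s *\<^sub>R v)) has_derivative (\<lambda>r. h' (y + s *\<^sub>R v) (r *\<^sub>R v))) (at s)" .
    moreover have "h' (y + s *\<^sub>R v) (r *\<^sub>R v) = r *\<^sub>R h' (y + s *\<^sub>R v) v" for r
      using has_derivative_linear[OF der] by (rule linear_scale)
    ultimately show ?thesis by (simp add: has_vector_derivative_def)
  qed
  have [measurable]: "h \<in> borel_measurable borel" using h by (rule rapidly_decaying_measurable)
  have ih: "integrable lborel h" using h by (rule integrable_rapidly_decaying)
  have ih': "integrable lborel (\<lambda>y. h (y + c))" for c using lborel_integrable_translate[OF ih, of c] by (simp add: add.commute)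
  have "(\<lambda>n. \<integral>y. q n y \<partial>lborel) \<longlonglongrightarrow> (\<integral>y. h' y v \<partial>lborel)"
  proof (rule integral_dominated_convergence[where w = "\<lambda>y. K * euclidean_weight y"])
    show "(\<lambda>y. h' y v) \<in> borel_measurable lborel" using D by (simp add: rapidly_decaying_def)
    show "q n \<in> borel_measurable lborel" for n unfolding q_def by measurable
    show "integrable lborel (\<lambda>y. K * euclidean_weight y)" by (intro integrable_mult_right integrable_euclidean_weight)
    show "AE y in lborel. (\<lambda>n. q n y) \<longlonglongrightarrow> h' y v"
    proof (rule AE_I2)
      fix y
      have "((\<lambda>s. h (y + s *\<^sub>R v)) has_vector_derivative h' y v) (at 0)" using line[of y 0] by simp
      then have "((\<lambda>s. (h (y + s *\<^sub>R v) - h y - s *\<^sub>R h' y v) /\<^sub>R \<bar>s\<bar>) \<longlongrightarrow> 0) (at 0)"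
        by (simp add: has_vector_derivative_def has_derivative_at_within)
      then have "(\<lambda>n. (h (y + t n *\<^sub>R v) - h y - t n *\<^sub>R h' y v) /\<^sub>R \<bar>t n\<bar>) \<longlonglongrightarrow> 0"
        by (rule filterlim_compose) (use t tl in \<open>auto simp: filterlim_at less_imp_neq[symmetric]\<close>)
      moreover have "(h (y + t n *\<^sub>R v) - h y - t n *\<^sub>R h' y v) /\<^sub>R \<bar>t n\<bar> = (h (y + t n *\<^sub>R v) - h y) /\<^sub>R t n - h' y v" for n
        using t[of n] by (simp add: scaleR_diff_right)
      ultimately have "(\<lambda>n. (h (y + t n *\<^sub>R v) - h y) /\<^sub>R t n) \<longlonglongrightarrow> h' y v"
        by (simp add: LIM_zero_iff)
      then show "(\<lambda>n. q n y) \<longlonglongrightarrow> h' y v" unfolding q_def by (simp add: scaleR_conv_of_real divide_inverse mult.commute)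
    qed
    show "AE y in lborel. norm (q n y) \<le> K * euclidean_weight y" for n
    proof (rule AE_I2)
      fix y
      \<comment> \<open>Mean value inequality on the segment from y to y + t n v, on all of which
        the derivative obeys the bound K.\<close>
      have "norm (h (y + t n *\<^sub>R v) - h (y + 0 *\<^sub>R v)) \<le> (K * euclidean_weight y) * norm (t n - 0)"
      proof (rule differentiable_bound[where S = "{0..t n}" and f = "\<lambda>s. h (y + s *\<^sub>R v)" and f' = "\<lambda>s r. r *\<^sub>R h' (y + s *\<^sub>R v) v"])
        fix s assume s: "s \<in> {0..t n}"
        show "((\<lambda>s. h (y + s *\<^sub>R v)) has_derivative (\<lambda>r. r *\<^sub>R h' (y + s *\<^sub>R v) v)) (at s within {0..t n})"
          using line[of y s] has_derivative_at_withinI unfolding has_vector_derivative_def by blast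
        have "\<bar>s\<bar> \<le> 1" using s t[of n] by auto
        then have "norm (h' (y + s *\<^sub>R v) v) \<le> K * euclidean_weight y" by (rule K)
        then show "onorm (\<lambda>r. r *\<^sub>R h' (y + s *\<^sub>R v) v) \<le> K * euclidean_weight y"
          by (intro onorm_le) (simp add: mult.commute mult_left_mono)
      qed (use t[of n] in auto)
      then show "norm (q n y) \<le> K * euclidean_weight y"
        using t[of n] by (simp add: q_def norm_divide field_simps)
    qed
  qed
  moreover have "(\<integral>y. q n y \<partial>lborel) = 0" for n
  proof -
    have "(\<integral>y. q n y \<partial>lborel) = ((\<integral>y. h (y + t n *\<^sub>R v) \<partial>lborel) - (\<integral>y. h y \<partial>lborel)) / of_real (t n)"
      unfolding q_def using ih ih' by simp
    also have "(\<integral>y. h (y + t n *\<^sub>R v) \<partial>lborel) = (\<integral>y. h y \<partial>lborel)"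
      using lborel_integral_translate[of h "t n *\<^sub>R v"] by (simp add: add.commute)
    finally show ?thesis by simp
  qed
  ultimately show ?thesis by (simp add: LIMSEQ_const_iff)
qed

section \<open>Decay of the Fourier transform of a Schwartz function\<close>

definition fourier :: "('a::euclidean_space \<Rightarrow> complex) \<Rightarrow> 'a \<Rightarrow> complex" where
  "fourier h x = (\<integral>y. exp (2 * \<i> * of_real pi * of_real (x \<bullet> y)) * h y \<partial>lborel)"

lemma norm_fourier_le:
  assumes "integrable lborel h"
  shows "norm (fourier h x) \<le> (\<integral>y. norm (h y) \<partial>lborel)"
proof -
  have "norm (fourier h x) \<le> (\<integral>y. norm (exp (2 * \<i> * of_real pi * of_real (x \<bullet> y)) * h y) \<partial>lborel)"
    unfolding fourier_def by (rule integral_norm_bound)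
  also have "\<dots> = (\<integral>y. norm (h y) \<partial>lborel)"
    by (simp add: norm_mult)
  finally show ?thesis .
qed

lemma fourier_measurable:
  assumes [measurable]: "h \<in> borel_measurable borel"
  shows "fourier h \<in> borel_measurable borel"
  unfolding fourier_def by measurable

text \<open>Integration by parts: the directional derivative of the character times g has integral
  0, and Leibniz' rule splits it into the two sides.\<close>

lemma fourier_frechet_derivative:
  fixes g :: "'a::euclidean_space \<Rightarrow> complex"
  assumes g: "schwartz g"
  shows "fourier (\<lambda>y. frechet_derivative g (at y) v) x = - (2 * \<i> * of_real pi * of_real (x \<bullet> v)) * fourier g x"
proof -
  let ?D = "\<lambda>y. frechet_derivative g (at y) v"
  let ?e = "\<lambda>y. exp (2 * \<i> * of_real pi * of_real (x \<bullet> y)) :: complex"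
  let ?c = "2 * \<i> * of_real pi * of_real (x \<bullet> v) :: complex"
  have [measurable]: "g \<in> borel_measurable borel" "?D \<in> borel_measurable borel"
    using g schwartz_measurable schwartz_frechet_derivative by blast+
  have dg: "(g has_derivative frechet_derivative g (at y)) (at y)" for y
    using schwartz_differentiable[OF g] by (simp add: frechet_derivative_works)
  have "((\<lambda>y. ?e y * g y) has_derivative (\<lambda>w. ?e y * frechet_derivative g (at y) w + (2 * \<i> * of_real pi * of_real (x \<bullet> w)) * ?e y * g y)) (at y)" for y
  proof -
    have "((\<lambda>y. 2 * \<i> * of_real pi * complex_of_real (x \<bullet> y)) has_derivative (\<lambda>w. 2 * \<i> * of_real pi * of_real (x \<bullet> w))) (at y)"
      by (intro derivative_intros)
    moreover have "(exp has_derivative (*) (exp z)) (at z)" for z :: complex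
      using DERIV_exp[of z] by (simp add: has_field_derivative_def)
    ultimately have "(?e has_derivative (\<lambda>w. ?e y * (2 * \<i> * of_real pi * of_real (x \<bullet> w)))) (at y)"
      by (rule has_derivative_compose)
    from has_derivative_mult[OF this dg] show ?thesis by (simp add: mult_ac)
  qed
  then have "(\<integral>y. ?e y * ?D y + ?c * ?e y * g y \<partial>lborel) = 0"
  proof (rule integral_directional_derivative)
    have rg: "rapidly_decaying g" and rD: "rapidly_decaying ?D"
      using g schwartz_rapidly_decaying schwartz_frechet_derivative by blast+
    show "rapidly_decaying (\<lambda>y. ?e y * g y)"
      by (rule rapidly_decaying_dominated[OF rg, where K = 1]) (auto simp: norm_mult)
    show "rapidly_decaying (\<lambda>y. ?e y * ?D y + ?c * ?e y * g y)"
      by (intro rapidly_decaying_add rapidly_decaying_dominated[OF rD, where K = 1] rapidly_decaying_dominated[OF rg, where K = "norm ?c"])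
         (auto simp: norm_mult)
  qed
  moreover have "integrable lborel (\<lambda>y. ?e y * ?D y)"
    by (rule integrable_rapidly_decaying, rule rapidly_decaying_dominated[OF schwartz_rapidly_decaying[OF schwartz_frechet_derivative[OF g]], where K = 1])
       (auto simp: norm_mult)
  moreover have "integrable lborel (\<lambda>y. ?e y * g y)"
    by (rule integrable_rapidly_decaying, rule rapidly_decaying_dominated[OF schwartz_rapidly_decaying[OF g], where K = 1])
       (auto simp: norm_mult)
  ultimately have "(\<integral>y. ?e y * ?D y \<partial>lborel) + ?c * (\<integral>y. ?e y * g y \<partial>lborel) = 0"
    by (simp add: mult.assoc)
  then show ?thesis unfolding fourier_def by (simp add: eq_neg_iff_add_eq_0)
qed

lemma fourier_iter_deriv:
  assumes "schwartz g"
  shows "fourier (iter_deriv (replicate k v) g) x = (- (2 * \<i> * of_real pi * of_real (x \<bullet> v))) ^ k * fourier g x"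
proof (induction k)
  case (Suc k)
  show ?case
    using fourier_frechet_derivative[OF schwartz_iter_deriv[OF assms, of "replicate k v"], of v x] Suc by simp
qed simp

text \<open>A power of one coordinate times the transform is, up to a constant, the transform of a
  repeated derivative of g, hence bounded.\<close>

lemma rapidly_decaying_fourier:
  fixes g :: "'a::euclidean_space \<Rightarrow> complex"
  assumes g: "schwartz g"
  shows "rapidly_decaying (fourier g)"
  unfolding rapidly_decaying_def
proof (intro conjI allI)
  show "fourier g \<in> borel_measurable borel" by (intro fourier_measurable schwartz_measurable g)
  fix k :: nat
  define I where "I b = (\<integral>y. norm (iter_deriv (replicate k b) g y) \<partial>lborel)" for b
  have b: "\<bar>x \<bullet> b\<bar> ^ k * norm (fourier g x) \<le> I b" for x b
  proof -
    have "\<bar>x \<bullet> b\<bar> ^ k \<le> (2 * pi * \<bar>x \<bullet> b\<bar>) ^ k"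
      using pi_ge_two mult_right_mono[of 1 "2 * pi" "\<bar>x \<bullet> b\<bar>"] by (intro power_mono) auto
    then have "\<bar>x \<bullet> b\<bar> ^ k * norm (fourier g x) \<le> (2 * pi * \<bar>x \<bullet> b\<bar>) ^ k * norm (fourier g x)"
      by (intro mult_right_mono) auto
    also have "\<dots> = norm (fourier (iter_deriv (replicate k b) g) x)"
      unfolding fourier_iter_deriv[OF g] by (simp add: norm_mult norm_power)
    also have "\<dots> \<le> I b" unfolding I_def
      by (intro norm_fourier_le integrable_rapidly_decaying schwartz_rapidly_decaying schwartz_iter_deriv g)
    finally show ?thesis .
  qed
  have "norm x ^ k * norm (fourier g x) \<le> real DIM('a) ^ k * (\<Sum>b\<in>Basis. I b)" for x
  proof -
    \<comment> \<open>The norm is at most \<open>DIM('a)\<close> times the largest coordinate, so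
      that only repeated derivatives in a single direction are needed, never mixed ones.\<close>
    define m where "m = Max ((\<lambda>b. \<bar>x \<bullet> b\<bar>) ` Basis)"
    have "m \<in> (\<lambda>b. \<bar>x \<bullet> b\<bar>) ` Basis" unfolding m_def by (rule Max_in) auto
    then obtain b0 where b0: "b0 \<in> Basis" "m = \<bar>x \<bullet> b0\<bar>" by blast
    have "norm x \<le> (\<Sum>b\<in>Basis. \<bar>x \<bullet> b\<bar>)" by (rule norm_le_l1)
    also have "\<dots> \<le> (\<Sum>b\<in>(Basis::'a set). m)" by (intro sum_mono) (simp add: m_def)
    finally have "norm x ^ k \<le> (real DIM('a) * m) ^ k" by (intro power_mono) auto
    then have "norm x ^ k * norm (fourier g x) \<le> (real DIM('a) * m) ^ k * norm (fourier g x)"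
      by (intro mult_right_mono) auto
    also have "\<dots> = real DIM('a) ^ k * (\<bar>x \<bullet> b0\<bar> ^ k * norm (fourier g x))" by (simp add: b0 power_mult_distrib)
    also have "\<dots> \<le> real DIM('a) ^ k * I b0" by (intro mult_left_mono b) auto
    also have "I b0 \<le> (\<Sum>b\<in>Basis. I b)"
      by (rule member_le_sum[OF b0(1)]) (auto simp: I_def)
    finally show ?thesis by (simp add: mult_left_mono)
  qed
  then show "\<exists>C. \<forall>x. norm x ^ k * norm (fourier g x) \<le> C" by blast
qed

subsection \<open>Theta integrals and their Mellin transforms\<close>

lemma lorentz_altdef:
  assumes "e \<in> Basis"
  shows "lorentz e x = (x \<bullet> e)\<^sup>2 - (norm x)\<^sup>2 / 2"
proof -
  have "(norm x)\<^sup>2 = (\<Sum>b\<in>Basis. (x \<bullet> b)\<^sup>2)"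
    unfolding power2_norm_eq_inner by (subst euclidean_inner) (simp add: power2_eq_square)
  also have "\<dots> = (x \<bullet> e)\<^sup>2 + (\<Sum>b\<in>Basis - {e}. (x \<bullet> b)\<^sup>2)" by (rule sum.remove) (use assms in auto)
  finally show ?thesis by (simp add: lorentz_def field_simps)
qed

lemma abs_lorentz_le:
  assumes "e \<in> Basis"
  shows "\<bar>lorentz e x\<bar> \<le> 1 + (norm x)\<^sup>2"
proof -
  have "(x \<bullet> e)\<^sup>2 \<le> (norm x)\<^sup>2" using Basis_le_norm[OF assms, of x] by (metis abs_le_square_iff abs_norm_cancel)
  then show ?thesis using zero_le_power2[of "x \<bullet> e"] zero_le_power2[of "norm x"] unfolding lorentz_altdef[OF assms] by linarith
qed

lemma norm_of_real_powr: "norm (complex_of_real \<bar>q\<bar> powr s) = \<bar>q\<bar> powr Re s"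
  by (cases "q = 0") (simp_all add: norm_powr_real_powr)

text \<open>The first term rules for |q| \<le> 1, the second for |q| > 1. Neither depends on
  \<sigma>, so the bound is uniform on vertical strips, as holomorphy in s demands.\<close>

lemma abs_powr_le:
  fixes q \<sigma> :: real
  assumes "-1/4 \<le> \<sigma>" "\<sigma> \<le> real N"
  shows "\<bar>q\<bar> powr \<sigma> \<le> \<bar>q\<bar> powr (-1/4) + \<bar>q\<bar> ^ N"
proof (cases "q = 0")
  case False
  show ?thesis
  proof (cases "\<bar>q\<bar> \<le> 1")
    case True
    then have "\<bar>q\<bar> powr \<sigma> \<le> \<bar>q\<bar> powr (-1/4)" using False assms by (intro powr_mono') auto
    then show ?thesis by (simp add: add_increasing2)
  next
    case F: False
    then have "\<bar>q\<bar> powr \<sigma> \<le> \<bar>q\<bar> powr real N" using assms by (intro powr_mono) auto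
    also have "\<dots> = \<bar>q\<bar> ^ N" using False by (simp add: powr_realpow)
    finally show ?thesis by (simp add: add_increasing)
  qed
qed simp

lemma integrable_lorentz_bound:
  fixes h :: "'a::euclidean_space \<Rightarrow> complex"
  assumes e: "e \<in> Basis" and h: "rapidly_decaying h"
  shows "integrable lborel (\<lambda>x. norm (h x) * (\<bar>lorentz e x\<bar> powr (-1/4) + \<bar>lorentz e x\<bar> ^ N))"
proof -
  obtain C where C: "C \<ge> 0" "\<And>x. norm (h x) * (1 + (norm x)\<^sup>2) ^ 0 \<le> C * euclidean_weight x"
    using rapidly_decaying_weight_bound[OF h, of 0] by blast
  obtain D where D: "D \<ge> 0" "\<And>x. norm (h x) * (1 + (norm x)\<^sup>2) ^ N \<le> D * euclidean_weight x"
    using rapidly_decaying_weight_bound[OF h, of N] by blast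
  have [measurable]: "h \<in> borel_measurable borel" using h by (rule rapidly_decaying_measurable)
  show ?thesis
  proof (rule Bochner_Integration.integrable_bound)
    show "integrable lborel (\<lambda>x. C * (\<bar>lorentz e x\<bar> powr (-1/4) * euclidean_weight x) + D * euclidean_weight x)"
      by (intro Bochner_Integration.integrable_add integrable_mult_right integrable_euclidean_weight integrable_lorentz_powr_weight e)
    show "(\<lambda>x. norm (h x) * (\<bar>lorentz e x\<bar> powr (-1/4) + \<bar>lorentz e x\<bar> ^ N)) \<in> borel_measurable lborel" by measurable
    show "AE x in lborel. norm (norm (h x) * (\<bar>lorentz e x\<bar> powr (-1/4) + \<bar>lorentz e x\<bar> ^ N))
      \<le> norm (C * (\<bar>lorentz e x\<bar> powr (-1/4) * euclidean_weight x) + D * euclidean_weight x)"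
    proof (rule AE_I2)
      fix x
      have "norm (h x) * \<bar>lorentz e x\<bar> powr (-1/4) \<le> C * (\<bar>lorentz e x\<bar> powr (-1/4) * euclidean_weight x)"
        using mult_right_mono[OF C(2)[of x], of "\<bar>lorentz e x\<bar> powr (-1/4)"] by (simp add: mult_ac)
      moreover have "norm (h x) * \<bar>lorentz e x\<bar> ^ N \<le> norm (h x) * (1 + (norm x)\<^sup>2) ^ N"
        by (intro mult_left_mono power_mono abs_lorentz_le e) auto
      ultimately have "norm (h x) * (\<bar>lorentz e x\<bar> powr (-1/4) + \<bar>lorentz e x\<bar> ^ N)
         \<le> C * (\<bar>lorentz e x\<bar> powr (-1/4) * euclidean_weight x) + D * euclidean_weight x"
        using D(2)[of x] by (simp add: distrib_left)
      then show "norm (norm (h x) * (\<bar>lorentz e x\<bar> powr (-1/4) + \<bar>lorentz e x\<bar> ^ N))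
        \<le> norm (C * (\<bar>lorentz e x\<bar> powr (-1/4) * euclidean_weight x) + D * euclidean_weight x)"
        by (auto simp: abs_mult intro!: order_trans[OF _ abs_ge_self])
    qed
  qed
qed

text \<open>The parity is passed as a function u of the value of the form; convergence and
  holomorphy are then shown once for all bounded measurable u.\<close>

definition lorentz_zeta :: "'a::euclidean_space \<Rightarrow> (real \<Rightarrow> complex) \<Rightarrow> ('a \<Rightarrow> complex) \<Rightarrow> complex \<Rightarrow> complex" where
  "lorentz_zeta e u h s = (\<integral>x. h x * (u (lorentz e x) * of_real \<bar>lorentz e x\<bar> powr s) \<partial>lborel)"

context
  fixes e :: "'a::euclidean_space" and h :: "'a \<Rightarrow> complex" and u :: "real \<Rightarrow> complex"
  assumes e: "e \<in> Basis" and h: "rapidly_decaying h"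
    and u[measurable]: "u \<in> borel_measurable borel" and u1: "\<And>q. norm (u q) \<le> 1"
begin

lemma lorentz_zeta_integrand_bound:
  assumes "-1/4 \<le> Re s" "Re s \<le> real N"
  shows "norm (h x * (u (lorentz e x) * of_real \<bar>lorentz e x\<bar> powr s))
    \<le> norm (h x) * (\<bar>lorentz e x\<bar> powr (-1/4) + \<bar>lorentz e x\<bar> ^ N)"
proof -
  have "norm (u (lorentz e x) * of_real \<bar>lorentz e x\<bar> powr s) \<le> 1 * (\<bar>lorentz e x\<bar> powr (-1/4) + \<bar>lorentz e x\<bar> ^ N)"
    unfolding norm_mult norm_of_real_powr by (intro mult_mono u1 abs_powr_le assms) auto
  then show ?thesis by (subst norm_mult) (intro mult_left_mono, auto)
qed

lemma lorentz_zeta_measurable: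
  "(\<lambda>x. h x * (u (lorentz e x) * of_real \<bar>lorentz e x\<bar> powr s)) \<in> borel_measurable borel"
  using rapidly_decaying_measurable[OF h] by measurable

lemma lorentz_zeta_integrable:
  assumes "-1/4 \<le> Re s"
  shows "integrable lborel (\<lambda>x. h x * (u (lorentz e x) * of_real \<bar>lorentz e x\<bar> powr s))"
proof -
  obtain N where "Re s \<le> real N" using real_arch_simple by blast
  then show ?thesis
    using lorentz_zeta_measurable lorentz_zeta_integrand_bound[OF assms]
    by (intro Bochner_Integration.integrable_bound[OF integrable_lorentz_bound[OF e h, of N]])
       (auto intro!: AE_I2 order_trans[OF _ abs_ge_self])
qed

lemma lorentz_zeta_holomorphic: "lorentz_zeta e u h holomorphic_on {s. Re s > -1/4}"
  unfolding lorentz_zeta_def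
proof (rule holomorphic_on_integral_param)
  show "(\<lambda>s. h x * (u (lorentz e x) * of_real \<bar>lorentz e x\<bar> powr s)) holomorphic_on {s. Re s > -1/4}" for x
    by (cases "lorentz e x = 0") (auto intro!: holomorphic_intros)
  show "(\<lambda>x. h x * (u (lorentz e x) * of_real \<bar>lorentz e x\<bar> powr s)) \<in> borel_measurable lborel" for s
    using lorentz_zeta_measurable by simp
  fix s assume "s \<in> {s. - 1 / 4 < Re s}"
  then have s: "Re s > -1/4" by simp
  define r where "r = (Re s + 1/4) / 2"
  have r: "r > 0" using s by (simp add: r_def)
  obtain N where N: "Re s + r \<le> real N" using real_arch_simple by blast
  have cb: "-1/4 < Re z \<and> Re z \<le> real N" if "z \<in> cball s r" for z
    using Re_in_cball[OF that] s r N by (auto simp: r_def field_simps)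
  show "\<exists>r>0. \<exists>w. cball s r \<subseteq> {s. - 1 / 4 < Re s} \<and> integrable lborel w \<and>
     (\<forall>z\<in>cball s r. \<forall>x\<in>space lborel. norm (h x * (u (lorentz e x) * of_real \<bar>lorentz e x\<bar> powr z)) \<le> w x)"
  proof (intro exI conjI ballI)
    show "r > 0" by fact
    show "cball s r \<subseteq> {s. - 1 / 4 < Re s}" using cb by fastforce
    show "integrable lborel (\<lambda>x. norm (h x) * (\<bar>lorentz e x\<bar> powr (-1/4) + \<bar>lorentz e x\<bar> ^ N))"
      by (rule integrable_lorentz_bound[OF e h])
    show "norm (h x * (u (lorentz e x) * of_real \<bar>lorentz e x\<bar> powr z)) \<le> norm (h x) * (\<bar>lorentz e x\<bar> powr (-1/4) + \<bar>lorentz e x\<bar> ^ N)"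
      if "z \<in> cball s r" for z x
      using cb[OF that] by (intro lorentz_zeta_integrand_bound) auto
  qed
qed

end

section \<open>Theta integrals and the strip of their Mellin transforms\<close>

definition theta :: "'a::euclidean_space \<Rightarrow> ('a \<Rightarrow> complex) \<Rightarrow> real \<Rightarrow> complex" where
  "theta e h t = (\<integral>x. h x * exp (\<i> * of_real (pi * t * lorentz e x)) \<partial>lborel)"

lemma theta_measurable:
  assumes [measurable]: "h \<in> borel_measurable borel"
  shows "theta e h \<in> borel_measurable borel"
  unfolding theta_def by measurable

lemma norm_theta_le: "norm (theta e h t) \<le> (\<integral>x. norm (h x) \<partial>lborel)"
proof -
  have "norm (theta e h t) \<le> (\<integral>x. norm (h x * exp (\<i> * of_real (pi * t * lorentz e x))) \<partial>lborel)"
    unfolding theta_def by (rule integral_norm_bound)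
  then show ?thesis by (simp add: norm_mult)
qed

text \<open>The integral of |t|^(-s-1) against the theta integral over the half-line of sign \<tau>,
  written with t = \<tau> exp x.\<close>

definition mellin_theta :: "'a::euclidean_space \<Rightarrow> ('a \<Rightarrow> complex) \<Rightarrow> real \<Rightarrow> complex \<Rightarrow> complex" where
  "mellin_theta e h \<tau> s = (\<integral>x. exp (- s * of_real x) * theta e h (\<tau> * exp x) \<partial>lborel)"

lemma exp_neg_abs_le_cauchy_weight:
  assumes "c > 0"
  shows "\<exists>K. \<forall>x. exp (- (c * \<bar>x\<bar>)) \<le> K * cauchy_weight x"
proof (intro exI allI)
  fix x :: real
  let ?m = "min 1 (c\<^sup>2 / 2)"
  have m: "?m > 0" using assms by simp
  have "?m * (1 + x\<^sup>2) \<le> 1 + (c\<^sup>2 / 2) * x\<^sup>2"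
    unfolding distrib_left by (intro add_mono mult_right_mono) auto
  also have "\<dots> \<le> 1 + c * \<bar>x\<bar> + (c * \<bar>x\<bar>)\<^sup>2 / 2" using assms by (simp add: power_mult_distrib)
  also have "\<dots> \<le> exp (c * \<bar>x\<bar>)" by (rule exp_lower_Taylor_quadratic) (use assms in auto)
  finally have "1 / exp (c * \<bar>x\<bar>) \<le> 1 / (?m * (1 + x\<^sup>2))"
    using m by (intro divide_left_mono mult_pos_pos) (auto intro: add_pos_nonneg)
  then show "exp (- (c * \<bar>x\<bar>)) \<le> (1 / ?m) * cauchy_weight x"
    by (simp add: exp_minus cauchy_weight_def inverse_eq_divide)
qed

lemma integrable_exp_neg_abs:
  assumes "c > 0"
  shows "integrable lborel (\<lambda>x::real. exp (- (c * \<bar>x\<bar>)))"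
proof -
  obtain K where K: "\<And>x. exp (- (c * \<bar>x\<bar>)) \<le> K * cauchy_weight x"
    using exp_neg_abs_le_cauchy_weight[OF assms] by blast
  show ?thesis
    by (rule Bochner_Integration.integrable_bound[OF integrable_mult_right[OF integrable_cauchy_weight, of K]])
       (auto intro!: AE_I2 order_trans[OF K] abs_ge_self)
qed

text \<open>The order of decay is that of the Weil factor. It is obtained in
  \<open>theta_dual_decays\<close> from the boundedness of the dual theta integral.\<close>

definition theta_decays :: "'a::euclidean_space \<Rightarrow> ('a \<Rightarrow> complex) \<Rightarrow> bool" where
  "theta_decays e h \<longleftrightarrow> (\<exists>K. \<forall>t. t \<noteq> 0 \<longrightarrow> norm (theta e h t) \<le> K * \<bar>t\<bar> powr (- real DIM('a) / 2))"

context
  fixes e :: "'a::euclidean_space" and h :: "'a \<Rightarrow> complex" and \<tau> :: real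
  assumes e: "e \<in> Basis" and h: "rapidly_decaying h" and dec: "theta_decays e h" and \<tau>: "\<bar>\<tau>\<bar> = 1"
begin

text \<open>For x \<ge> 0 the decay of theta is used, for x < 0 its boundedness. The number a
  measures the distance of s to the edges of the strip.\<close>

lemma mellin_theta_integrand_bound:
  "\<exists>K\<ge>0. \<forall>s x a. - real DIM('a) / 2 + a \<le> Re s \<longrightarrow> Re s \<le> - a \<longrightarrow>
     norm (exp (- s * of_real x) * theta e h (\<tau> * exp x)) \<le> K * exp (- (a * \<bar>x\<bar>))"
proof -
  obtain K where K: "\<And>t. t \<noteq> 0 \<Longrightarrow> norm (theta e h t) \<le> K * \<bar>t\<bar> powr (- real DIM('a) / 2)"
    using dec unfolding theta_decays_def by blast
  define L where "L = max \<bar>K\<bar> (\<integral>x. norm (h x) \<partial>lborel)"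
  have "norm (exp (- s * of_real x) * theta e h (\<tau> * exp x)) \<le> L * exp (- (a * \<bar>x\<bar>))"
    if a: "- real DIM('a) / 2 + a \<le> Re s" "Re s \<le> - a" for s x a
  proof (cases "x \<ge> 0")
    case True
    have "\<tau> * exp x \<noteq> 0" using \<tau> by auto
    then have "norm (theta e h (\<tau> * exp x)) \<le> K * \<bar>\<tau> * exp x\<bar> powr (- real DIM('a) / 2)" by (rule K)
    also have "\<dots> = K * exp (- (real DIM('a) / 2) * x)" using \<tau> by (simp add: abs_mult powr_def)
    also have "\<dots> \<le> L * exp (- (real DIM('a) / 2) * x)" by (intro mult_right_mono) (auto simp: L_def)
    finally have "norm (exp (- s * of_real x) * theta e h (\<tau> * exp x)) \<le> exp (- (Re s * x)) * (L * exp (- (real DIM('a) / 2) * x))"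
      by (subst norm_mult) (intro mult_mono, auto)
    also have "\<dots> = L * exp (- ((Re s + real DIM('a) / 2) * x))" by (simp add: algebra_simps flip: exp_add)
    also have "\<dots> \<le> L * exp (- (a * \<bar>x\<bar>))"
    proof (intro mult_left_mono)
      have "a * x \<le> (Re s + real DIM('a) / 2) * x" using True a by (intro mult_right_mono) auto
      then show "exp (- ((Re s + real DIM('a) / 2) * x)) \<le> exp (- (a * \<bar>x\<bar>))" using True by simp
    qed (simp add: L_def)
    finally show ?thesis .
  next
    case False
    have "norm (theta e h (\<tau> * exp x)) \<le> L" unfolding L_def by (rule order_trans[OF norm_theta_le]) simp
    then have "norm (exp (- s * of_real x) * theta e h (\<tau> * exp x)) \<le> exp (- (Re s * x)) * L"
      by (subst norm_mult) (intro mult_mono, auto)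
    also have "\<dots> \<le> exp (- (a * \<bar>x\<bar>)) * L"
    proof (intro mult_right_mono)
      have "(- a) * x \<le> Re s * x" using False a by (intro mult_right_mono_neg) auto
      then show "exp (- (Re s * x)) \<le> exp (- (a * \<bar>x\<bar>))" using False by simp
    qed (simp add: L_def)
    finally show ?thesis by (simp add: mult.commute)
  qed
  then show ?thesis by (intro exI[of _ L]) (auto simp: L_def)
qed

lemma mellin_theta_measurable:
  "(\<lambda>x. exp (- s * of_real x) * theta e h (\<tau> * exp x)) \<in> borel_measurable borel"
  using theta_measurable[OF rapidly_decaying_measurable[OF h], of e] by measurable

lemma mellin_theta_integrable:
  assumes "- real DIM('a) / 2 < Re s" "Re s < 0"
  shows "integrable lborel (\<lambda>x. exp (- s * of_real x) * theta e h (\<tau> * exp x))"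
proof -
  obtain K where K: "K \<ge> 0" "\<And>s x a. - real DIM('a) / 2 + a \<le> Re s \<Longrightarrow> Re s \<le> - a \<Longrightarrow>
     norm (exp (- s * of_real x) * theta e h (\<tau> * exp x)) \<le> K * exp (- (a * \<bar>x\<bar>))"
    using mellin_theta_integrand_bound by blast
  define a where "a = min (- Re s) (Re s + real DIM('a) / 2)"
  have a: "a > 0" "- real DIM('a) / 2 + a \<le> Re s" "Re s \<le> - a" using assms by (auto simp: a_def min_def)
  show ?thesis
    using K(2)[OF a(2,3)] mellin_theta_measurable
    by (intro Bochner_Integration.integrable_bound[OF integrable_mult_right[OF integrable_exp_neg_abs[OF a(1)], of K]])
       (auto intro!: AE_I2 order_trans[OF _ abs_ge_self])
qed

lemma mellin_theta_holomorphic: "mellin_theta e h \<tau> holomorphic_on {s. - real DIM('a) / 2 < Re s \<and> Re s < 0}"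
  unfolding mellin_theta_def
proof (rule holomorphic_on_integral_param)
  show "(\<lambda>s. exp (- s * of_real x) * theta e h (\<tau> * exp x)) holomorphic_on {s. - real DIM('a) / 2 < Re s \<and> Re s < 0}" for x
    by (auto intro!: holomorphic_intros)
  show "(\<lambda>x. exp (- s * of_real x) * theta e h (\<tau> * exp x)) \<in> borel_measurable lborel" for s
    using mellin_theta_measurable by simp
  fix s assume s: "s \<in> {s. - real DIM('a) / 2 < Re s \<and> Re s < 0}"
  obtain K where K: "K \<ge> 0" "\<And>s x a. - real DIM('a) / 2 + a \<le> Re s \<Longrightarrow> Re s \<le> - a \<Longrightarrow>
     norm (exp (- s * of_real x) * theta e h (\<tau> * exp x)) \<le> K * exp (- (a * \<bar>x\<bar>))"
    using mellin_theta_integrand_bound by blast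
  define a where "a = min (- Re s) (Re s + real DIM('a) / 2) / 2"
  have a: "a > 0" "- real DIM('a) / 2 + 2 * a \<le> Re s" "Re s \<le> - (2 * a)" using s by (auto simp: a_def min_def field_simps)
  have cb: "- real DIM('a) / 2 + a \<le> Re z \<and> Re z \<le> - a" if "z \<in> cball s a" for z
    using Re_in_cball[OF that] a by linarith
  show "\<exists>r>0. \<exists>w. cball s r \<subseteq> {s. - real DIM('a) / 2 < Re s \<and> Re s < 0} \<and> integrable lborel w \<and>
     (\<forall>z\<in>cball s r. \<forall>x\<in>space lborel. norm (exp (- z * of_real x) * theta e h (\<tau> * exp x)) \<le> w x)"
  proof (intro exI conjI ballI)
    show "a > 0" by fact
    show "integrable lborel (\<lambda>x. K * exp (- (a * \<bar>x\<bar>)))" by (intro integrable_mult_right integrable_exp_neg_abs a)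
    show "cball s a \<subseteq> {s. - real DIM('a) / 2 < Re s \<and> Re s < 0}" using cb a(1) by fastforce
    show "norm (exp (- z * of_real x) * theta e h (\<tau> * exp x)) \<le> K * exp (- (a * \<bar>x\<bar>))" if "z \<in> cball s a" for z x
      using K(2) cb[OF that] by blast
  qed
qed

end

definition parity_one :: "real \<Rightarrow> complex" where "parity_one q = 1"
definition parity_sgn :: "real \<Rightarrow> complex" where "parity_sgn q = of_real (sgn q)"

lemma parity_measurable [measurable]:
  "parity_one \<in> borel_measurable borel" "parity_sgn \<in> borel_measurable borel"
  unfolding parity_one_def parity_sgn_def by measurable

lemma norm_parity_le: "norm (parity_one q) \<le> 1" "norm (parity_sgn q) \<le> 1"
  by (auto simp: parity_one_def parity_sgn_def sgn_if)

text \<open>Gamma(-s) times the integral of h against the power s of - i pi \<tau> Q. The power has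
  phase exp (- i \<tau> sgn(Q) pi s / 2), whose cosine part goes with the even zeta integral and
  whose sine part goes with the odd one.\<close>

definition mellin_factor :: "'a::euclidean_space \<Rightarrow> ('a \<Rightarrow> complex) \<Rightarrow> real \<Rightarrow> complex \<Rightarrow> complex" where
  "mellin_factor e h \<tau> s = Gamma (- s) * of_real pi powr s *
     (cos (of_real pi * s / 2) * lorentz_zeta e parity_one h s
       - \<i> * of_real \<tau> * sin (of_real pi * s / 2) * lorentz_zeta e parity_sgn h s)"

lemma powr_imaginary:
  fixes q :: real
  assumes "q \<noteq> 0"
  shows "(- (\<i> * of_real (pi * q))) powr s = of_real pi powr s * of_real \<bar>q\<bar> powr s *
     (cos (of_real pi * s / 2) - \<i> * of_real (sgn q) * sin (of_real pi * s / 2))"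
proof -
  have "of_real pi powr s * of_real \<bar>q\<bar> powr s = of_real (pi * \<bar>q\<bar>) powr s"
    using powr_times_real[of "of_real pi" "of_real \<bar>q\<bar>" s] by (simp add: powr_times_real)
  moreover have "(- (\<i> * of_real (pi * q))) powr s = of_real (pi * \<bar>q\<bar>) powr s * exp (- (\<i> * of_real (sgn q) * (of_real pi * s / 2)))"
  proof -
    have e: "exp (- (\<i> * of_real (sgn q * (pi / 2)))) = - (\<i> * of_real (sgn q))"
    proof (cases "q > 0")
      case True
      have "exp (- (\<i> * of_real (pi / 2))) = - \<i>"
        unfolding exp_minus cis_conv_exp[symmetric] by simp
      then show ?thesis using True by simp
    next
      case False
      have "exp (\<i> * of_real (pi / 2)) = \<i>"
        unfolding cis_conv_exp[symmetric] by simp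
      then show ?thesis using False assms by simp
    qed
    have "exp (of_real (ln (pi * \<bar>q\<bar>))) = complex_of_real (pi * \<bar>q\<bar>)"
      using assms by (subst exp_of_real) simp
    then have "exp (of_real (ln (pi * \<bar>q\<bar>)) + - (\<i> * of_real (sgn q * (pi / 2)))) = - (\<i> * of_real (pi * q))"
      unfolding exp_add e by (simp add: sgn_if abs_if)
    then have Ln: "Ln (- (\<i> * of_real (pi * q))) = of_real (ln (pi * \<bar>q\<bar>)) + - (\<i> * of_real (sgn q * (pi / 2)))"
      by (rule Ln_unique) (use pi_ge_two in \<open>auto simp: sgn_if\<close>)
    have "(- (\<i> * of_real (pi * q))) powr s = exp (s * Ln (- (\<i> * of_real (pi * q))))"
      using assms by (simp add: powr_def)
    also have "\<dots> = exp (s * of_real (ln (pi * \<bar>q\<bar>)) + - (\<i> * of_real (sgn q) * (of_real pi * s / 2)))"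
      unfolding Ln by (simp add: algebra_simps)
    also have "\<dots> = exp (s * of_real (ln (pi * \<bar>q\<bar>))) * exp (- (\<i> * of_real (sgn q) * (of_real pi * s / 2)))"
      by (rule exp_add)
    also have "exp (s * of_real (ln (pi * \<bar>q\<bar>))) = of_real (pi * \<bar>q\<bar>) powr s"
      using assms Ln_of_real[of "pi * \<bar>q\<bar>"] by (simp add: powr_def)
    finally show ?thesis .
  qed
  moreover have "exp (- (\<i> * of_real (sgn q) * (of_real pi * s / 2))) = cos (of_real pi * s / 2) - \<i> * of_real (sgn q) * sin (of_real pi * s / 2)"
  proof -
    have "exp (- (\<i> * z)) = cos z - \<i> * sin z" for z
      using exp_Euler[of "- z"] by simp
    moreover have "exp (\<i> * z) = cos z + \<i> * sin z" for z by (rule exp_Euler)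
    ultimately have "exp (- (\<i> * of_real (sgn q) * z)) = cos z - \<i> * of_real (sgn q) * sin z" for z
      using assms by (cases "q > 0") simp_all
    then show ?thesis .
  qed
  ultimately show ?thesis by simp
qed

text \<open>The principal argument is at most pi in modulus, so the bound depends on w only through
  a lower bound of its modulus; in the limit \<delta> to 0 that lower bound is pi |Q|.\<close>

lemma norm_powr_le:
  assumes "w \<noteq> 0" "Re s \<le> 0" "0 < r" "r \<le> norm w"
  shows "norm (w powr s) \<le> r powr Re s * exp (pi * \<bar>Im s\<bar>)"
proof -
  have "norm (w powr s) = norm w powr Re s * exp (- (Im s * Im (Ln w)))"
    using assms by (simp add: powr_def exp_diff exp_minus divide_inverse)
  also have "\<dots> \<le> r powr Re s * exp (pi * \<bar>Im s\<bar>)"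
  proof (intro mult_mono)
    show "norm w powr Re s \<le> r powr Re s" using assms by (intro powr_mono2') auto
    have "\<bar>Im (Ln w)\<bar> \<le> pi" using Im_Ln_le_pi[of w] mpi_less_Im_Ln[of w] assms by auto
    then have "\<bar>Im s * Im (Ln w)\<bar> \<le> pi * \<bar>Im s\<bar>"
      using mult_left_mono[of "\<bar>Im (Ln w)\<bar>" pi "\<bar>Im s\<bar>"] by (simp add: abs_mult mult.commute)
    then show "exp (- (Im s * Im (Ln w))) \<le> exp (pi * \<bar>Im s\<bar>)" by simp
  qed auto
  finally show ?thesis .
qed

lemma integrable_tensor:
  fixes f g :: "_ \<Rightarrow> complex"
  assumes f: "integrable lborel (f :: 'a::euclidean_space \<Rightarrow> complex)" and g: "integrable lborel (g :: 'b::euclidean_space \<Rightarrow> complex)"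
    and m: "F \<in> borel_measurable (lborel \<Otimes>\<^sub>M lborel)"
    and le: "\<And>x y. norm (F (x, y)) \<le> norm (f x) * norm (g y)"
  shows "integrable (lborel \<Otimes>\<^sub>M lborel) (F :: 'a \<times> 'b \<Rightarrow> complex)"
proof (rule Bochner_Integration.integrable_bound)
  have [measurable]: "f \<in> borel_measurable borel" "g \<in> borel_measurable borel" using f g by auto
  show "integrable (lborel \<Otimes>\<^sub>M lborel) (\<lambda>(x, y). norm (f x) * norm (g y))"
  proof (rule lborel_pair.Fubini_integrable)
    show "(\<lambda>(x, y). norm (f x) * norm (g y)) \<in> borel_measurable (lborel \<Otimes>\<^sub>M lborel)" by measurable
    show "integrable lborel (\<lambda>x. \<integral>y. norm (case (x, y) of (x, y) \<Rightarrow> norm (f x) * norm (g y)) \<partial>lborel)"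
      using f by (simp add: abs_mult)
    show "AE x in lborel. integrable lborel (\<lambda>y. case (x, y) of (x, y) \<Rightarrow> norm (f x) * norm (g y))"
      using g by simp
  qed
  show "F \<in> borel_measurable (lborel \<Otimes>\<^sub>M lborel)" by fact
  show "AE x in lborel \<Otimes>\<^sub>M lborel. norm (F x) \<le> norm (case x of (x, y) \<Rightarrow> norm (f x) * norm (g y))"
    using le by (intro AE_I2) (auto simp: abs_mult)
qed

text \<open>Damping by \<open>exp (- \<delta> exp x)\<close> makes the double integral absolutely convergent.\<close>

lemma mellin_theta_damped:
  fixes e :: "'a::euclidean_space"
  assumes h: "rapidly_decaying h" and s: "Re s < 0" and \<delta>: "\<delta> > 0"
  shows "(\<integral>x. exp (- s * of_real x) * exp (- of_real (\<delta> * exp x)) * theta e h (\<tau> * exp x) \<partial>lborel)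
    = Gamma (- s) * (\<integral>y. h y * (of_real \<delta> - \<i> * of_real (pi * (\<tau> * lorentz e y))) powr s \<partial>lborel)"
proof -
  define F where "F = (\<lambda>(x, y). exp (- s * of_real x) * exp (- of_real (\<delta> * exp x)) *
     (h y * exp (\<i> * of_real (pi * (\<tau> * exp x) * lorentz e y))))"
  have [measurable]: "h \<in> borel_measurable borel" using h by (rule rapidly_decaying_measurable)
  have eq1: "exp (- s * of_real x) * exp (- of_real (\<delta> * exp x)) = exp ((- s) * of_real x - of_real \<delta> * of_real (exp x))" for x :: real
    by (simp add: exp_diff exp_minus divide_inverse mult.commute flip: exp_add)
  have int1: "integrable lborel (\<lambda>x. exp (- s * of_real x) * exp (- of_real (\<delta> * exp x)))"
    unfolding eq1 by (rule Gamma_integral_exp(1)) (use s \<delta> in auto)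
  have int: "integrable (lborel \<Otimes>\<^sub>M lborel) F"
  proof (rule integrable_tensor[OF int1 integrable_rapidly_decaying[OF h]])
    show "F \<in> borel_measurable (lborel \<Otimes>\<^sub>M lborel)" unfolding F_def by measurable
    show "norm (F (x, y)) \<le> norm (exp (- s * of_real x) * exp (- of_real (\<delta> * exp x))) * norm (h y)" for x y
      by (simp add: F_def norm_mult)
  qed
  have "(\<integral>x. exp (- s * of_real x) * exp (- of_real (\<delta> * exp x)) * theta e h (\<tau> * exp x) \<partial>lborel)
      = (\<integral>x. \<integral>y. F (x, y) \<partial>lborel \<partial>lborel)"
    unfolding F_def theta_def by simp
  also have "\<dots> = (\<integral>y. \<integral>x. F (x, y) \<partial>lborel \<partial>lborel)"
    using lborel_pair.Fubini_integral[of "\<lambda>x y. F (x, y)"] int by simp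
  also have "\<dots> = (\<integral>y. Gamma (- s) * (h y * (of_real \<delta> - \<i> * of_real (pi * (\<tau> * lorentz e y))) powr s) \<partial>lborel)"
  proof (rule Bochner_Integration.integral_cong)
    fix y :: 'a
    let ?z = "of_real \<delta> - \<i> * of_real (pi * (\<tau> * lorentz e y)) :: complex"
    have "F (x, y) = h y * exp ((- s) * of_real x - ?z * of_real (exp x))" for x
      unfolding F_def prod.case eq1 by (simp add: algebra_simps flip: exp_add)
    then have "(\<integral>x. F (x, y) \<partial>lborel) = h y * (\<integral>x. exp ((- s) * of_real x - ?z * of_real (exp x)) \<partial>lborel)"
      by simp
    also have "(\<integral>x. exp ((- s) * of_real x - ?z * of_real (exp x)) \<partial>lborel) = Gamma (- s) * ?z powr (- (- s))"
      by (rule Gamma_integral_exp(2)) (use s \<delta> in auto)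
    finally show "(\<integral>x. F (x, y) \<partial>lborel) = Gamma (- s) * (h y * ?z powr s)" by simp
  qed simp
  finally show ?thesis by simp
qed

text \<open>Both sides of the damped identity pass to the limit. On the left the undamped integrand
  dominates. On the right the base has modulus at least pi |Q|, and as Re s < 0 its power is bounded
  by a constant times |Q|^(Re s), which is integrable against h because Re s > -1/4.\<close>

lemma mellin_theta_eq:
  fixes e :: "'a::euclidean_space"
  assumes e: "e \<in> Basis" and h: "rapidly_decaying h" and dec: "theta_decays e h" and \<tau>: "\<bar>\<tau>\<bar> = 1"
    and s: "- 1/4 < Re s" "Re s < 0" "- real DIM('a) / 2 < Re s"
  shows "mellin_theta e h \<tau> s = mellin_factor e h \<tau> s"
proof -
  have [measurable]: "h \<in> borel_measurable borel" using h by (rule rapidly_decaying_measurable)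
  define \<delta> where "\<delta> n = 1 / real (Suc n)" for n
  have \<delta>: "\<delta> n > 0" for n by (simp add: \<delta>_def)
  have \<delta>l: "\<delta> \<longlonglongrightarrow> 0" unfolding \<delta>_def by (rule LIMSEQ_Suc[OF lim_1_over_n])
  have 1: "(\<lambda>n. \<integral>x. exp (- s * of_real x) * exp (- of_real (\<delta> n * exp x)) * theta e h (\<tau> * exp x) \<partial>lborel)
     \<longlonglongrightarrow> mellin_theta e h \<tau> s"
    unfolding mellin_theta_def
  proof (rule integral_dominated_convergence[where w = "\<lambda>x. norm (exp (- s * of_real x) * theta e h (\<tau> * exp x))"])
    have m: "(\<lambda>x. exp (- s * of_real x) * theta e h (\<tau> * exp x)) \<in> borel_measurable borel"
      by (rule mellin_theta_measurable[OF e h dec \<tau>])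
    then show "(\<lambda>x. exp (- s * of_real x) * theta e h (\<tau> * exp x)) \<in> borel_measurable lborel" by simp
    have "(\<lambda>x. exp (- of_real (\<delta> n * exp x)) * (exp (- s * of_real x) * theta e h (\<tau> * exp x))) \<in> borel_measurable lborel" for n
      using m by measurable
    then show "(\<lambda>x. exp (- s * of_real x) * exp (- of_real (\<delta> n * exp x)) * theta e h (\<tau> * exp x)) \<in> borel_measurable lborel" for n
      by (simp add: mult_ac)
    show "integrable lborel (\<lambda>x. norm (exp (- s * of_real x) * theta e h (\<tau> * exp x)))"
      by (intro integrable_norm mellin_theta_integrable[OF e h dec \<tau>] s)
    show "AE x in lborel. (\<lambda>n. exp (- s * of_real x) * exp (- of_real (\<delta> n * exp x)) * theta e h (\<tau> * exp x))
       \<longlonglongrightarrow> exp (- s * of_real x) * theta e h (\<tau> * exp x)"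
    proof (rule AE_I2)
      fix x
      have "(\<lambda>n. exp (- s * of_real x) * exp (- of_real (\<delta> n * exp x)) * theta e h (\<tau> * exp x))
       \<longlonglongrightarrow> exp (- s * of_real x) * exp (- of_real (0 * exp x)) * theta e h (\<tau> * exp x)"
        by (intro tendsto_intros \<delta>l)
      then show "(\<lambda>n. exp (- s * of_real x) * exp (- of_real (\<delta> n * exp x)) * theta e h (\<tau> * exp x))
       \<longlonglongrightarrow> exp (- s * of_real x) * theta e h (\<tau> * exp x)" by simp
    qed
    show "AE x in lborel. norm (exp (- s * of_real x) * exp (- of_real (\<delta> n * exp x)) * theta e h (\<tau> * exp x))
       \<le> norm (exp (- s * of_real x) * theta e h (\<tau> * exp x))" for n
    proof (rule AE_I2)
      fix x
      have "norm (exp (- complex_of_real (\<delta> n * exp x))) \<le> 1" using \<delta>[of n] by simp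
      then show "norm (exp (- s * of_real x) * exp (- of_real (\<delta> n * exp x)) * theta e h (\<tau> * exp x))
       \<le> norm (exp (- s * of_real x) * theta e h (\<tau> * exp x))"
        unfolding norm_mult by (intro mult_right_mono) (auto intro: mult_left_le)
    qed
  qed
  \<comment> \<open>The value at \<delta> = 0. Off the null set Q = 0 the limiting base is imaginary
    and nonzero, so the principal power is continuous there.\<close>
  define L where "L y = of_real pi powr s * of_real \<bar>lorentz e y\<bar> powr s *
     (cos (of_real pi * s / 2) - \<i> * of_real (\<tau> * sgn (lorentz e y)) * sin (of_real pi * s / 2))" for y
  have Lm[measurable]: "L \<in> borel_measurable borel" unfolding L_def by measurable
  have 2: "(\<lambda>n. \<integral>y. h y * (of_real (\<delta> n) - \<i> * of_real (pi * (\<tau> * lorentz e y))) powr s \<partial>lborel)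
     \<longlonglongrightarrow> (\<integral>y. h y * L y \<partial>lborel)"
  proof (rule integral_dominated_convergence[where w = "\<lambda>y. norm (h y) * ((\<bar>lorentz e y\<bar> powr (-1/4) + \<bar>lorentz e y\<bar> ^ 0) * (pi powr Re s * exp (pi * \<bar>Im s\<bar>)))"])
    show "(\<lambda>y. h y * L y) \<in> borel_measurable lborel" by measurable
    show "(\<lambda>y. h y * (of_real (\<delta> n) - \<i> * of_real (pi * (\<tau> * lorentz e y))) powr s) \<in> borel_measurable lborel" for n
      by measurable
    show "integrable lborel (\<lambda>y. norm (h y) * ((\<bar>lorentz e y\<bar> powr (-1/4) + \<bar>lorentz e y\<bar> ^ 0) * (pi powr Re s * exp (pi * \<bar>Im s\<bar>))))"
      using integrable_mult_left[OF integrable_lorentz_bound[OF e h, of 0], of "pi powr Re s * exp (pi * \<bar>Im s\<bar>)"]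
      by (simp only: mult.assoc)
    show "AE y in lborel. (\<lambda>n. h y * (of_real (\<delta> n) - \<i> * of_real (pi * (\<tau> * lorentz e y))) powr s) \<longlonglongrightarrow> h y * L y"
      using AE_lorentz_nonzero[OF e]
    proof eventually_elim
      case (elim y)
      let ?q = "\<tau> * lorentz e y"
      have q: "?q \<noteq> 0" using elim \<tau> by auto
      have "(\<lambda>n. (of_real (\<delta> n) - \<i> * of_real (pi * ?q)) powr s) \<longlonglongrightarrow> (of_real 0 - \<i> * of_real (pi * ?q)) powr s"
        by (intro tendsto_intros \<delta>l) (use q in \<open>auto simp: complex_nonpos_Reals_iff\<close>)
      also have "(of_real 0 - \<i> * of_real (pi * ?q)) powr s = L y"
      proof -
        have "\<tau> = 1 \<or> \<tau> = -1" using \<tau> by auto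
        then have "\<bar>?q\<bar> = \<bar>lorentz e y\<bar>" "sgn ?q = \<tau> * sgn (lorentz e y)" by (auto simp: sgn_mult)
        then show ?thesis unfolding L_def using powr_imaginary[OF q, of s] by simp
      qed
      finally show ?case by (intro tendsto_mult tendsto_const)
    qed
    show "AE y in lborel. norm (h y * (of_real (\<delta> n) - \<i> * of_real (pi * (\<tau> * lorentz e y))) powr s)
       \<le> norm (h y) * ((\<bar>lorentz e y\<bar> powr (-1/4) + \<bar>lorentz e y\<bar> ^ 0) * (pi powr Re s * exp (pi * \<bar>Im s\<bar>)))" for n
      using AE_lorentz_nonzero[OF e]
    proof eventually_elim
      case (elim y)
      let ?w = "of_real (\<delta> n) - \<i> * of_real (pi * (\<tau> * lorentz e y)) :: complex"
      have "\<bar>Im ?w\<bar> = pi * \<bar>lorentz e y\<bar>" using \<tau> by (simp add: abs_mult)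
      then have w: "pi * \<bar>lorentz e y\<bar> \<le> norm ?w" using abs_Im_le_cmod[of ?w] by simp
      have "norm (?w powr s) \<le> (pi * \<bar>lorentz e y\<bar>) powr Re s * exp (pi * \<bar>Im s\<bar>)"
        by (rule norm_powr_le) (use w elim s \<delta>[of n] in \<open>auto simp: complex_eq_iff\<close>)
      also have "\<dots> = \<bar>lorentz e y\<bar> powr Re s * (pi powr Re s * exp (pi * \<bar>Im s\<bar>))"
        by (simp add: powr_mult)
      also have "\<dots> \<le> (\<bar>lorentz e y\<bar> powr (-1/4) + \<bar>lorentz e y\<bar> ^ 0) * (pi powr Re s * exp (pi * \<bar>Im s\<bar>))"
        by (intro mult_right_mono abs_powr_le) (use s in auto)
      finally show ?case unfolding norm_mult by (intro mult_left_mono) auto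
    qed
  qed
  have "(\<lambda>n. Gamma (- s) * (\<integral>y. h y * (of_real (\<delta> n) - \<i> * of_real (pi * (\<tau> * lorentz e y))) powr s \<partial>lborel))
     \<longlonglongrightarrow> Gamma (- s) * (\<integral>y. h y * L y \<partial>lborel)"
    by (intro tendsto_intros 2)
  with 1 have "mellin_theta e h \<tau> s = Gamma (- s) * (\<integral>y. h y * L y \<partial>lborel)"
    unfolding mellin_theta_damped[OF h s(2) \<delta>] by (rule LIMSEQ_unique)
  also have "(\<integral>y. h y * L y \<partial>lborel) = of_real pi powr s *
     (cos (of_real pi * s / 2) * lorentz_zeta e parity_one h s
       - \<i> * of_real \<tau> * sin (of_real pi * s / 2) * lorentz_zeta e parity_sgn h s)"
  proof -
    define f1 where "f1 y = h y * (parity_one (lorentz e y) * of_real \<bar>lorentz e y\<bar> powr s)" for y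
    define f2 where "f2 y = h y * (parity_sgn (lorentz e y) * of_real \<bar>lorentz e y\<bar> powr s)" for y
    have "h y * L y = (of_real pi powr s * cos (of_real pi * s / 2)) * f1 y
      - (of_real pi powr s * \<i> * of_real \<tau> * sin (of_real pi * s / 2)) * f2 y" for y
      by (simp add: f1_def f2_def L_def parity_one_def parity_sgn_def algebra_simps)
    moreover have "integrable lborel f1" unfolding f1_def
      by (rule lorentz_zeta_integrable[OF e h]) (use s norm_parity_le in auto)
    moreover have "integrable lborel f2" unfolding f2_def
      by (rule lorentz_zeta_integrable[OF e h]) (use s norm_parity_le in auto)
    ultimately have "(\<integral>y. h y * L y \<partial>lborel) = (of_real pi powr s * cos (of_real pi * s / 2)) * (\<integral>y. f1 y \<partial>lborel)
      - (of_real pi powr s * \<i> * of_real \<tau> * sin (of_real pi * s / 2)) * (\<integral>y. f2 y \<partial>lborel)"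
      by simp
    then show ?thesis unfolding lorentz_zeta_def f1_def f2_def by (simp add: algebra_simps)
  qed
  finally show ?thesis unfolding mellin_factor_def by (simp add: mult.assoc)
qed

text \<open>The constant in \<open>theta (fourier g) t = const * theta g (- 4 / t)\<close>.\<close>

definition weil_factor :: "nat \<Rightarrow> real \<Rightarrow> complex" where
  "weil_factor n t = of_real ((\<bar>t\<bar> / 2) powr (- real n / 2)) * exp (- (\<i> * of_real (sgn t * (pi * (real n - 2) / 4))))"

section \<open>Transformation of theta integrals under the Fourier transform\<close>

lemma powr_half_imaginary:
  fixes t :: real
  assumes "t \<noteq> 0"
  shows "(\<i> * of_real t) powr (-1/2) = of_real (\<bar>t\<bar> powr (-1/2)) * exp (- (\<i> * of_real (sgn t * (pi / 4))))"
proof -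
  have e: "exp (\<i> * of_real (sgn t * (pi / 2))) = \<i> * of_real (sgn t)"
  proof (cases "t > 0")
    case True
    have "exp (\<i> * of_real (pi / 2)) = \<i>"
      unfolding cis_conv_exp[symmetric] by simp
    then show ?thesis using True by simp
  next
    case False
    have "exp (- (\<i> * of_real (pi / 2))) = - \<i>"
      unfolding exp_minus cis_conv_exp[symmetric] by simp
    then show ?thesis using False assms by simp
  qed
  have "exp (of_real (ln \<bar>t\<bar>)) = complex_of_real \<bar>t\<bar>"
    using assms by (subst exp_of_real) simp
  then have "exp (of_real (ln \<bar>t\<bar>) + \<i> * of_real (sgn t * (pi / 2))) = \<i> * of_real t"
    unfolding exp_add e by (simp add: sgn_if abs_if)
  then have Ln: "Ln (\<i> * of_real t) = of_real (ln \<bar>t\<bar>) + \<i> * of_real (sgn t * (pi / 2))"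
    by (rule Ln_unique) (auto simp: sgn_if)
  have "(\<i> * of_real t) powr (-1/2) = exp ((-1/2) * Ln (\<i> * of_real t))"
    using assms by (simp add: powr_def)
  also have "\<dots> = exp (of_real ((-1/2) * ln \<bar>t\<bar>) + - (\<i> * of_real (sgn t * (pi / 4))))"
    unfolding Ln by (simp add: algebra_simps)
  also have "\<dots> = exp (of_real ((-1/2) * ln \<bar>t\<bar>)) * exp (- (\<i> * of_real (sgn t * (pi / 4))))"
    by (rule exp_add)
  also have "exp (complex_of_real ((-1/2) * ln \<bar>t\<bar>)) = of_real (\<bar>t\<bar> powr (-1/2))"
    unfolding exp_of_real using assms by (simp add: powr_def)
  finally show ?thesis .
qed

text \<open>The coordinate e contributes the phase exp (i sgn(t) pi / 4), each of the other n - 1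
  coordinates its inverse; together this leaves the exponent - (n - 2).\<close>

lemma weil_factor_eq:
  assumes "t \<noteq> 0" "n > 0"
  shows "(- (\<i> * of_real (t / 2))) powr (-1/2) * ((\<i> * of_real (t / 2)) powr (-1/2)) ^ (n - 1) = weil_factor n t"
proof -
  obtain m where n: "n = Suc m" using assms by (cases n) auto
  have a: "(- (\<i> * of_real (t / 2))) powr (-1/2) = of_real ((\<bar>t\<bar> / 2) powr (-1/2)) * exp (\<i> * of_real (sgn t * (pi / 4)))"
    using powr_half_imaginary[of "- (t / 2)"] assms by (simp add: sgn_divide)
  have b: "(\<i> * of_real (t / 2)) powr (-1/2) = of_real ((\<bar>t\<bar> / 2) powr (-1/2)) * exp (- (\<i> * of_real (sgn t * (pi / 4))))"
    using powr_half_imaginary[of "t / 2"] assms by (simp add: sgn_divide)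
  have "(- (\<i> * of_real (t / 2))) powr (-1/2) * ((\<i> * of_real (t / 2)) powr (-1/2)) ^ m
    = of_real (((\<bar>t\<bar> / 2) powr (-1/2)) ^ n) * (exp (\<i> * of_real (sgn t * (pi / 4))) * exp (- (\<i> * of_real (sgn t * (pi / 4)))) ^ m)"
    unfolding a b n by (simp add: power_mult_distrib)
  also have "((\<bar>t\<bar> / 2) powr (-1/2)) ^ n = (\<bar>t\<bar> / 2) powr (- real n / 2)"
    using assms by (simp add: powr_power)
  also have "exp (\<i> * of_real (sgn t * (pi / 4))) * exp (- (\<i> * of_real (sgn t * (pi / 4)))) ^ m
     = exp (- (\<i> * of_real (sgn t * (pi * (real n - 2) / 4))))"
    unfolding exp_of_nat_mult[symmetric] exp_add[symmetric] n by (simp add: algebra_simps diff_divide_distrib)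
  finally show ?thesis by (simp add: n weil_factor_def)
qed

abbreviation gaussian :: "('a \<Rightarrow> complex) \<Rightarrow> 'a::euclidean_space \<Rightarrow> complex" where
  "gaussian z x \<equiv> exp (- (of_real pi * (\<Sum>b\<in>Basis. z b * of_real ((x \<bullet> b)\<^sup>2))))"

abbreviation gaussian_transform :: "('a \<Rightarrow> complex) \<Rightarrow> 'a::euclidean_space \<Rightarrow> complex" where
  "gaussian_transform z y \<equiv> \<Prod>b\<in>Basis. z b powr (-1/2) * exp (- of_real pi * of_real ((y \<bullet> b)\<^sup>2) / z b)"

lemma fourier_gaussian:
  fixes y :: "'a::euclidean_space" and z :: "'a \<Rightarrow> complex"
  assumes z: "\<And>b. b \<in> Basis \<Longrightarrow> Re (z b) > 0"
  shows "integrable lborel (\<lambda>x. exp (2 * \<i> * of_real pi * of_real (x \<bullet> y)) * gaussian z x)"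
    "(\<integral>x. exp (2 * \<i> * of_real pi * of_real (x \<bullet> y)) * gaussian z x \<partial>lborel)
     = gaussian_transform z y"
proof -
  define f where "f b x = exp (of_real (2 * pi * x * (y \<bullet> b)) * \<i> - of_real pi * z b * of_real (x\<^sup>2))" for b x
  have eq: "exp (2 * \<i> * of_real pi * of_real (x \<bullet> y)) * gaussian z x = (\<Prod>b\<in>Basis. f b (x \<bullet> b))" for x
  proof -
    have "(\<Prod>b\<in>Basis. f b (x \<bullet> b)) = exp (\<Sum>b\<in>Basis. of_real (2 * pi * (x \<bullet> b) * (y \<bullet> b)) * \<i> - of_real pi * z b * of_real ((x \<bullet> b)\<^sup>2))"
      unfolding f_def by (simp add: exp_sum)
    also have "(\<Sum>b\<in>Basis. of_real (2 * pi * (x \<bullet> b) * (y \<bullet> b)) * \<i> - of_real pi * z b * of_real ((x \<bullet> b)\<^sup>2))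
      = 2 * \<i> * of_real pi * of_real (\<Sum>b\<in>Basis. (x \<bullet> b) * (y \<bullet> b)) + - (of_real pi * (\<Sum>b\<in>Basis. z b * of_real ((x \<bullet> b)\<^sup>2)))"
      by (simp add: sum_subtractf sum_distrib_left mult_ac)
    finally show ?thesis unfolding exp_add euclidean_inner[of x y] by simp
  qed
  have f: "integrable lborel (f b)" "(\<integral>x. f b x \<partial>lborel) = z b powr (-1/2) * exp (- of_real pi * of_real ((y \<bullet> b)\<^sup>2) / z b)"
    if "b \<in> Basis" for b
    unfolding f_def using gaussian_fourier[OF z[OF that], of "y \<bullet> b"] by auto
  show "integrable lborel (\<lambda>x. exp (2 * \<i> * of_real pi * of_real (x \<bullet> y)) * gaussian z x)"
    unfolding eq by (rule lborel_integral_prod(1)) (rule f)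
  show "(\<integral>x. exp (2 * \<i> * of_real pi * of_real (x \<bullet> y)) * gaussian z x \<partial>lborel)
     = gaussian_transform z y"
    unfolding eq by (subst lborel_integral_prod(2)) (auto simp: f intro!: prod.cong)
qed

text \<open>The multiplication formula, which moves the Fourier transform from g to the Gaussian by
  Fubini.\<close>

lemma integral_fourier_gaussian:
  fixes g :: "'a::euclidean_space \<Rightarrow> complex" and z :: "'a \<Rightarrow> complex"
  assumes g: "integrable lborel g" and z: "\<And>b. b \<in> Basis \<Longrightarrow> Re (z b) > 0"
  shows "(\<integral>x. fourier g x * gaussian z x \<partial>lborel)
     = (\<integral>y. g y * gaussian_transform z y \<partial>lborel)"
proof -
  define F where "F = (\<lambda>(x, y). (exp (2 * \<i> * of_real pi * of_real (x \<bullet> y)) * g y) * gaussian z x)"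
  have [measurable]: "g \<in> borel_measurable borel" using g by simp
  have E: "integrable lborel (gaussian z)" using fourier_gaussian(1)[OF z, where y = 0] by simp
  have int: "integrable (lborel \<Otimes>\<^sub>M lborel) F"
  proof (rule integrable_tensor[OF E g])
    show "F \<in> borel_measurable (lborel \<Otimes>\<^sub>M lborel)" unfolding F_def by measurable
    show "norm (F (x, y)) \<le> norm (gaussian z x) * norm (g y)" for x y
      by (simp add: F_def norm_mult)
  qed
  have "(\<integral>x. fourier g x * gaussian z x \<partial>lborel) = (\<integral>x. \<integral>y. F (x, y) \<partial>lborel \<partial>lborel)"
    unfolding F_def fourier_def by simp
  also have "\<dots> = (\<integral>y. \<integral>x. F (x, y) \<partial>lborel \<partial>lborel)"
    using lborel_pair.Fubini_integral[of "\<lambda>x y. F (x, y)"] int by simp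
  also have "\<dots> = (\<integral>y. g y * gaussian_transform z y \<partial>lborel)"
  proof (rule Bochner_Integration.integral_cong)
    fix y :: 'a
    have "(\<integral>x. F (x, y) \<partial>lborel) = (\<integral>x. g y * (exp (2 * \<i> * of_real pi * of_real (x \<bullet> y)) * gaussian z x) \<partial>lborel)"
      unfolding F_def by (simp add: mult_ac)
    also have "\<dots> = g y * gaussian_transform z y"
      using fourier_gaussian(2)[OF z, where y = y] by simp
    finally show "(\<integral>x. F (x, y) \<partial>lborel) = g y * gaussian_transform z y" .
  qed simp
  finally show ?thesis .
qed

lemma norm_powr_neg_half_le:
  assumes "Re z > 0" "r > 0" "r \<le> norm z"
  shows "norm (z powr (-1/2)) \<le> r powr (-1/2)"
proof -
  have "norm (z powr (-1/2)) = norm z powr (-1/2)"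
    using assms norm_powr_real_powr'[of "-1/2" z] by simp
  also have "\<dots> \<le> r powr (-1/2)" using assms by (intro powr_mono2') auto
  finally show ?thesis .
qed

text \<open>The character exp (i pi t Q) is a Gaussian with imaginary parameters i t / 2 and - i t /
  2, approached through parameters of real part \<delta>. The transform inverts the parameters, and
  since the form carries the factor 1/2 this sends t to - 4 / t.\<close>

lemma theta_fourier:
  fixes e :: "'a::euclidean_space"
  assumes e: "e \<in> Basis" and g: "integrable lborel g" and fg: "integrable lborel (fourier g)" and t: "t \<noteq> 0"
  shows "theta e (fourier g) t = weil_factor DIM('a) t * theta e g (- 4 / t)"
proof -
  define \<delta> where "\<delta> n = 1 / real (Suc n)" for n
  have \<delta>: "\<delta> n > 0" for n by (simp add: \<delta>_def)
  have \<delta>l: "\<delta> \<longlonglongrightarrow> 0" unfolding \<delta>_def by (rule LIMSEQ_Suc[OF lim_1_over_n])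
  \<comment> \<open>The signs are those of - Q, as the exponent of \<open>gaussian\<close> has a
    minus sign.\<close>
  define \<sigma> where "\<sigma> b = (if b = e then -1 else 1 :: real)" for b
  define w where "w b = \<i> * complex_of_real (\<sigma> b * (t / 2))" for b
  define z where "z n b = complex_of_real (\<delta> n) + w b" for n b
  have Rez: "Re (z n b) > 0" for n b by (simp add: z_def w_def \<delta>)
  have Q: "lorentz e x = (\<Sum>b\<in>Basis. - \<sigma> b * (x \<bullet> b)\<^sup>2) / 2" for x
    unfolding lorentz_def by (subst sum.remove[OF _ e]) (auto simp: \<sigma>_def sum_negf)
  have zl: "(\<lambda>n. z n b) \<longlonglongrightarrow> w b" for b
    using tendsto_add[OF tendsto_of_real[OF \<delta>l] tendsto_const[of "w b"]] by (simp add: z_def)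
  have wnz: "w b \<noteq> 0" for b using t by (auto simp: w_def \<sigma>_def)
  have wnp: "w b \<notin> \<real>\<^sub>\<le>\<^sub>0" for b using t by (auto simp: w_def \<sigma>_def complex_nonpos_Reals_iff)
  have lhs: "(\<lambda>n. \<integral>x. fourier g x * gaussian (z n) x \<partial>lborel)
     \<longlonglongrightarrow> theta e (fourier g) t"
    unfolding theta_def
  proof (rule integral_dominated_convergence[where w = "\<lambda>x. norm (fourier g x)"])
    have [measurable]: "fourier g \<in> borel_measurable borel" using fg by simp
    show "(\<lambda>x. fourier g x * exp (\<i> * of_real (pi * t * lorentz e x))) \<in> borel_measurable lborel" by measurable
    show "(\<lambda>x. fourier g x * gaussian (z n) x) \<in> borel_measurable lborel" for n
      by measurable
    show "integrable lborel (\<lambda>x. norm (fourier g x))" using fg by simp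
    show "AE x in lborel. (\<lambda>n. fourier g x * gaussian (z n) x)
      \<longlonglongrightarrow> fourier g x * exp (\<i> * of_real (pi * t * lorentz e x))"
    proof (rule AE_I2)
      fix x
      have "(\<Sum>b\<in>Basis. w b * of_real ((x \<bullet> b)\<^sup>2)) = - (\<i> * of_real (t * lorentz e x))"
        unfolding Q w_def by (simp add: sum_negf sum_distrib_left sum_divide_distrib mult_ac)
      then have "exp (\<i> * of_real (pi * t * lorentz e x)) = gaussian w x"
        by (simp add: mult_ac)
      moreover have "(\<lambda>n. fourier g x * gaussian (z n) x)
        \<longlonglongrightarrow> fourier g x * gaussian w x"
        by (intro tendsto_intros zl)
      ultimately show "(\<lambda>n. fourier g x * gaussian (z n) x)
        \<longlonglongrightarrow> fourier g x * exp (\<i> * of_real (pi * t * lorentz e x))" by simp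
    qed
    show "AE x in lborel. norm (fourier g x * gaussian (z n) x) \<le> norm (fourier g x)" for n
    proof (rule AE_I2)
      fix x
      have "Re (of_real pi * (\<Sum>b\<in>Basis. z n b * of_real ((x \<bullet> b)\<^sup>2))) = pi * (\<Sum>b\<in>Basis. Re (z n b) * (x \<bullet> b)\<^sup>2)"
        by simp
      also have "\<dots> \<ge> 0" by (intro mult_nonneg_nonneg sum_nonneg) (auto intro: less_imp_le[OF Rez])
      finally have "norm (gaussian (z n) x) \<le> 1"
        unfolding norm_exp_eq_Re by simp
      then show "norm (fourier g x * gaussian (z n) x) \<le> norm (fourier g x)"
        unfolding norm_mult by (rule mult_left_le) simp
    qed
  qed
  have rhs: "(\<lambda>n. \<integral>y. g y * gaussian_transform (z n) y \<partial>lborel) \<longlonglongrightarrow> (\<integral>y. g y * gaussian_transform w y \<partial>lborel)"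
  proof (rule integral_dominated_convergence[where w = "\<lambda>y. norm (g y) * (\<Prod>b\<in>(Basis::'a set). (\<bar>t\<bar> / 2) powr (-1/2))"])
    have [measurable]: "g \<in> borel_measurable borel" using g by simp
    show "(\<lambda>y. g y * gaussian_transform w y) \<in> borel_measurable lborel" by measurable
    show "(\<lambda>y. g y * gaussian_transform (z n) y) \<in> borel_measurable lborel" for n by measurable
    show "integrable lborel (\<lambda>y. norm (g y) * (\<Prod>b\<in>(Basis::'a set). (\<bar>t\<bar> / 2) powr (-1/2)))"
      using g by (intro integrable_mult_left integrable_norm)
    show "AE y in lborel. (\<lambda>n. g y * gaussian_transform (z n) y) \<longlonglongrightarrow> g y * gaussian_transform w y"
      by (intro AE_I2 tendsto_intros zl) (use wnp wnz in auto)
    show "AE y in lborel. norm (g y * gaussian_transform (z n) y) \<le> norm (g y) * (\<Prod>b\<in>(Basis::'a set). (\<bar>t\<bar> / 2) powr (-1/2))" for n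
    proof (rule AE_I2)
      fix y
      \<comment> \<open>The bound is uniform in n: z n b has imaginary part of modulus |t| / 2, and
        its inverse has nonnegative real part, so the exponential is at most 1.\<close>
      have "norm (z n b powr (-1/2) * exp (- of_real pi * of_real ((y \<bullet> b)\<^sup>2) / z n b)) \<le> (\<bar>t\<bar> / 2) powr (-1/2)" for b
      proof -
        have "\<bar>Im (z n b)\<bar> = \<bar>t\<bar> / 2" by (simp add: z_def w_def \<sigma>_def)
        then have "\<bar>t\<bar> / 2 \<le> norm (z n b)" using abs_Im_le_cmod[of "z n b"] by simp
        then have 1: "norm (z n b powr (-1/2)) \<le> (\<bar>t\<bar> / 2) powr (-1/2)"
          by (intro norm_powr_neg_half_le Rez) (use t in auto)
        have "- of_real pi * of_real ((y \<bullet> b)\<^sup>2) / z n b = of_real (- pi * (y \<bullet> b)\<^sup>2) * inverse (z n b)"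
          by (simp add: divide_inverse)
        then have "Re (- of_real pi * of_real ((y \<bullet> b)\<^sup>2) / z n b) = - pi * (y \<bullet> b)\<^sup>2 * Re (inverse (z n b))"
          by (simp only: Re_complex_of_real Im_complex_of_real times_complex.sel)
        also have "\<dots> \<le> 0"
          using less_imp_le[OF Rez[of n b]] by (intro mult_nonpos_nonneg) (auto intro!: divide_nonneg_nonneg)
        finally have 2: "norm (exp (- of_real pi * of_real ((y \<bullet> b)\<^sup>2) / z n b)) \<le> 1"
          unfolding norm_exp_eq_Re by simp
        show ?thesis unfolding norm_mult
          using mult_mono[OF 1 2] by simp
      qed
      then have "norm (gaussian_transform (z n) y) \<le> (\<Prod>b\<in>(Basis::'a set). (\<bar>t\<bar> / 2) powr (-1/2))"
        unfolding prod_norm[symmetric] by (intro prod_mono) auto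
      then show "norm (g y * gaussian_transform (z n) y) \<le> norm (g y) * (\<Prod>b\<in>(Basis::'a set). (\<bar>t\<bar> / 2) powr (-1/2))"
        unfolding norm_mult by (rule mult_left_mono) simp
    qed
  qed
  have "theta e (fourier g) t = (\<integral>y. g y * gaussian_transform w y \<partial>lborel)"
    using lhs rhs unfolding integral_fourier_gaussian[OF g Rez] by (rule LIMSEQ_unique)
  also have "\<dots> = (\<integral>y. weil_factor DIM('a) t * (g y * exp (\<i> * of_real (pi * (- 4 / t) * lorentz e y))) \<partial>lborel)"
  proof (rule Bochner_Integration.integral_cong)
    fix y
    have "(\<Prod>b\<in>Basis. w b powr (-1/2)) = w e powr (-1/2) * (\<Prod>b\<in>Basis - {e}. w b powr (-1/2))"
      by (rule prod.remove) (use e in auto)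
    also have "(\<Prod>b\<in>Basis - {e}. w b powr (-1/2)) = (\<Prod>b\<in>Basis - {e}. (\<i> * of_real (t / 2)) powr (-1/2))"
      by (intro prod.cong) (auto simp: w_def \<sigma>_def)
    also have "\<dots> = ((\<i> * of_real (t / 2)) powr (-1/2)) ^ (DIM('a) - 1)" using e by simp
    also have "w e = - (\<i> * of_real (t / 2))" by (simp add: w_def \<sigma>_def)
    also have "(- (\<i> * of_real (t / 2))) powr (-1/2) * ((\<i> * of_real (t / 2)) powr (-1/2)) ^ (DIM('a) - 1) = weil_factor DIM('a) t"
      by (rule weil_factor_eq) (use t in auto)
    finally have 1: "(\<Prod>b\<in>Basis. w b powr (-1/2)) = weil_factor DIM('a) t" .
    have "- of_real pi * of_real ((y \<bullet> b)\<^sup>2) / w b = \<i> * of_real (pi * (- 4 / t) * (- \<sigma> b * (y \<bullet> b)\<^sup>2 / 2))" for b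
      using t by (auto simp: w_def \<sigma>_def field_simps)
    then have "(\<Prod>b\<in>Basis. exp (- of_real pi * of_real ((y \<bullet> b)\<^sup>2) / w b)) = exp (\<Sum>b\<in>Basis. \<i> * of_real (pi * (- 4 / t) * (- \<sigma> b * (y \<bullet> b)\<^sup>2 / 2)))"
      by (simp only: exp_sum[OF finite_Basis])
    also have "(\<Sum>b\<in>Basis. \<i> * of_real (pi * (- 4 / t) * (- \<sigma> b * (y \<bullet> b)\<^sup>2 / 2))) = \<i> * of_real (pi * (- 4 / t) * lorentz e y)"
      unfolding Q sum_distrib_left[symmetric] of_real_sum[symmetric] sum_divide_distrib[symmetric] by simp
    finally have 2: "(\<Prod>b\<in>Basis. exp (- of_real pi * of_real ((y \<bullet> b)\<^sup>2) / w b)) = exp (\<i> * of_real (pi * (- 4 / t) * lorentz e y))" .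
    show "g y * gaussian_transform w y = weil_factor DIM('a) t * (g y * exp (\<i> * of_real (pi * (- 4 / t) * lorentz e y)))"
      unfolding prod.distrib 1 2 by simp
  qed simp
  also have "\<dots> = weil_factor DIM('a) t * theta e g (- 4 / t)" unfolding theta_def by simp
  finally show ?thesis .
qed

subsection \<open>Meromorphic continuation\<close>

text \<open>The link between g and its Fourier transform in a form that is symmetric
  (\<open>theta_dual_sym\<close>). The two functions can therefore be exchanged without Fourier
  inversion.\<close>

definition theta_dual :: "'a::euclidean_space \<Rightarrow> ('a \<Rightarrow> complex) \<Rightarrow> ('a \<Rightarrow> complex) \<Rightarrow> bool" where
  "theta_dual e h k \<longleftrightarrow> (\<forall>t. t \<noteq> 0 \<longrightarrow> theta e h t = weil_factor DIM('a) t * theta e k (- 4 / t))"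

lemma weil_factor_inverse:
  assumes "t \<noteq> 0"
  shows "weil_factor n t * weil_factor n (- 4 / t) = 1"
proof -
  have "(\<bar>t\<bar> / 2) powr (- real n / 2) * (\<bar>- 4 / t\<bar> / 2) powr (- real n / 2) = ((\<bar>t\<bar> / 2) * (\<bar>- 4 / t\<bar> / 2)) powr (- real n / 2)"
    by (rule powr_mult[symmetric])
  also have "(\<bar>t\<bar> / 2) * (\<bar>- 4 / t\<bar> / 2) = 1" using assms by (simp add: abs_divide)
  finally have 1: "(\<bar>t\<bar> / 2) powr (- real n / 2) * (\<bar>- 4 / t\<bar> / 2) powr (- real n / 2) = 1" by simp
  have "sgn (- 4 / t) = - sgn t" by (simp add: sgn_divide sgn_if)
  then have 2: "exp (- (\<i> * of_real (sgn t * (pi * (real n - 2) / 4)))) * exp (- (\<i> * of_real (sgn (- 4 / t) * (pi * (real n - 2) / 4)))) = 1"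
    by (simp flip: exp_add)
  have "weil_factor n t * weil_factor n (- 4 / t) = of_real ((\<bar>t\<bar> / 2) powr (- real n / 2) * (\<bar>- 4 / t\<bar> / 2) powr (- real n / 2)) *
     (exp (- (\<i> * of_real (sgn t * (pi * (real n - 2) / 4)))) * exp (- (\<i> * of_real (sgn (- 4 / t) * (pi * (real n - 2) / 4)))))"
    unfolding weil_factor_def by (simp only: of_real_mult mult_ac)
  then show ?thesis unfolding 1 2 by simp
qed

lemma norm_weil_factor: "norm (weil_factor n t) = (\<bar>t\<bar> / 2) powr (- real n / 2)"
  by (simp add: weil_factor_def norm_mult)

lemma theta_dual_sym:
  assumes "theta_dual e h k"
  shows "theta_dual e k h"
  unfolding theta_dual_def
proof (intro allI impI)
  fix t :: real assume t: "t \<noteq> 0"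
  then have "theta e h (- 4 / t) = weil_factor DIM('a) (- 4 / t) * theta e k (- 4 / (- 4 / t))"
    using assms by (simp add: theta_dual_def)
  also have "- 4 / (- 4 / t) = t" using t by simp
  finally have "weil_factor DIM('a) t * theta e h (- 4 / t) = (weil_factor DIM('a) t * weil_factor DIM('a) (- 4 / t)) * theta e k t"
    by (simp add: mult.assoc)
  then show "theta e k t = weil_factor DIM('a) t * theta e h (- 4 / t)"
    unfolding weil_factor_inverse[OF t] by simp
qed

lemma theta_dual_decays:
  fixes e :: "'a::euclidean_space"
  assumes "theta_dual e h k"
  shows "theta_decays e h"
  unfolding theta_decays_def
proof (intro exI allI impI)
  fix t :: real assume t: "t \<noteq> 0"
  have "norm (theta e h t) = (\<bar>t\<bar> / 2) powr (- real DIM('a) / 2) * norm (theta e k (- 4 / t))"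
    using assms t unfolding theta_dual_def by (simp add: norm_mult norm_weil_factor)
  also have "\<dots> \<le> (\<bar>t\<bar> / 2) powr (- real DIM('a) / 2) * (\<integral>x. norm (k x) \<partial>lborel)"
    by (intro mult_left_mono norm_theta_le) auto
  also have "\<dots> = ((1 / 2) powr (- real DIM('a) / 2) * (\<integral>x. norm (k x) \<partial>lborel)) * \<bar>t\<bar> powr (- real DIM('a) / 2)"
    using powr_mult[of "\<bar>t\<bar>" "1/2" "- real DIM('a) / 2"] by simp
  finally show "norm (theta e h t) \<le> ((1 / 2) powr (- real DIM('a) / 2) * (\<integral>x. norm (k x) \<partial>lborel)) * \<bar>t\<bar> powr (- real DIM('a) / 2)" .
qed

text \<open>What remains of the Weil factor after t becomes 4 / t. The power of 2 is 4^(-s-n/2) from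
  the substitution times 2^(n/2) from |t| / 2.\<close>

definition dual_phase :: "nat \<Rightarrow> real \<Rightarrow> complex \<Rightarrow> complex" where
  "dual_phase n \<tau> s = exp (- (\<i> * of_real (\<tau> * (pi * (real n - 2) / 4)))) * 2 powr (- 2 * s - of_nat n / 2)"

text \<open>In the variable x the substitution is the reflection x to ln 4 - x. It preserves
  Lebesgue measure, so the equality of integrals holds for every s.\<close>

lemma mellin_theta_dual:
  fixes e :: "'a::euclidean_space"
  assumes dual: "theta_dual e h k" and \<tau>: "\<bar>\<tau>\<bar> = 1"
  shows "mellin_theta e h \<tau> s = dual_phase DIM('a) \<tau> s * mellin_theta e k (- \<tau>) (- s - of_nat DIM('a) / 2)"
proof -
  let ?n = "DIM('a)"
  let ?s = "- s - of_nat ?n / 2"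
  define f where "f y = exp (- ?s * of_real y) * theta e k ((- \<tau>) * exp y)" for y
  have \<tau>': "\<tau> = 1 \<or> \<tau> = - 1" using \<tau> by auto
  have eq: "exp (- s * of_real x) * theta e h (\<tau> * exp x) = dual_phase ?n \<tau> s * f (ln 4 + (-1) * x)" for x
  proof -
    have "\<tau> * exp x \<noteq> 0" using \<tau> by auto
    then have "theta e h (\<tau> * exp x) = weil_factor ?n (\<tau> * exp x) * theta e k (- 4 / (\<tau> * exp x))"
      using dual unfolding theta_dual_def by blast
    also have "- 4 / (\<tau> * exp x) = (- \<tau>) * exp (ln 4 + (-1) * x)"
      using \<tau>' by (auto simp: exp_add exp_minus exp_diff field_simps)
    finally have th: "theta e h (\<tau> * exp x) = weil_factor ?n (\<tau> * exp x) * theta e k ((- \<tau>) * exp (ln 4 + (-1) * x))" .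
    have pw: "(\<bar>\<tau> * exp x\<bar> / 2) powr (- real ?n / 2) = exp ((- real ?n / 2) * (x - ln 2))"
      using \<tau> by (simp add: powr_def abs_mult ln_div)
    have sg: "sgn (\<tau> * exp x) = \<tau>" using \<tau>' by (auto simp: sgn_mult)
    have wf: "weil_factor ?n (\<tau> * exp x) = exp (of_real ((- real ?n / 2) * (x - ln 2))) * exp (- (\<i> * of_real (\<tau> * (pi * (real ?n - 2) / 4))))"
      unfolding weil_factor_def pw sg exp_of_real ..
    have ln4: "ln (4::real) = 2 * ln 2" using ln_realpow[of 2 2] by simp
    have p2: "2 powr (- 2 * s - of_nat ?n / 2) = exp ((- 2 * s - of_nat ?n / 2) * of_real (ln 2))"
      by (simp add: powr_def Ln_of_real[of 2, simplified])
    have "exp (- s * of_real x) * exp (of_real ((- real ?n / 2) * (x - ln 2))) = 2 powr (- 2 * s - of_nat ?n / 2) * exp (- ?s * of_real (ln 4 + (-1) * x))"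
      unfolding p2 ln4 exp_add[symmetric] by (rule arg_cong[where f = exp]) (simp add: field_simps)
    then show ?thesis unfolding th wf f_def dual_phase_def by (simp add: mult_ac)
  qed
  have "(\<integral>y. f y \<partial>lborel) = \<bar>-1\<bar> *\<^sub>R (\<integral>x. f (ln 4 + (-1) * x) \<partial>lborel)"
    by (rule lborel_integral_real_affine) simp
  then show ?thesis unfolding mellin_theta_def eq by (simp add: f_def)
qed

section \<open>Identities between meromorphic functions off sparse sets\<close>

lemma meromorphic_Gamma_compose:
  assumes "f analytic_on A"
  shows "(\<lambda>s. Gamma (f s)) meromorphic_on A"
proof -
  have "(\<lambda>s. inverse (rGamma (f s))) meromorphic_on A"
    by (intro meromorphic_on_inverse analytic_on_imp_meromorphic_on analytic_intros assms)
  then show ?thesis by (simp add: rGamma_inverse_Gamma)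
qed

lemma pi_not_le_zero: "\<not> pi \<le> 0"
  using pi_gt_zero by linarith

lemma eventually_cosparse_nonzero:
  assumes "f analytic_on UNIV" "f z0 \<noteq> (0::complex)"
  shows "\<forall>\<^sub>\<approx>z. f z \<noteq> 0"
proof -
  have "(\<forall>\<^sub>\<approx>z. f z = 0) \<or> (\<forall>\<^sub>\<approx>z. f z \<noteq> 0)"
    by (rule meromorphic_imp_constant_or_avoid) (use assms in \<open>auto intro: analytic_on_imp_meromorphic_on\<close>)
  moreover have False if "\<forall>\<^sub>\<approx>z. f z = 0"
  proof -
    have "eventually (\<lambda>z. f z = 0) (at z0)" using that by (rule eventually_cosparse_imp_eventually_at) simp
    moreover have "isCont f z0" by (intro analytic_at_imp_isCont analytic_on_subset[OF assms(1)]) simp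
    then have "f \<midarrow>z0\<rightarrow> f z0" by (simp add: isCont_def)
    ultimately have "((\<lambda>_. 0) \<longlongrightarrow> f z0) (at z0)" by (rule Lim_transform_eventually[rotated])
    then show False using assms(2) by (simp add: tendsto_const_iff)
  qed
  ultimately show ?thesis by blast
qed

text \<open>The difference is zero off a sparse set or nonzero off a sparse set, and the second
  contradicts the agreement near a point of U.\<close>

lemma meromorphic_identity:
  fixes f g :: "complex \<Rightarrow> complex"
  assumes f: "f meromorphic_on UNIV" and g: "g meromorphic_on UNIV" and U: "open U" "z0 \<in> U"
    and eq: "\<forall>\<^sub>\<approx>z. z \<in> U \<longrightarrow> f z = g z"
  shows "\<forall>\<^sub>\<approx>z. f z = g z"
proof -
  have "(\<forall>\<^sub>\<approx>z. f z - g z = 0) \<or> (\<forall>\<^sub>\<approx>z. f z - g z \<noteq> 0)"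
    by (rule meromorphic_imp_constant_or_avoid) (use f g in \<open>auto intro!: meromorphic_intros\<close>)
  moreover have False if "\<forall>\<^sub>\<approx>z. f z - g z \<noteq> 0"
  proof -
    have "eventually (\<lambda>z. f z - g z \<noteq> 0) (at z0)" using that by (rule eventually_cosparse_imp_eventually_at) simp
    moreover have "eventually (\<lambda>z. z \<in> U \<longrightarrow> f z = g z) (at z0)" using eq by (rule eventually_cosparse_imp_eventually_at) simp
    moreover have "eventually (\<lambda>z. z \<in> U) (at z0)" using U by (rule eventually_at_in_open')
    ultimately have "eventually (\<lambda>z. False) (at z0)" by eventually_elim auto
    then show False by simp
  qed
  ultimately show ?thesis by auto
qed

lemma nicely_meromorphic_identity:
  assumes f: "f nicely_meromorphic_on UNIV" and g: "g nicely_meromorphic_on UNIV" and eq: "\<forall>\<^sub>\<approx>z. f z = g z"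
  shows "f = g"
proof
  fix z
  have ev: "eventually (\<lambda>z. f z = g z) (at z)" using eq by (rule eventually_cosparse_imp_eventually_at) simp
  have fz: "(is_pole f z \<and> f z = 0) \<or> f \<midarrow>z\<rightarrow> f z" and gz: "(is_pole g z \<and> g z = 0) \<or> g \<midarrow>z\<rightarrow> g z"
    using f g unfolding nicely_meromorphic_on_def by auto
  have pole: "is_pole f z \<longleftrightarrow> is_pole g z" by (rule is_pole_cong[OF ev refl])
  show "f z = g z"
  proof (cases "is_pole f z")
    case True
    then have "\<not> f \<midarrow>z\<rightarrow> c" "\<not> g \<midarrow>z\<rightarrow> c" for c
      using pole by (metis at_neq_bot is_pole_def not_tendsto_and_filterlim_at_infinity)+
    then show ?thesis using fz gz by auto
  next
    case False
    then have 1: "f \<midarrow>z\<rightarrow> f z" "g \<midarrow>z\<rightarrow> g z" using pole fz gz by auto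
    have "g \<midarrow>z\<rightarrow> f z" using 1(1) ev by (rule Lim_transform_eventually)
    then show ?thesis using 1(2) by (metis LIM_unique)
  qed
qed

text \<open>Generic agreement with a holomorphic function excludes poles of f in U; the
  normalization of f then forces its value to be the limit at each point.\<close>

lemma nicely_meromorphic_eq_on_open:
  assumes f: "f nicely_meromorphic_on UNIV" and a: "a holomorphic_on U" and U: "open U"
    and eq: "\<forall>\<^sub>\<approx>z. z \<in> U \<longrightarrow> f z = a z" and z: "z \<in> U"
  shows "f z = a z"
proof -
  have "eventually (\<lambda>z. z \<in> U \<longrightarrow> f z = a z) (at z)" using eq by (rule eventually_cosparse_imp_eventually_at) simp
  moreover have "eventually (\<lambda>z. z \<in> U) (at z)" using U z by (rule eventually_at_in_open')
  ultimately have ev: "eventually (\<lambda>z. a z = f z) (at z)" by eventually_elim auto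
  have "isCont a z"
    using holomorphic_on_imp_continuous_on[OF a] continuous_on_eq_continuous_at[OF U] z by blast
  then have "f \<midarrow>z\<rightarrow> a z" unfolding isCont_def using ev by (rule Lim_transform_eventually)
  moreover from this have "\<not> is_pole f z" by (metis at_neq_bot is_pole_def not_tendsto_and_filterlim_at_infinity)
  then have "f \<midarrow>z\<rightarrow> f z" using f unfolding nicely_meromorphic_on_def by auto
  ultimately show ?thesis by (metis LIM_unique)
qed

section \<open>Gluing of the three regions and values to the left of the strip\<close>

definition fe_factor :: "nat \<Rightarrow> complex \<Rightarrow> complex" where
  "fe_factor n s = - (2 / of_real pi) * of_real (2 * pi) powr (- 2 * s - of_nat n / 2) * Gamma (1 + s) * Gamma (s + of_nat n / 2)"

text \<open>The zeta functions of h are continued, using those of k on the far left. The locale is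
  instantiated with a Fourier transform and its original in both orders.\<close>

locale dual_pair =
  fixes e :: "'a::euclidean_space" and h k :: "'a \<Rightarrow> complex"
  assumes e: "e \<in> Basis" and h: "rapidly_decaying h" and k: "rapidly_decaying k" and dual: "theta_dual e h k"
    and dim: "DIM('a) \<ge> 3"
begin

text \<open>Three regions: the half-plane where the zeta integrals of h converge, the strip of the
  Mellin integral, and the half-plane where the zeta integrals of k converge at the dual point.
  Neighbouring regions overlap in strips of width 1/4.\<close>

definition mellin_ext :: "real \<Rightarrow> complex \<Rightarrow> complex" where
  "mellin_ext \<tau> s = (if s \<in> {s. Re s > - 1/4} then mellin_factor e h \<tau> s
     else if s \<in> {s. - real DIM('a) / 2 < Re s \<and> Re s < 0} then mellin_theta e h \<tau> s
     else dual_phase DIM('a) \<tau> s * mellin_factor e k (- \<tau>) (- s - of_nat DIM('a) / 2))"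

lemma mellin_factor_meromorphic:
  assumes "rapidly_decaying h'"
  shows "mellin_factor e h' \<tau> meromorphic_on {s. Re s > - 1/4}"
proof -
  have "open {s::complex. Re s > - 1/4}" by (rule open_halfspace_Re_gt)
  then have "lorentz_zeta e parity_one h' analytic_on {s. Re s > - 1/4}" "lorentz_zeta e parity_sgn h' analytic_on {s. Re s > - 1/4}"
    using lorentz_zeta_holomorphic[OF e assms] parity_measurable norm_parity_le by (auto simp: analytic_on_open)
  then show ?thesis unfolding mellin_factor_def
    by (intro meromorphic_intros meromorphic_Gamma_compose)
       (auto intro!: analytic_on_imp_meromorphic_on analytic_intros simp: pi_not_le_zero)
qed

lemma mellin_ext_meromorphic:
  assumes \<tau>: "\<bar>\<tau>\<bar> = 1"
  shows "mellin_ext \<tau> meromorphic_on UNIV"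
proof -
  let ?R = "{s. Re s > - 1/4}" and ?S = "{s. - real DIM('a) / 2 < Re s \<and> Re s < 0}" and ?L = "{s. Re s < 1/4 - real DIM('a) / 2}"
  have opS: "open ?S"
  proof -
    have "?S = {s. Re s > - real DIM('a) / 2} \<inter> {s. Re s < 0}" by auto
    then show ?thesis by (simp add: open_Int open_halfspace_Re_gt open_halfspace_Re_lt)
  qed
  have \<tau>': "\<bar>- \<tau>\<bar> = 1" using \<tau> by simp
  have D: "(\<lambda>s. dual_phase DIM('a) \<tau> s * mellin_factor e k (- \<tau>) (- s - of_nat DIM('a) / 2)) meromorphic_on ?L"
  proof (intro meromorphic_on_mult)
    show "dual_phase DIM('a) \<tau> meromorphic_on ?L" unfolding dual_phase_def
      by (intro analytic_on_imp_meromorphic_on analytic_intros) auto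
    show "(\<lambda>s. mellin_factor e k (- \<tau>) (- s - of_nat DIM('a) / 2)) meromorphic_on ?L"
      by (rule meromorphic_on_compose[OF mellin_factor_meromorphic[OF k]]) (auto intro!: analytic_intros)
  qed
  have SL: "(\<lambda>s. if s \<in> ?S then mellin_theta e h \<tau> s else dual_phase DIM('a) \<tau> s * mellin_factor e k (- \<tau>) (- s - of_nat DIM('a) / 2))
     meromorphic_on ?S \<union> ?L"
  proof (rule meromorphic_on_If)
    show "mellin_theta e h \<tau> meromorphic_on ?S"
      using mellin_theta_holomorphic[OF e h theta_dual_decays[OF dual] \<tau>] opS
      by (intro analytic_on_imp_meromorphic_on) (simp add: analytic_on_open)
    fix s assume s: "s \<in> ?S" "s \<in> ?L"
    \<comment> \<open>Here - s - n / 2 has real part between -1/4 and 0, where the Mellin integral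
      of k is known explicitly.\<close>
    show "mellin_theta e h \<tau> s = dual_phase DIM('a) \<tau> s * mellin_factor e k (- \<tau>) (- s - of_nat DIM('a) / 2)"
      unfolding mellin_theta_dual[OF dual \<tau>]
      by (subst mellin_theta_eq[OF e k theta_dual_decays[OF theta_dual_sym[OF dual]] \<tau>']) (use s dim in auto)
  qed (use D opS in \<open>auto simp: open_halfspace_Re_lt\<close>)
  show ?thesis unfolding mellin_ext_def
  proof (rule meromorphic_on_If[OF mellin_factor_meromorphic[OF h] SL])
    fix s assume s: "s \<in> ?R" "s \<in> ?S \<union> ?L"
    \<comment> \<open>The two half-planes are disjoint because n \<ge> 3, so the only overlap to
      check is with the strip.\<close>
    then have "s \<in> ?S" using dim by auto
    then show "mellin_factor e h \<tau> s = (if s \<in> ?S then mellin_theta e h \<tau> s else dual_phase DIM('a) \<tau> s * mellin_factor e k (- \<tau>) (- s - of_nat DIM('a) / 2))"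
      using mellin_theta_eq[OF e h theta_dual_decays[OF dual] \<tau>, of s] s by simp
  next
    show "UNIV \<subseteq> ?R \<union> (?S \<union> ?L)" using dim by auto
  qed (use opS in \<open>auto simp: open_halfspace_Re_lt open_halfspace_Re_gt\<close>)
qed

lemma mellin_ext_right: "Re s > - 1/4 \<Longrightarrow> mellin_ext \<tau> s = mellin_factor e h \<tau> s"
  by (simp add: mellin_ext_def)

lemma mellin_ext_left:
  assumes "Re s < - real DIM('a) / 2"
  shows "mellin_ext \<tau> s = dual_phase DIM('a) \<tau> s * mellin_factor e k (- \<tau>) (- s - of_nat DIM('a) / 2)"
  using assms dim by (simp add: mellin_ext_def)

text \<open>The equations of \<open>mellin_factor\<close> for \<tau> = 1 and \<tau> = -1 are solved
  for the even zeta function: their sum keeps the cosine term only, just as the difference in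
  \<open>ext_minus\<close> keeps the sine term. Division by Gamma(-s) is multiplication by the
  entire \<open>rGamma\<close>, and \<open>remove_sings\<close> supplies the normalized
  values.\<close>

definition ext_plus :: "complex \<Rightarrow> complex" where
  "ext_plus = remove_sings (\<lambda>s. (mellin_ext 1 s + mellin_ext (- 1) s) * (rGamma (- s) / (2 * of_real pi powr s * cos (of_real pi * s / 2))))"

definition ext_minus :: "complex \<Rightarrow> complex" where
  "ext_minus = remove_sings (\<lambda>s. (mellin_ext 1 s - mellin_ext (- 1) s) * (rGamma (- s) / (- 2 * \<i> * of_real pi powr s * sin (of_real pi * s / 2))))"

lemma ext_raw_meromorphic:
  "(\<lambda>s. (mellin_ext 1 s + mellin_ext (- 1) s) * (rGamma (- s) / (2 * of_real pi powr s * cos (of_real pi * s / 2)))) meromorphic_on UNIV"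
  "(\<lambda>s. (mellin_ext 1 s - mellin_ext (- 1) s) * (rGamma (- s) / (- 2 * \<i> * of_real pi powr s * sin (of_real pi * s / 2)))) meromorphic_on UNIV"
proof -
  have M: "mellin_ext 1 meromorphic_on UNIV" "mellin_ext (- 1) meromorphic_on UNIV"
    by (intro mellin_ext_meromorphic; simp)+
  have R: "(\<lambda>s. rGamma (- s)) meromorphic_on UNIV"
    by (intro analytic_on_imp_meromorphic_on analytic_intros)
  have C: "(\<lambda>s. 2 * of_real pi powr s * cos (of_real pi * s / 2) :: complex) meromorphic_on UNIV"
    "(\<lambda>s. - 2 * \<i> * of_real pi powr s * sin (of_real pi * s / 2)) meromorphic_on UNIV"
    by (auto intro!: analytic_on_imp_meromorphic_on analytic_intros simp: pi_not_le_zero)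
  show "(\<lambda>s. (mellin_ext 1 s + mellin_ext (- 1) s) * (rGamma (- s) / (2 * of_real pi powr s * cos (of_real pi * s / 2)))) meromorphic_on UNIV"
    by (rule meromorphic_on_mult[OF meromorphic_on_add[OF M] meromorphic_on_divide[OF R C(1)]])
  show "(\<lambda>s. (mellin_ext 1 s - mellin_ext (- 1) s) * (rGamma (- s) / (- 2 * \<i> * of_real pi powr s * sin (of_real pi * s / 2)))) meromorphic_on UNIV"
    by (rule meromorphic_on_mult[OF meromorphic_on_diff[OF M] meromorphic_on_divide[OF R C(2)]])
qed

lemma ext_nicely: "ext_plus nicely_meromorphic_on UNIV" "ext_minus nicely_meromorphic_on UNIV"
  unfolding ext_plus_def ext_minus_def by (intro remove_sings_nicely_meromorphic ext_raw_meromorphic)+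

lemma ext_eq:
  "\<forall>\<^sub>\<approx>s. ext_plus s = (mellin_ext 1 s + mellin_ext (- 1) s) * (rGamma (- s) / (2 * of_real pi powr s * cos (of_real pi * s / 2)))"
  "\<forall>\<^sub>\<approx>s. ext_minus s = (mellin_ext 1 s - mellin_ext (- 1) s) * (rGamma (- s) / (- 2 * \<i> * of_real pi powr s * sin (of_real pi * s / 2)))"
  unfolding ext_plus_def ext_minus_def by (intro eventually_remove_sings_eq ext_raw_meromorphic)+

text \<open>These are the quantities divided by in solving for the zeta functions. The point 1/2
  witnesses that their product is not identically zero.\<close>

lemma generic_nonzero:
  "\<forall>\<^sub>\<approx>s::complex. rGamma (- s) * cos (of_real pi * s / 2) * sin (of_real pi * s / 2) \<noteq> 0"
proof (rule eventually_cosparse_nonzero[of _ "1/2"])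
  have "- (1/2) \<notin> (\<int>\<^sub>\<le>\<^sub>0 :: complex set)"
  proof
    assume "- (1/2) \<in> (\<int>\<^sub>\<le>\<^sub>0 :: complex set)"
    then obtain m where "- (1/2) = - (of_nat m :: complex)" by (elim nonpos_Ints_cases')
    then have "of_nat (2 * m) = (of_nat 1 :: complex)" by (simp add: mult.commute)
    then have "2 * m = 1" by (rule of_nat_eq_iff[THEN iffD1])
    then show False by presburger
  qed
  moreover have "cos (of_real pi * (1/2) / 2) \<noteq> (0 :: complex)"
  proof -
    have eq: "cos (of_real pi * (1/2) / 2) = (of_real (cos (pi / 4)) :: complex)" unfolding cos_of_real[symmetric] by simp
    show ?thesis unfolding eq of_real_eq_0_iff cos_45 by simp
  qed
  moreover have "sin (of_real pi * (1/2) / 2) \<noteq> (0 :: complex)"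
  proof -
    have eq: "sin (of_real pi * (1/2) / 2) = (of_real (sin (pi / 4)) :: complex)" unfolding sin_of_real[symmetric] by simp
    show ?thesis unfolding eq of_real_eq_0_iff sin_45 by simp
  qed
  ultimately show "rGamma (- (1/2)) * cos (of_real pi * (1/2) / 2) * sin (of_real pi * (1/2) / 2) \<noteq> (0::complex)"
    by (simp only: rGamma_eq_zero_iff mult_eq_0_iff de_Morgan_disj simp_thms)
qed (auto intro!: analytic_intros)

lemma ext_right:
  assumes "Re s > - 1/4"
  shows "ext_plus s = lorentz_zeta e parity_one h s" "ext_minus s = lorentz_zeta e parity_sgn h s"
proof -
  have s: "s \<in> {s. Re s > - 1/4}" using assms by simp
  have op: "open {s::complex. Re s > - 1/4}" by (rule open_halfspace_Re_gt)
  have hol: "lorentz_zeta e parity_one h holomorphic_on {s. Re s > - 1/4}" "lorentz_zeta e parity_sgn h holomorphic_on {s. Re s > - 1/4}"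
    using lorentz_zeta_holomorphic[OF e h] parity_measurable norm_parity_le by auto
  show "ext_plus s = lorentz_zeta e parity_one h s"
  proof (rule nicely_meromorphic_eq_on_open[OF ext_nicely(1) hol(1) op _ s])
    show "\<forall>\<^sub>\<approx>s. s \<in> {s. - 1 / 4 < Re s} \<longrightarrow> ext_plus s = lorentz_zeta e parity_one h s"
      using ext_eq(1) generic_nonzero
    proof eventually_elim
      case (elim s)
      then show ?case
        by (auto simp: mellin_ext_right mellin_factor_def rGamma_inverse_Gamma field_simps)
    qed
  qed
  show "ext_minus s = lorentz_zeta e parity_sgn h s"
  proof (rule nicely_meromorphic_eq_on_open[OF ext_nicely(2) hol(2) op _ s])
    show "\<forall>\<^sub>\<approx>s. s \<in> {s. - 1 / 4 < Re s} \<longrightarrow> ext_minus s = lorentz_zeta e parity_sgn h s"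
      using ext_eq(2) generic_nonzero
    proof eventually_elim
      case (elim s)
      then show ?case
        by (auto simp: mellin_ext_right mellin_factor_def rGamma_inverse_Gamma field_simps)
    qed
  qed
qed

text \<open>The reflection formula turns 1 / Gamma(-s) into Gamma(1+s) times the sine of pi s. The
  double-angle formula splits that sine so that one half-angle factor cancels the denominator of
  \<open>ext_plus\<close> or \<open>ext_minus\<close> and the other survives.\<close>

lemma fe_prefactor:
  assumes "rGamma (- s) * cos (of_real pi * s / 2) * sin (of_real pi * s / 2) \<noteq> 0"
  shows "2 powr (- 2 * s - of_nat DIM('a) / 2) * Gamma (s + of_nat DIM('a) / 2) * of_real pi powr (- s - of_nat DIM('a) / 2) *
      (rGamma (- s) / of_real pi powr s) = fe_factor DIM('a) s * sin (of_real pi * s / 2) * cos (of_real pi * s / 2)"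
proof -
  have sin2: "sin (of_real pi * s) = 2 * sin (of_real pi * s / 2) * cos (of_real pi * s / 2)"
    using sin_double[of "of_real pi * s / 2"] by simp
  have refl: "rGamma (- s) * rGamma (1 + s) = - sin (of_real pi * s) / of_real pi"
    using rGamma_reflection_complex[of "- s"] by simp
  then have nz: "rGamma (1 + s) \<noteq> 0" using assms unfolding sin2 by auto
  have "Gamma (1 + s) = inverse (rGamma (1 + s))" by (simp add: rGamma_inverse_Gamma)
  then have G: "rGamma (- s) = - sin (of_real pi * s) / of_real pi * Gamma (1 + s)"
    unfolding refl[symmetric] using nz by simp
  have "of_real (2 * pi) powr w = 2 powr w * of_real pi powr w" for w :: complex
    using powr_times_real[of 2 "of_real pi" w] by simp
  moreover have "complex_of_real pi powr (- 2 * s - of_nat DIM('a) / 2) = of_real pi powr (- s - of_nat DIM('a) / 2) / of_real pi powr s"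
    using powr_diff[of "complex_of_real pi" "- s - of_nat DIM('a) / 2" s] by (simp add: algebra_simps)
  ultimately have P: "of_real (2 * pi) powr (- 2 * s - of_nat DIM('a) / 2)
     = 2 powr (- 2 * s - of_nat DIM('a) / 2) * (of_real pi powr (- s - of_nat DIM('a) / 2) / of_real pi powr s)" by simp
  show ?thesis unfolding fe_factor_def P G sin2 by (simp add: field_simps)
qed

context
  fixes \<theta> :: complex and \<beta> :: "complex \<Rightarrow> complex"
  assumes \<theta>: "\<theta> = of_real (pi * (real DIM('a) - 2) / 4)"
    and \<beta>: "\<beta> = (\<lambda>s. of_real pi / 2 * (s + of_nat DIM('a) / 2))"
begin

text \<open>Here \<theta> is the angle of the Weil phase, and - \<beta> s is pi / 2 times the dual
  point - s - n / 2, the angle in \<open>mellin_factor\<close> there.\<close>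

lemma mellin_ext_left_expand:
  assumes "Re s < - real DIM('a) / 2" "\<tau> = 1 \<or> \<tau> = - 1"
  shows "mellin_ext \<tau> s = 2 powr (- 2 * s - of_nat DIM('a) / 2) * Gamma (s + of_nat DIM('a) / 2) * of_real pi powr (- s - of_nat DIM('a) / 2) *
     ((cos \<theta> - \<i> * of_real \<tau> * sin \<theta>) * (cos (\<beta> s) * lorentz_zeta e parity_one k (- s - of_nat DIM('a) / 2)
       - \<i> * of_real \<tau> * sin (\<beta> s) * lorentz_zeta e parity_sgn k (- s - of_nat DIM('a) / 2)))"
proof -
  have "exp (- (\<i> * of_real \<tau> * \<theta>)) = cos \<theta> - \<i> * of_real \<tau> * sin \<theta>"
    using assms(2) exp_Euler[of \<theta>] exp_Euler[of "- \<theta>"] by auto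
  then have ph: "exp (- (\<i> * of_real (\<tau> * (pi * (real DIM('a) - 2) / 4)))) = cos \<theta> - \<i> * of_real \<tau> * sin \<theta>"
    by (simp add: \<theta> mult.assoc)
  have b: "of_real pi * (- s - of_nat DIM('a) / 2) / 2 = - \<beta> s" by (simp add: \<beta> field_simps)
  show ?thesis
    unfolding mellin_ext_left[OF assms(1)] dual_phase_def mellin_factor_def b ph
    by (simp add: add.commute)
qed

lemma ext_left_at:
  assumes s: "Re s < - real DIM('a) / 2"
    and nz: "rGamma (- s) * cos (of_real pi * s / 2) * sin (of_real pi * s / 2) \<noteq> 0"
  defines "A \<equiv> lorentz_zeta e parity_one k (- s - of_nat DIM('a) / 2)"
    and "B \<equiv> lorentz_zeta e parity_sgn k (- s - of_nat DIM('a) / 2)"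
  shows "(mellin_ext 1 s + mellin_ext (- 1) s) * (rGamma (- s) / (2 * of_real pi powr s * cos (of_real pi * s / 2)))
      = fe_factor DIM('a) s * sin (of_real pi * s / 2) * (cos \<theta> * cos (\<beta> s) * A - sin \<theta> * sin (\<beta> s) * B)" (is ?plus)
    and "(mellin_ext 1 s - mellin_ext (- 1) s) * (rGamma (- s) / (- 2 * \<i> * of_real pi powr s * sin (of_real pi * s / 2)))
      = fe_factor DIM('a) s * cos (of_real pi * s / 2) * (sin \<theta> * cos (\<beta> s) * A + cos \<theta> * sin (\<beta> s) * B)" (is ?minus)
proof -
  define T where "T = 2 powr (- 2 * s - of_nat DIM('a) / 2) * Gamma (s + of_nat DIM('a) / 2) * of_real pi powr (- s - of_nat DIM('a) / 2)"
  define R where "R = T * (rGamma (- s) / of_real pi powr s)"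
  have c: "cos (of_real pi * s / 2) \<noteq> 0" "sin (of_real pi * s / 2) \<noteq> 0" using nz by auto
  have pf: "R = fe_factor DIM('a) s * sin (of_real pi * s / 2) * cos (of_real pi * s / 2)"
    unfolding R_def T_def by (rule fe_prefactor[OF nz])
  have M: "mellin_ext 1 s = T * ((cos \<theta> - \<i> * sin \<theta>) * (cos (\<beta> s) * A - \<i> * sin (\<beta> s) * B))"
    "mellin_ext (- 1) s = T * ((cos \<theta> + \<i> * sin \<theta>) * (cos (\<beta> s) * A + \<i> * sin (\<beta> s) * B))"
    unfolding A_def B_def T_def using mellin_ext_left_expand[OF s, of 1] mellin_ext_left_expand[OF s, of "- 1"] by simp_all
  have "mellin_ext 1 s + mellin_ext (- 1) s = 2 * T * (cos \<theta> * cos (\<beta> s) * A - sin \<theta> * sin (\<beta> s) * B)"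
    unfolding M by (simp add: algebra_simps)
  then have "(mellin_ext 1 s + mellin_ext (- 1) s) * (rGamma (- s) / (2 * of_real pi powr s * cos (of_real pi * s / 2)))
      = R * (cos \<theta> * cos (\<beta> s) * A - sin \<theta> * sin (\<beta> s) * B) / cos (of_real pi * s / 2)"
    unfolding R_def by simp
  then show ?plus unfolding pf using c by simp
  have "mellin_ext 1 s - mellin_ext (- 1) s = (- 2 * \<i>) * (T * (sin \<theta> * cos (\<beta> s) * A + cos \<theta> * sin (\<beta> s) * B))"
    unfolding M by (simp add: algebra_simps)
  then have "(mellin_ext 1 s - mellin_ext (- 1) s) * (rGamma (- s) / (- 2 * \<i> * of_real pi powr s * sin (of_real pi * s / 2)))
      = R * (sin \<theta> * cos (\<beta> s) * A + cos \<theta> * sin (\<beta> s) * B) / sin (of_real pi * s / 2)"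
    unfolding R_def by simp
  then show ?minus unfolding pf using c by simp
qed

text \<open>For Re s < - n / 2 the dual point has positive real part, so the right sides are
  convergent integrals of k.\<close>

lemma ext_left:
  "\<forall>\<^sub>\<approx>s. s \<in> {s. Re s < - real DIM('a) / 2} \<longrightarrow> ext_plus s = fe_factor DIM('a) s * sin (of_real pi * s / 2) *
      (cos \<theta> * cos (\<beta> s) * lorentz_zeta e parity_one k (- s - of_nat DIM('a) / 2) - sin \<theta> * sin (\<beta> s) * lorentz_zeta e parity_sgn k (- s - of_nat DIM('a) / 2))"
  "\<forall>\<^sub>\<approx>s. s \<in> {s. Re s < - real DIM('a) / 2} \<longrightarrow> ext_minus s = fe_factor DIM('a) s * cos (of_real pi * s / 2) *
      (sin \<theta> * cos (\<beta> s) * lorentz_zeta e parity_one k (- s - of_nat DIM('a) / 2) + cos \<theta> * sin (\<beta> s) * lorentz_zeta e parity_sgn k (- s - of_nat DIM('a) / 2))"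
  subgoal using ext_eq(1) generic_nonzero by eventually_elim (simp only: mem_Collect_eq, intro impI ext_left_at; assumption)
  subgoal using ext_eq(2) generic_nonzero by eventually_elim (simp only: mem_Collect_eq, intro impI ext_left_at; assumption)
  done

end

end

subsection \<open>Euclidean Jordan algebras of rank two\<close>

lemma jordan_unit_right: "x * 1 = (x::'a::jordan_algebra)"
  by (metis jordan_mult_commute jordan_unit)

lemma jordan_distrib_left: "z * (x + y) = z * x + z * (y::'a::jordan_algebra)"
  by (metis jordan_mult_commute jordan_distrib_right)

lemma jordan_scaleR_right: "x * (a *\<^sub>R y) = a *\<^sub>R (x * (y::'a::jordan_algebra))"
  by (metis jordan_mult_commute jordan_scaleR_left)

lemma jordan_zero_left: "0 * x = (0::'a::jordan_algebra)"
  using jordan_scaleR_left[of 0 x x] by simp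

lemma jordan_zero_right: "x * 0 = (0::'a::jordan_algebra)"
  by (metis jordan_mult_commute jordan_zero_left)

lemma jordan_minus_left: "(- x) * y = - (x * (y::'a::jordan_algebra))"
  using jordan_scaleR_left[of "-1" x y] by simp

lemma jordan_minus_right: "x * (- y) = - (x * (y::'a::jordan_algebra))"
  using jordan_scaleR_right[of x "-1" y] by simp

lemma scaleR_double: "(a * 2) *\<^sub>R x = a *\<^sub>R x + a *\<^sub>R (x::'a::real_vector)"
  by (simp flip: scaleR_add_left)

lemma jordan_diff_left: "(x - y) * z = x * z - y * (z::'a::jordan_algebra)"
  using jordan_distrib_right[of x "- y" z] by (simp add: jordan_minus_left)

lemma jordan_diff_right: "z * (x - y) = z * x - z * (y::'a::jordan_algebra)"
  using jordan_distrib_left[of z x "- y"] by (simp add: jordan_minus_right)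

lemmas jordan_bilinear = jordan_diff_left jordan_diff_right jordan_distrib_left jordan_distrib_right jordan_scaleR_left jordan_scaleR_right
  jordan_unit jordan_unit_right jordan_zero_left jordan_zero_right jordan_minus_left jordan_minus_right

lemma jordan_one_neq_zero: "(1::'a::euclidean_jordan_algebra) \<noteq> 0"
proof
  assume "(1::'a) = 0"
  then have "x = 0" for x :: 'a using jordan_unit[of x] jordan_zero_left[of x] by simp
  then show False using nonempty_Basis nonzero_Basis by blast
qed

section \<open>Existence and uniqueness of minimal polynomials\<close>

lemma jpoly_altdef: "degree p \<le> n \<Longrightarrow> jpoly p x = (\<Sum>i\<le>n. coeff p i *\<^sub>R x ^ i)"
  unfolding jpoly_def by (rule sum.mono_neutral_left) (auto simp: coeff_eq_0 not_le)

lemma jpoly_diff: "jpoly (p - q) x = jpoly p x - jpoly q x"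
proof -
  let ?n = "max (degree p) (degree q)"
  have "degree (p - q) \<le> ?n" by (rule degree_diff_le_max)
  then show ?thesis
    by (simp add: jpoly_altdef[of _ ?n] scaleR_diff_left sum_subtractf)
qed

lemma jpoly_smult: "jpoly (smult a p) x = a *\<^sub>R jpoly p x"
  by (simp add: jpoly_altdef[of _ "degree p"] degree_smult_le scaleR_sum_right)

lemma exists_annihilating_jpoly:
  fixes x :: "'a::euclidean_jordan_algebra"
  shows "\<exists>p. p \<noteq> 0 \<and> degree p \<le> DIM('a) \<and> jpoly p x = 0"
proof (cases "inj_on (\<lambda>i. x ^ i) {..DIM('a)}")
  case True
  let ?S = "(\<lambda>i. x ^ i) ` {..DIM('a)}"
  have "card ?S > DIM('a)" using True by (simp add: card_image)
  then have "dependent ?S" using independent_card_le[of ?S] by (metis not_le independent_bound)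
  then obtain u where u: "\<exists>v\<in>?S. u v \<noteq> 0" "(\<Sum>v\<in>?S. u v *\<^sub>R v) = 0"
    using dependent_finite[of ?S] by auto
  define p where "p = (\<Sum>i\<le>DIM('a). monom (u (x ^ i)) i)"
  have c: "coeff p i = (if i \<le> DIM('a) then u (x ^ i) else 0)" for i
    by (auto simp: p_def coeff_sum sum.delta)
  have "degree p \<le> DIM('a)" by (rule degree_le) (simp add: c)
  moreover have "p \<noteq> 0" using u(1) c by (metis (no_types, lifting) atMost_iff coeff_0 imageE)
  moreover have "jpoly p x = (\<Sum>i\<le>DIM('a). u (x ^ i) *\<^sub>R x ^ i)"
    using \<open>degree p \<le> DIM('a)\<close> by (simp add: jpoly_altdef c)
  moreover have "\<dots> = 0" using u(2) True by (simp add: sum.reindex)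
  ultimately show ?thesis by metis
next
  \<comment> \<open>Linear dependence of a set does not see repetitions; a repeated power gives a
    binomial annihilator at once.\<close>
  case False
  then obtain i j where ij: "i \<le> DIM('a)" "j \<le> DIM('a)" "i \<noteq> j" "x ^ i = x ^ j"
    by (auto simp: inj_on_def)
  let ?p = "monom (1::real) i - monom 1 j"
  have "coeff ?p i = 1" using ij by simp
  then have "?p \<noteq> 0" by (metis coeff_0 zero_neq_one)
  moreover have "degree ?p \<le> DIM('a)" using ij by (intro degree_diff_le) (auto simp: degree_monom_eq)
  moreover have "jpoly (monom 1 k) x = x ^ k" for k
    unfolding jpoly_def by (simp add: degree_monom_eq if_distrib[of "\<lambda>a. a *\<^sub>R _"] sum.delta cong: if_cong)
  ultimately show ?thesis using ij by (metis jpoly_diff right_minus_eq)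
qed

lemma jminpoly_ex1:
  fixes x :: "'a::euclidean_jordan_algebra"
  shows "\<exists>!p. lead_coeff p = 1 \<and> jpoly p x = 0 \<and> (\<forall>q. q \<noteq> 0 \<and> jpoly q x = 0 \<longrightarrow> degree p \<le> degree q)"
proof (rule ex_ex1I)
  obtain q where q: "q \<noteq> 0 \<and> jpoly q x = 0"
    and min: "\<And>p. p \<noteq> 0 \<and> jpoly p x = 0 \<Longrightarrow> degree q \<le> degree p"
    using exists_annihilating_jpoly[of x] ex_has_least_nat[of "\<lambda>p. p \<noteq> 0 \<and> jpoly p x = 0" _ degree] by blast
  show "\<exists>p. lead_coeff p = 1 \<and> jpoly p x = 0 \<and> (\<forall>q. q \<noteq> 0 \<and> jpoly q x = 0 \<longrightarrow> degree p \<le> degree q)"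
    by (rule exI[of _ "smult (inverse (lead_coeff q)) q"]) (use q min in \<open>auto simp: jpoly_smult\<close>)
next
  fix p q
  assume p: "lead_coeff p = 1 \<and> jpoly p x = 0 \<and> (\<forall>q. q \<noteq> 0 \<and> jpoly q x = 0 \<longrightarrow> degree p \<le> degree q)"
    and q: "lead_coeff q = 1 \<and> jpoly q x = 0 \<and> (\<forall>p. p \<noteq> 0 \<and> jpoly p x = 0 \<longrightarrow> degree q \<le> degree p)"
  have nz: "p \<noteq> 0" "q \<noteq> 0" using p q by auto
  then have deg: "degree p = degree q" using p q by (meson le_antisym)
  show "p = q"
  proof (rule ccontr)
    assume "p \<noteq> q"
    then have "p - q \<noteq> 0" "jpoly (p - q) x = 0" using p q by (auto simp: jpoly_diff)
    then have le: "degree p \<le> degree (p - q)" using p by blast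
    have "coeff (p - q) (degree p) = 0" using p q deg by simp
    moreover have "degree (p - q) \<le> degree p" using deg degree_diff_le by (metis order_refl)
    ultimately show False using le \<open>p - q \<noteq> 0\<close> by (metis le_antisym leading_coeff_0_iff)
  qed
qed

lemma
  fixes x :: "'a::euclidean_jordan_algebra"
  shows lead_coeff_jminpoly: "lead_coeff (jminpoly x) = 1"
    and jpoly_jminpoly: "jpoly (jminpoly x) x = 0"
    and jminpoly_minimal: "q \<noteq> 0 \<Longrightarrow> jpoly q x = 0 \<Longrightarrow> degree (jminpoly x) \<le> degree q"
  using theI'[OF jminpoly_ex1[of x]] unfolding jminpoly_def by auto

lemma jminpolyI:
  fixes x :: "'a::euclidean_jordan_algebra"
  assumes "lead_coeff p = 1" "jpoly p x = 0" "\<And>q. q \<noteq> 0 \<Longrightarrow> jpoly q x = 0 \<Longrightarrow> degree p \<le> degree q"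
  shows "jminpoly x = p"
  unfolding jminpoly_def by (rule the1_equality[OF jminpoly_ex1]) (use assms in auto)

lemma finite_degree_jminpoly: "finite (range (\<lambda>x::'a::euclidean_jordan_algebra. degree (jminpoly x)))"
proof (rule finite_subset)
  show "range (\<lambda>x::'a. degree (jminpoly x)) \<subseteq> {..DIM('a)}"
    using exists_annihilating_jpoly jminpoly_minimal by (force intro: order_trans)
qed simp

lemma jpoly_degree_le_2:
  "degree p \<le> 2 \<Longrightarrow> jpoly p x = coeff p 0 *\<^sub>R 1 + coeff p 1 *\<^sub>R x + coeff p 2 *\<^sub>R (x * (x::'a::jordan_algebra))"
  by (simp add: jpoly_altdef[of p 2] numeral_2_eq_2 jordan_unit_right)

section \<open>Rank-two algebras as spin factors\<close>

locale rank_two =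
  fixes dummy :: "'a::euclidean_jordan_algebra itself"
  assumes rank: "jrank TYPE('a) = 2"
begin

lemma degree_jminpoly_le: "degree (jminpoly (x::'a)) \<le> 2"
  using rank finite_degree_jminpoly Max_ge[of "range (\<lambda>x::'a. degree (jminpoly x))" "degree (jminpoly x)"]
  by (simp add: jrank_def)

lemma exists_regular: "\<exists>x::'a. degree (jminpoly x) = 2"
proof -
  have "Max (range (\<lambda>x::'a. degree (jminpoly x))) \<in> range (\<lambda>x::'a. degree (jminpoly x))"
    by (rule Max_in) (auto simp: finite_degree_jminpoly)
  then show ?thesis using rank by (auto simp: jrank_def)
qed

lemma square_in_span: "\<exists>a b. (x::'a) * x = a *\<^sub>R x + b *\<^sub>R 1"
proof -
  let ?p = "jminpoly x"
  have eq: "coeff ?p 0 *\<^sub>R 1 + coeff ?p 1 *\<^sub>R x + coeff ?p 2 *\<^sub>R (x * x) = 0"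
    using jpoly_jminpoly[of x] jpoly_degree_le_2[OF degree_jminpoly_le, of x x] by simp
  consider "degree ?p = 0" | "degree ?p = 1" | "degree ?p = 2"
    using degree_jminpoly_le[of x] by (cases "degree ?p" rule: nat.exhaust) (auto simp: le_Suc_eq)
  then show ?thesis
  proof cases
    case 1
    then have "coeff ?p 0 = 1" "coeff ?p 1 = 0" "coeff ?p 2 = 0"
      using lead_coeff_jminpoly[of x] by (auto simp: coeff_eq_0)
    then show ?thesis using eq jordan_one_neq_zero[where 'a='a] by simp
  next
    case 2
    then have c: "coeff ?p 1 = 1" "coeff ?p 2 = 0"
      using lead_coeff_jminpoly[of x] by (auto simp: coeff_eq_0)
    then have "coeff ?p 0 *\<^sub>R 1 + x = 0" using eq by simp
    then have "x = (- coeff ?p 0) *\<^sub>R 1" by (simp add: eq_neg_iff_add_eq_0 add.commute)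
    then have "x * x = 0 *\<^sub>R x + (coeff ?p 0)\<^sup>2 *\<^sub>R 1"
      by (metis (no_types) jordan_scaleR_left jordan_scaleR_right jordan_unit scaleR_scaleR power2_eq_square minus_mult_minus scaleR_zero_left add_0)
    then show ?thesis by blast
  next
    case 3
    then have "coeff ?p 2 = 1" using lead_coeff_jminpoly[of x] by simp
    then have "x * x = (- coeff ?p 1) *\<^sub>R x + (- coeff ?p 0) *\<^sub>R 1"
      using eq by (simp add: algebra_simps eq_neg_iff_add_eq_0)
    then show ?thesis by blast
  qed
qed

lemma square_zero: "(x::'a) * x = 0 \<Longrightarrow> x = 0"
  using jordan_formally_real[of x 0] by (simp add: jordan_bilinear)

lemma square_neg: "(x::'a) * x = c *\<^sub>R 1 \<Longrightarrow> c \<ge> 0"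
proof (rule ccontr)
  assume x: "x * x = c *\<^sub>R 1" and "\<not> c \<ge> 0"
  then have "x * x + (sqrt (- c) *\<^sub>R 1) * (sqrt (- c) *\<^sub>R 1) = 0"
    by (simp add: jordan_bilinear)
  then have "sqrt (- c) *\<^sub>R (1::'a) = 0" using jordan_formally_real by blast
  then show False using \<open>\<not> c \<ge> 0\<close> jordan_one_neq_zero[where 'a='a] by simp
qed

definition traceless :: "'a set" where
  "traceless = {w. (\<exists>c. w * w = c *\<^sub>R 1) \<and> (w \<in> range (\<lambda>a. a *\<^sub>R 1) \<longrightarrow> w = 0)}"

lemma traceless_iff: "w \<in> traceless \<longleftrightarrow> (\<exists>c. w * w = c *\<^sub>R 1) \<and> (w \<in> range (\<lambda>a. a *\<^sub>R 1) \<longrightarrow> w = 0)"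
  by (simp add: traceless_def)

lemma traceless_decomp: "\<exists>t w. (x::'a) = t *\<^sub>R 1 + w \<and> w \<in> traceless"
proof (cases "x \<in> range (\<lambda>a. a *\<^sub>R 1)")
  case True
  then obtain t where "x = t *\<^sub>R 1 + 0" by auto
  moreover have "0 \<in> traceless" unfolding traceless_iff by (auto simp: jordan_bilinear intro: exI[of _ 0])
  ultimately show ?thesis by blast
next
  case False
  obtain a b where ab: "x * x = a *\<^sub>R x + b *\<^sub>R 1" using square_in_span by blast
  \<comment> \<open>Completing the square in the quadratic equation of x.\<close>
  let ?w = "x + (- a / 2) *\<^sub>R 1"
  have "?w * ?w = (b + a\<^sup>2 / 4) *\<^sub>R 1"
  proof -
    have "?w * ?w = a *\<^sub>R x + b *\<^sub>R 1 + (- a / 2) *\<^sub>R x + ((- a / 2) *\<^sub>R x + (a\<^sup>2 / 4) *\<^sub>R 1)"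
      by (simp only: jordan_bilinear ab scaleR_scaleR) (simp add: power2_eq_square scaleR_diff_right)
    also have "\<dots> = (a - a / 2 - a / 2) *\<^sub>R x + (b + a\<^sup>2 / 4) *\<^sub>R 1"
      unfolding scaleR_add_left scaleR_diff_left by simp
    finally show ?thesis by simp
  qed
  moreover have "?w \<notin> range (\<lambda>a. a *\<^sub>R 1)"
  proof
    assume "?w \<in> range (\<lambda>a. a *\<^sub>R 1)"
    then obtain k where "x + (- a / 2) *\<^sub>R 1 = k *\<^sub>R 1" by auto
    then have "x = (k + a / 2) *\<^sub>R 1" by (simp add: algebra_simps)
    then show False using False by blast
  qed
  ultimately have "?w \<in> traceless" unfolding traceless_iff by blast
  moreover have "x = (a / 2) *\<^sub>R 1 + ?w" by simp
  ultimately show ?thesis by blast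
qed

lemma traceless_scalar: "w \<in> traceless \<Longrightarrow> w = a *\<^sub>R 1 \<Longrightarrow> w = 0"
  unfolding traceless_iff by blast

text \<open>Comparing two expressions for the square of q v makes 2 p r u a scalar. So either u = 0,
  or p r = 0, and then v is zero or a multiple of u.\<close>

lemma traceless_mult_scaled:
  assumes u: "u \<in> traceless" and v: "v \<in> traceless" and eq: "q *\<^sub>R v = p *\<^sub>R u + r *\<^sub>R 1" and q: "q \<noteq> 0"
  shows "\<exists>c. u * v = c *\<^sub>R 1"
proof -
  obtain cu where cu: "u * u = cu *\<^sub>R 1" using u by (auto simp: traceless_iff)
  obtain cv where cv: "v * v = cv *\<^sub>R 1" using v by (auto simp: traceless_iff)
  have "(q *\<^sub>R v) * (q *\<^sub>R v) = (q * q * cv) *\<^sub>R 1" by (simp add: jordan_bilinear cv)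
  moreover have "(q *\<^sub>R v) * (q *\<^sub>R v) = (p * r + p * r) *\<^sub>R u + (p * p * cu + r * r) *\<^sub>R 1"
    unfolding eq by (simp add: jordan_bilinear cu algebra_simps) (simp flip: scaleR_left_distrib)
  ultimately have e: "(p * r + p * r) *\<^sub>R u = (q * q * cv - (p * p * cu + r * r)) *\<^sub>R 1"
    by (simp add: algebra_simps)
  have v': "v = (1 / q) *\<^sub>R (p *\<^sub>R u + r *\<^sub>R 1)" using q by (simp flip: eq)
  show ?thesis
  proof (cases "p * r = 0")
    case True
    then consider "p = 0" | "r = 0" by auto
    then show ?thesis
    proof cases
      case 1
      then have "v = (r / q) *\<^sub>R 1" using v' by simp
      then have "v = 0" using traceless_scalar[OF v] by blast
      then show ?thesis by (auto simp: jordan_bilinear intro: exI[of _ 0])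
    next
      case 2
      then show ?thesis unfolding v' by (auto simp: jordan_bilinear cu)
    qed
  next
    case False
    then have "u = ((q * q * cv - (p * p * cu + r * r)) / (p * r + p * r)) *\<^sub>R 1"
      using arg_cong[OF e, of "\<lambda>x. (1 / (p * r + p * r)) *\<^sub>R x"] by simp
    then have "u = 0" using traceless_scalar[OF u] by blast
    then show ?thesis by (auto simp: jordan_bilinear intro: exI[of _ 0])
  qed
qed

text \<open>The quadratic equations of u + v and u - v give two expressions for 2 u v, whose
  comparison is a linear relation between u, v and 1. If v occurs in it,
  \<open>traceless_mult_scaled\<close> applies; if only u occurs, u is scalar and hence 0; if
  neither does, the expression for 2 u v is already scalar.\<close>

lemma traceless_mult:
  assumes u: "u \<in> traceless" and v: "v \<in> traceless"
  shows "\<exists>c. u * v = c *\<^sub>R 1"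
proof -
  obtain cu where cu: "u * u = cu *\<^sub>R 1" using u by (auto simp: traceless_iff)
  obtain cv where cv: "v * v = cv *\<^sub>R 1" using v by (auto simp: traceless_iff)
  obtain a b where ab: "(u + v) * (u + v) = a *\<^sub>R (u + v) + b *\<^sub>R 1" using square_in_span by blast
  obtain c d where cd: "(u - v) * (u - v) = c *\<^sub>R (u - v) + d *\<^sub>R 1" using square_in_span by blast
  have comm: "v * u = u * v" by (rule jordan_mult_commute)
  have 1: "u * v + u * v = a *\<^sub>R u + a *\<^sub>R v + (b - cu - cv) *\<^sub>R 1"
    using ab by (simp add: jordan_bilinear cu cv comm algebra_simps)
  have 2: "u * v + u * v = - (c *\<^sub>R u) + c *\<^sub>R v - (d - cu - cv) *\<^sub>R 1"
    using cd by (simp add: jordan_bilinear cu cv comm algebra_simps)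
  have 3: "(c - a) *\<^sub>R v = (a + c) *\<^sub>R u + (b + d - 2 * cu - 2 * cv) *\<^sub>R 1"
    using 1 2 by (simp add: algebra_simps scaleR_double)
  show ?thesis
  proof (cases "c - a = 0")
    case False
    then show ?thesis using traceless_mult_scaled[OF u v 3] by blast
  next
    case True
    show ?thesis
    proof (cases "a = 0")
      case True
      then have "2 *\<^sub>R (u * v) = (b - cu - cv) *\<^sub>R 1"
        using 1 by (simp add: scaleR_2)
      then have "(1/2) *\<^sub>R (2 *\<^sub>R (u * v)) = (1/2) *\<^sub>R ((b - cu - cv) *\<^sub>R 1)" by simp
      then have "u * v = (1/2) *\<^sub>R ((b - cu - cv) *\<^sub>R 1)" by (simp only: scaleR_scaleR) simp
      then show ?thesis by (metis scaleR_scaleR)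
    next
      case False
      then have e: "(2 * a) *\<^sub>R u = (- (b + d - 2 * cu - 2 * cv)) *\<^sub>R 1"
        unfolding scaleR_minus_left eq_neg_iff_add_eq_0 using 3 True by simp
      then have "u = (- (b + d - 2 * cu - 2 * cv) / (2 * a)) *\<^sub>R 1"
      proof -
        have "u = (1 / (2 * a)) *\<^sub>R ((2 * a) *\<^sub>R u)" using False by simp
        then show ?thesis unfolding e by simp
      qed
      then have "u = 0" using traceless_scalar[OF u] by blast
      then show ?thesis by (auto simp: jordan_bilinear intro: exI[of _ 0])
    qed
  qed
qed

lemma traceless_scaleR: "w \<in> traceless \<Longrightarrow> k *\<^sub>R w \<in> traceless"
proof (cases "k = 0")
  case True
  then show ?thesis by (auto simp: traceless_iff jordan_bilinear intro: exI[of _ 0])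
next
  case False
  assume w: "w \<in> traceless"
  have "k *\<^sub>R w = 0" if "k *\<^sub>R w = a *\<^sub>R 1" for a
    using False traceless_scalar[OF w, of "a / k"] arg_cong[OF that, of "\<lambda>x. (1 / k) *\<^sub>R x"] by simp
  moreover obtain c where "w * w = c *\<^sub>R 1" using w by (auto simp: traceless_iff)
  then have "(k *\<^sub>R w) * (k *\<^sub>R w) = (k * k * c) *\<^sub>R 1" by (simp add: jordan_bilinear)
  ultimately show ?thesis unfolding traceless_iff by blast
qed

lemma traceless_add:
  assumes u: "u \<in> traceless" and v: "v \<in> traceless"
  shows "u + v \<in> traceless"
proof -
  obtain cu where cu: "u * u = cu *\<^sub>R 1" using u by (auto simp: traceless_iff)
  obtain cv where cv: "v * v = cv *\<^sub>R 1" using v by (auto simp: traceless_iff)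
  obtain c where c: "u * v = c *\<^sub>R 1" using traceless_mult[OF u v] by blast
  have comm: "v * u = u * v" by (rule jordan_mult_commute)
  have "(u + v) * (u + v) = (cu + cv + (c + c)) *\<^sub>R 1"
    by (simp add: jordan_bilinear cu cv comm c algebra_simps) (simp flip: scaleR_left_distrib)
  moreover have "u + v = 0" if k: "u + v = k *\<^sub>R 1" for k
  proof -
    have v': "v = k *\<^sub>R 1 - u" using k by (simp add: algebra_simps)
    have ku: "k *\<^sub>R u = (c + cu) *\<^sub>R 1"
      using c unfolding v' by (simp add: jordan_bilinear cu algebra_simps)
    have "u = ((c + cu) / k) *\<^sub>R 1" if "k \<noteq> 0"
      using that arg_cong[OF ku, of "\<lambda>x. (1 / k) *\<^sub>R x"] by simp
    then have "k \<noteq> 0 \<Longrightarrow> u = 0" using traceless_scalar[OF u] by blast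
    then have "k \<noteq> 0 \<Longrightarrow> v = 0" using traceless_scalar[OF v, of k] k by simp
    then show ?thesis using k \<open>k \<noteq> 0 \<Longrightarrow> u = 0\<close> by (cases "k = 0") auto
  qed
  ultimately show ?thesis by (auto simp: traceless_iff)
qed

lemma traceless_unique:
  assumes "s *\<^sub>R 1 + u = t *\<^sub>R 1 + w" "u \<in> traceless" "w \<in> traceless"
  shows "s = t" "u = w"
proof -
  have "u + (-1) *\<^sub>R w = (t - s) *\<^sub>R 1" using assms(1) by (simp add: algebra_simps)
  then have "u + (-1) *\<^sub>R w = 0"
    using traceless_scalar traceless_add traceless_scaleR assms by blast
  then show "u = w" by simp
  then show "s = t" using assms(1) jordan_one_neq_zero[where 'a='a] by simp
qed

text \<open>The scalar part, which is half the Jordan trace (\<open>jtr_eq\<close>).\<close>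

definition jt :: "'a \<Rightarrow> real" where
  "jt x = (THE t. \<exists>w\<in>traceless. x = t *\<^sub>R 1 + w)"

lemma jt_eqI: "x = t *\<^sub>R 1 + w \<Longrightarrow> w \<in> traceless \<Longrightarrow> jt x = t"
  unfolding jt_def by (rule the_equality) (use traceless_unique in blast)+

lemma jt_decomp:
  obtains w where "w \<in> traceless" "x = jt x *\<^sub>R 1 + w"
  using traceless_decomp[of x] jt_eqI by metis

lemma zero_traceless: "0 \<in> traceless"
  using traceless_scaleR[of _ 0] traceless_decomp by fastforce

lemma linear_jt: "linear jt"
proof (rule linearI)
  fix x y and r :: real
  obtain u where u: "u \<in> traceless" "x = jt x *\<^sub>R 1 + u" using jt_decomp .
  obtain v where v: "v \<in> traceless" "y = jt y *\<^sub>R 1 + v" using jt_decomp .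
  show "jt (x + y) = jt x + jt y"
  proof (rule jt_eqI)
    show "u + v \<in> traceless" using u v traceless_add by blast
    have "x + y = (jt x *\<^sub>R 1 + u) + (jt y *\<^sub>R 1 + v)" using u(2) v(2) by metis
    then show "x + y = (jt x + jt y) *\<^sub>R 1 + (u + v)" by (simp add: scaleR_add_left)
  qed
  show "jt (r *\<^sub>R x) = r *\<^sub>R jt x"
  proof (rule jt_eqI)
    show "r *\<^sub>R u \<in> traceless" using u traceless_scaleR by blast
    have "r *\<^sub>R x = r *\<^sub>R (jt x *\<^sub>R 1 + u)" using u(2) by metis
    then show "r *\<^sub>R x = (r *\<^sub>R jt x) *\<^sub>R 1 + r *\<^sub>R u" by (simp add: scaleR_add_right)
  qed
qed

lemmas jt_linear_simps = linear_add[OF linear_jt] linear_diff[OF linear_jt] linear_scale[OF linear_jt]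
  linear_neg[OF linear_jt] linear_0[OF linear_jt]

lemma jt_one: "jt 1 = 1"
  by (rule jt_eqI[of _ _ 0]) (auto simp: zero_traceless)

lemma traceless_iff_jt: "w \<in> traceless \<longleftrightarrow> jt w = 0"
proof
  assume "w \<in> traceless"
  then show "jt w = 0" by (intro jt_eqI[of _ _ w]) auto
next
  assume "jt w = 0"
  then show "w \<in> traceless" by (metis jt_decomp scaleR_zero_left add_0)
qed

lemma traceless_mult_jt:
  assumes "jt u = 0" "jt v = 0"
  shows "u * v = jt (u * v) *\<^sub>R 1"
proof -
  obtain c where c: "u * v = c *\<^sub>R 1" using traceless_mult assms traceless_iff_jt by blast
  then have "jt (u * v) = c" by (simp add: jt_linear_simps jt_one)
  then show ?thesis using c by simp
qed

text \<open>The Cayley-Hamilton equation in rank two, from which trace and determinant are read off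
  below.\<close>

lemma square_eq: "x * x = (2 * jt x) *\<^sub>R x - (2 * (jt x)\<^sup>2 - jt (x * x)) *\<^sub>R 1"
proof -
  obtain w where w: "w \<in> traceless" "x = jt x *\<^sub>R 1 + w" using jt_decomp .
  define t where "t = jt x"
  have x: "x = t *\<^sub>R 1 + w" using w t_def by simp
  have w0: "jt w = 0" using w traceless_iff_jt by blast
  have ww: "w * w = jt (w * w) *\<^sub>R 1" by (rule traceless_mult_jt[OF w0 w0])
  have xx: "x * x = t\<^sup>2 *\<^sub>R 1 + (t + t) *\<^sub>R w + w * w"
    unfolding x by (simp add: jordan_bilinear algebra_simps power2_eq_square scaleR_double)
  have "jt (x * x) = t\<^sup>2 + jt (w * w)"
    unfolding xx by (simp add: jt_linear_simps jt_one w0)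
  then show ?thesis
    unfolding t_def[symmetric] xx mult_2 by (subst ww) (simp add: x algebra_simps power2_eq_square scaleR_double scaleR_double[of "t * t", unfolded mult.assoc])
qed

text \<open>Positive definiteness of the trace form. For x = t + w with w traceless the value is t^2
  plus the scalar w w, which formal reality makes nonnegative, and positive unless w = 0.\<close>

lemma jt_square_pos: "x \<noteq> 0 \<Longrightarrow> jt (x * x) > 0"
proof -
  assume "x \<noteq> 0"
  obtain w where w: "w \<in> traceless" "x = jt x *\<^sub>R 1 + w" using jt_decomp .
  define t where "t = jt x"
  have x: "x = t *\<^sub>R 1 + w" using w t_def by simp
  have w0: "jt w = 0" using w traceless_iff_jt by blast
  have ww: "w * w = jt (w * w) *\<^sub>R 1" by (rule traceless_mult_jt[OF w0 w0])
  have xx: "x * x = t\<^sup>2 *\<^sub>R 1 + (t + t) *\<^sub>R w + w * w"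
    unfolding x by (simp add: jordan_bilinear algebra_simps power2_eq_square scaleR_double)
  have eq: "jt (x * x) = t\<^sup>2 + jt (w * w)"
    unfolding xx by (simp add: jt_linear_simps jt_one w0)
  have ge: "jt (w * w) \<ge> 0" using ww by (rule square_neg)
  have "w = 0" if "jt (w * w) = 0" using ww that by (metis scaleR_zero_left square_zero)
  then show ?thesis using eq ge \<open>x \<noteq> 0\<close> x
    by (metis add_pos_nonneg add_nonneg_pos add_0 scaleR_zero_left zero_le_power2 zero_less_power2 order_le_less)
qed

lemma regular_iff: "degree (jminpoly (x::'a)) = 2 \<longleftrightarrow> x \<notin> range (\<lambda>a. a *\<^sub>R 1)"
proof
  assume d: "degree (jminpoly x) = 2"
  show "x \<notin> range (\<lambda>a. a *\<^sub>R 1)"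
  proof
    assume "x \<in> range (\<lambda>a. a *\<^sub>R 1)"
    then obtain a where "x = a *\<^sub>R 1" by blast
    then have "jpoly [:- a, 1:] x = 0"
      by (subst jpoly_degree_le_2) (simp_all add: numeral_2_eq_2 del: power_Suc)
    then show False using jminpoly_minimal[of "[:- a, 1:]" x] d by simp
  qed
next
  assume x: "x \<notin> range (\<lambda>a. a *\<^sub>R 1)"
  show "degree (jminpoly x) = 2"
  proof (rule ccontr)
    assume "degree (jminpoly x) \<noteq> 2"
    then have "degree (jminpoly x) \<le> 1" using degree_jminpoly_le[of x] by linarith
    then have "jpoly (jminpoly x) x = coeff (jminpoly x) 0 *\<^sub>R 1 + coeff (jminpoly x) 1 *\<^sub>R x"
      by (subst jpoly_degree_le_2) (auto simp: coeff_eq_0)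
    then have eq: "coeff (jminpoly x) 0 *\<^sub>R 1 + coeff (jminpoly x) 1 *\<^sub>R x = 0"
      by (simp add: jpoly_jminpoly)
    show False
    proof (cases "coeff (jminpoly x) 1 = 0")
      case True
      then have "degree (jminpoly x) = 0"
        using \<open>degree (jminpoly x) \<le> 1\<close> lead_coeff_jminpoly[of x]
        by (metis One_nat_def le_0_eq le_SucE zero_neq_one)
      then show False using eq True lead_coeff_jminpoly[of x] jordan_one_neq_zero[where 'a='a] by simp
    next
      case False
      then have "x = (- coeff (jminpoly x) 0 / coeff (jminpoly x) 1) *\<^sub>R 1"
        using arg_cong[OF eq, of "\<lambda>y. (1 / coeff (jminpoly x) 1) *\<^sub>R y"]
        by (simp add: scaleR_add_right eq_neg_iff_add_eq_0 add.commute)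
      then show False using x by blast
    qed
  qed
qed

lemma jminpoly_eq:
  assumes "x \<notin> range (\<lambda>a. a *\<^sub>R 1)"
  shows "jminpoly x = [:2 * (jt x)\<^sup>2 - jt (x * x), - 2 * jt x, 1:]"
proof (rule jminpolyI)
  show "jpoly [:2 * (jt x)\<^sup>2 - jt (x * x), - 2 * jt x, 1:] x = 0"
  proof -
    define k where "k = jt (x * x)"
    have "x * x = (2 * jt x) *\<^sub>R x - (2 * (jt x)\<^sup>2 - k) *\<^sub>R 1" unfolding k_def by (rule square_eq)
    then show ?thesis unfolding k_def[symmetric]
      by (subst jpoly_degree_le_2) (simp_all add: numeral_2_eq_2 del: power_Suc)
  qed
  fix q assume "q \<noteq> 0" "jpoly q x = 0"
  then show "degree [:2 * (jt x)\<^sup>2 - jt (x * x), - 2 * jt x, 1:] \<le> degree q"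
    using jminpoly_minimal[of q x] regular_iff[of x] assms by simp
qed simp

lemma exists_nonzero_traceless: "\<exists>w. w \<noteq> 0 \<and> jt w = 0"
proof -
  obtain x :: 'a where "degree (jminpoly x) = 2" using exists_regular by blast
  then have x: "x \<notin> range (\<lambda>a. a *\<^sub>R 1)" by (simp add: regular_iff)
  have "x - jt x *\<^sub>R 1 \<noteq> 0" using x by auto
  then show ?thesis by (intro exI[of _ "x - jt x *\<^sub>R 1"]) (simp add: jt_linear_simps jt_one)
qed

text \<open>Regular elements are dense: the others are scalars, and adding small multiples of a
  nonzero traceless element makes them regular. This is what gives the descriptions of
  \<open>jtr\<close> and \<open>jdet\<close> a unique solution.\<close>

lemma real_polynomial_function_unique:
  assumes p: "real_polynomial_function p" and q: "real_polynomial_function q"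
    and eq: "\<And>x::'a. degree (jminpoly x) = 2 \<Longrightarrow> p x = q x"
  shows "p = q"
proof
  fix x :: 'a
  show "p x = q x"
  proof (cases "degree (jminpoly x) = 2")
    case False
    then obtain a where a: "x = a *\<^sub>R 1" by (auto simp: regular_iff)
    obtain w where w: "w \<noteq> 0" "jt w = 0" using exists_nonzero_traceless by blast
    define X where "X n = x + (1 / real (Suc n)) *\<^sub>R w" for n
    have "X n \<notin> range (\<lambda>a. a *\<^sub>R 1)" for n
    proof
      assume "X n \<in> range (\<lambda>a. a *\<^sub>R 1)"
      then obtain b where "X n = b *\<^sub>R 1" by blast
      then have "(1 / real (Suc n)) *\<^sub>R w = (b - a) *\<^sub>R 1" by (simp add: X_def a algebra_simps)
      then have "(1 / real (Suc n)) *\<^sub>R w = 0"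
        using traceless_scalar traceless_scaleR w(2) traceless_iff_jt by blast
      then show False using w(1) by simp
    qed
    then have pq: "p (X n) = q (X n)" for n by (intro eq) (simp add: regular_iff)
    have "X \<longlonglongrightarrow> x + 0 *\<^sub>R w" unfolding X_def
      by (intro tendsto_intros LIMSEQ_Suc lim_1_over_n)
    then have X: "X \<longlonglongrightarrow> x" by simp
    have "(\<lambda>n. p (X n)) \<longlonglongrightarrow> p x" "(\<lambda>n. q (X n)) \<longlonglongrightarrow> q x"
      using continuous_real_polymonial_function[OF p, of x] continuous_real_polymonial_function[OF q, of x]
      by (auto intro!: isCont_tendsto_compose[OF _ X])
    then show ?thesis unfolding pq by (rule LIMSEQ_unique)
  qed (rule eq)
qed

lemma real_polynomial_function_jt: "real_polynomial_function jt"
  using linear_jt linear_conv_bounded_linear by blast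

lemma real_polynomial_function_jt_square: "real_polynomial_function (\<lambda>x. jt (x * x))"
proof -
  have "jt (x * x) = (\<Sum>b\<in>Basis. \<Sum>b'\<in>Basis. (x \<bullet> b) * (x \<bullet> b') * jt (b * b'))" for x
  proof -
    have l1: "linear (\<lambda>y. jt (x * y))" for x :: 'a
      by (rule linearI) (simp_all add: jordan_bilinear jt_linear_simps)
    have l2: "linear (\<lambda>x. jt (x * y))" for y :: 'a
      by (rule linearI) (simp_all add: jordan_bilinear jt_linear_simps)
    have "jt (x * x) = jt (x * (\<Sum>b'\<in>Basis. (x \<bullet> b') *\<^sub>R b'))" by (simp add: euclidean_representation)
    also have "\<dots> = (\<Sum>b'\<in>Basis. (x \<bullet> b') * jt (x * b'))"
      by (simp add: linear_sum[OF l1] linear_scale[OF l1])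
    also have "\<dots> = (\<Sum>b'\<in>Basis. (x \<bullet> b') * (\<Sum>b\<in>Basis. (x \<bullet> b) * jt (b * b')))"
    proof (intro sum.cong refl)
      fix b' :: 'a
      have "jt (x * b') = jt ((\<Sum>b\<in>Basis. (x \<bullet> b) *\<^sub>R b) * b')" by (simp add: euclidean_representation)
      also have "\<dots> = (\<Sum>b\<in>Basis. (x \<bullet> b) * jt (b * b'))"
        by (simp add: linear_sum[OF l2] linear_scale[OF l2])
      finally show "(x \<bullet> b') * jt (x * b') = (x \<bullet> b') * (\<Sum>b\<in>Basis. (x \<bullet> b) * jt (b * b'))" by simp
    qed
    finally show ?thesis by (subst sum.swap) (simp add: sum_distrib_left mult_ac)
  qed
  moreover have "real_polynomial_function (\<lambda>x::'a. \<Sum>b\<in>Basis. \<Sum>b'\<in>Basis. (x \<bullet> b) * (x \<bullet> b') * jt (b * b'))"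
    by (intro real_polynomial_function_sum real_polynomial_function.intros(4) real_polynomial_function.intros(2)
        real_polynomial_function.intros(1) bounded_linear_inner_left finite_Basis)
  ultimately show ?thesis by simp
qed

lemma jtr_eq: "jtr = (\<lambda>x::'a. 2 * jt x)"
  unfolding jtr_def rank
proof (rule the_equality)
  have *: "2 * jt x = - coeff (jminpoly x) (2 - 1)" if "degree (jminpoly x) = 2" for x
    using that by (simp add: regular_iff jminpoly_eq)
  have pol: "real_polynomial_function (\<lambda>x. 2 * jt x)"
    by (intro real_polynomial_function.intros(4) real_polynomial_function.intros(2) real_polynomial_function_jt)
  then show "real_polynomial_function (\<lambda>x. 2 * jt x) \<and> (\<forall>x. degree (jminpoly x) = 2 \<longrightarrow> 2 * jt x = - coeff (jminpoly x) (2 - 1))"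
    using * by blast
  fix p :: "'a \<Rightarrow> real"
  assume "real_polynomial_function p \<and> (\<forall>x. degree (jminpoly x) = 2 \<longrightarrow> p x = - coeff (jminpoly x) (2 - 1))"
  then show "p = (\<lambda>x. 2 * jt x)" using pol * by (intro real_polynomial_function_unique) auto
qed

lemma jdet_eq: "jdet = (\<lambda>x::'a. 2 * (jt x)\<^sup>2 - jt (x * x))"
  unfolding jdet_def rank
proof (rule the_equality)
  have *: "2 * (jt x)\<^sup>2 - jt (x * x) = (- 1) ^ 2 * coeff (jminpoly x) 0" if "degree (jminpoly x) = 2" for x
    using that by (simp add: regular_iff jminpoly_eq)
  have pol: "real_polynomial_function (\<lambda>x. 2 * (jt x)\<^sup>2 - jt (x * x))"
    using real_polynomial_function_jt real_polynomial_function_jt_square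
    by (intro real_polynomial_function_diff real_polynomial_function.intros(4) real_polynomial_function.intros(2) real_polynomial_function_power)
  then show "real_polynomial_function (\<lambda>x. 2 * (jt x)\<^sup>2 - jt (x * x)) \<and> (\<forall>x. degree (jminpoly x) = 2 \<longrightarrow> 2 * (jt x)\<^sup>2 - jt (x * x) = (- 1) ^ 2 * coeff (jminpoly x) 0)"
    using * by blast
  fix p :: "'a \<Rightarrow> real"
  assume "real_polynomial_function p \<and> (\<forall>x. degree (jminpoly x) = 2 \<longrightarrow> p x = (- 1) ^ 2 * coeff (jminpoly x) 0)"
  then show "p = (\<lambda>x. 2 * (jt x)\<^sup>2 - jt (x * x))" using pol * by (intro real_polynomial_function_unique) auto
qed

lemma jtau_eq: "jtau x y = 2 * jt (x * y)"
  by (simp add: jtau_def jtr_eq)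

text \<open>For an idempotent, \<open>square_eq\<close> becomes a linear relation between c and 1.
  If the coefficient of c is not zero, c is a scalar idempotent, that is 0 or 1.\<close>

lemma jordan_idempotent_cases:
  assumes "jidempotent (c::'a)" "c \<noteq> 0" "c \<noteq> 1"
  shows "jt c = 1 / 2"
proof -
  have c: "c * c = c" using assms by (simp add: jidempotent_def)
  have eq: "(1 - 2 * jt c) *\<^sub>R c = (jt c - 2 * (jt c)\<^sup>2) *\<^sub>R 1"
    using square_eq[of c] unfolding c by (simp add: algebra_simps)
  show ?thesis
  proof (rule ccontr)
    assume "jt c \<noteq> 1 / 2"
    then have "c = ((jt c - 2 * (jt c)\<^sup>2) / (1 - 2 * jt c)) *\<^sub>R 1"
      using arg_cong[OF eq, of "\<lambda>x. (1 / (1 - 2 * jt c)) *\<^sub>R x"] by simp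
    then obtain k where k: "c = k *\<^sub>R 1" by blast
    then have "(k * k) *\<^sub>R (1::'a) = k *\<^sub>R 1" using c by (simp add: jordan_bilinear)
    then have "k * k = k" using jordan_one_neq_zero[where 'a='a] by simp
    then have "k = 0 \<or> k = 1" by simp
    then show False using k assms by auto
  qed
qed

text \<open>The scalar part is additive: two nonzero orthogonal idempotents both differ from 1, so
  each has scalar part 1/2 and their sum has 1.\<close>

lemma jprimitive_half:
  assumes w: "jt w = 0" "w * w = (1/4) *\<^sub>R (1::'a)"
  shows "jprimitive ((1/2) *\<^sub>R 1 + w)"
proof -
  let ?c = "(1/2) *\<^sub>R 1 + w"
  have jc: "jt ?c = 1/2" by (simp add: jt_linear_simps jt_one w)
  have "jidempotent ?c"
    unfolding jidempotent_def
    using w by (simp add: jordan_bilinear algebra_simps) (simp flip: scaleR_add_left add.assoc)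
  moreover have "?c \<noteq> 0" using jc jt_linear_simps by force
  moreover have False if ab: "jidempotent a" "jidempotent b" "a \<noteq> 0" "b \<noteq> 0" "a * b = 0" "?c = a + b" for a b
  proof -
    have "a \<noteq> 1" using ab by (auto simp: jordan_bilinear)
    moreover have "b \<noteq> 1" using ab by (auto simp: jordan_bilinear)
    ultimately have "jt a = 1/2" "jt b = 1/2" using ab jordan_idempotent_cases by auto
    then show False using jc unfolding ab(6) by (simp add: jt_linear_simps)
  qed
  ultimately show ?thesis unfolding jprimitive_def by blast
qed

text \<open>Ensures that the description of \<open>peirce_const\<close> is not vacuous: without a
  frame every number would satisfy it.\<close>

lemma exists_jordan_frame: "\<exists>c :: nat \<Rightarrow> 'a. jordan_frame c"
proof -
  obtain v where v: "v \<noteq> 0" "jt v = 0" using exists_nonzero_traceless by blast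
  define m where "m = jt (v * v)"
  have m: "m > 0" "v * v = m *\<^sub>R 1"
    using jt_square_pos[OF v(1)] traceless_mult_jt[OF v(2) v(2)] by (auto simp: m_def)
  \<comment> \<open>Scaled so that w w = 1/4, which makes 1/2 + w and 1/2 - w idempotent.\<close>
  define w where "w = (1 / (2 * sqrt m)) *\<^sub>R v"
  have w: "jt w = 0" "w * w = (1/4) *\<^sub>R 1"
    using m v(2) by (simp_all add: w_def jt_linear_simps jordan_bilinear)
  have w': "jt (- w) = 0" "(- w) * (- w) = (1/4) *\<^sub>R 1"
    using w by (simp_all add: jt_linear_simps jordan_bilinear)
  define c :: "nat \<Rightarrow> 'a" where "c i = (if i = 1 then (1/2) *\<^sub>R 1 + w else (1/2) *\<^sub>R 1 + (- w))" for i
  have set: "{1..2::nat} = {1,2}" by auto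
  have "jprimitive (c 1)" "jprimitive (c 2)"
    using jprimitive_half[OF w] jprimitive_half[OF w'] by (simp_all add: c_def)
  moreover have "c 1 * c 2 = 0"
    using w by (simp add: c_def jordan_bilinear algebra_simps)
  moreover have "c 2 * c 1 = 0" using calculation jordan_mult_commute by metis
  moreover have "c 1 + c 2 = 1" by (simp add: c_def flip: scaleR_add_left)
  ultimately have "jordan_frame c"
    unfolding jordan_frame_def rank set by auto
  then show ?thesis by blast
qed

text \<open>With the frame written as 1/2 + w and 1/2 - w, the Peirce space consists of the
  traceless elements orthogonal to w for the trace form: two independent linear conditions.\<close>

lemma dim_peirce_space:
  fixes c :: "nat \<Rightarrow> 'a"
  assumes "jordan_frame c"
  shows "dim (peirce_space c 1 2) + 2 = DIM('a)"
proof -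
  have set: "{1..2::nat} = {1,2}" by auto
  have c: "jprimitive (c 1)" "jprimitive (c 2)" "c 1 * c 2 = 0" "c 1 + c 2 = 1"
    using assms unfolding jordan_frame_def rank set by auto
  have c1: "jidempotent (c 1)" "c 1 \<noteq> 0" "c 2 \<noteq> 0" using c by (auto simp: jprimitive_def)
  have "c 1 \<noteq> 1" using c c1 by auto
  then have "jt (c 1) = 1/2" using jordan_idempotent_cases c1 by blast
  define w where "w = c 1 - (1/2) *\<^sub>R 1"
  have w0: "jt w = 0" using \<open>jt (c 1) = 1/2\<close> by (simp add: w_def jt_linear_simps jt_one)
  have cw: "c 1 = (1/2) *\<^sub>R 1 + w" by (simp add: w_def)
  have "(1::'a) = (1/2) *\<^sub>R 1 + (1/2) *\<^sub>R 1" by (simp flip: scaleR_add_left)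
  moreover have "c 2 = 1 - c 1" using c(4) by (simp add: algebra_simps)
  ultimately have cw2: "c 2 = (1/2) *\<^sub>R 1 - w" unfolding cw
    by (metis add_diff_cancel_left)
  have "w \<noteq> 0"
  proof
    assume "w = 0"
    then have "c 1 * c 1 = (1/4) *\<^sub>R 1" "c 1 = (1/2) *\<^sub>R 1" unfolding cw by (simp_all add: jordan_bilinear)
    then have "(1/4) *\<^sub>R (1::'a) = (1/2) *\<^sub>R 1" using c1(1) by (simp add: jidempotent_def)
    then show False using jordan_one_neq_zero[where 'a='a] by simp
  qed
  then have ww: "jt (w * w) > 0" by (rule jt_square_pos)
  \<comment> \<open>Both Peirce conditions say w x = 0. Splitting x into scalar and traceless parts
    makes a multiple of w scalar, so the scalar part of x vanishes.\<close>
  have P: "peirce_space c 1 2 = {x. jt x = 0 \<and> jt (w * x) = 0}"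
  proof (intro set_eqI iffI)
    fix x assume "x \<in> peirce_space c 1 2"
    then have "w * x = 0" unfolding peirce_space_def cw by (simp add: jordan_bilinear)
    obtain u where u: "u \<in> traceless" "x = jt x *\<^sub>R 1 + u" using jt_decomp .
    have "0 = w * (jt x *\<^sub>R 1 + u)" using u(2) \<open>w * x = 0\<close> by simp
    also have "\<dots> = jt x *\<^sub>R w + w * u" by (simp add: jordan_bilinear)
    also have "w * u = jt (w * u) *\<^sub>R 1"
      using traceless_mult_jt w0 u(1) traceless_iff_jt by blast
    finally have "jt x *\<^sub>R w = (- jt (w * u)) *\<^sub>R 1" by (simp add: eq_neg_iff_add_eq_0)
    moreover have "jt x *\<^sub>R w \<in> traceless" using w0 traceless_iff_jt traceless_scaleR by blast
    ultimately have "jt x *\<^sub>R w = 0" using traceless_scalar by blast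
    then have "jt x = 0" using \<open>w \<noteq> 0\<close> by simp
    then show "x \<in> {x. jt x = 0 \<and> jt (w * x) = 0}"
      using \<open>w * x = 0\<close> by (simp add: jt_linear_simps)
  next
    fix x assume "x \<in> {x. jt x = 0 \<and> jt (w * x) = 0}"
    then have "w * x = 0" using traceless_mult_jt[OF w0, of x] by simp
    then show "x \<in> peirce_space c 1 2" unfolding peirce_space_def cw cw2 by (simp add: jordan_bilinear)
  qed
  \<comment> \<open>The vectors representing the two conditions in the inner product of the type, so
    that the codimension can be counted as that of an orthogonal complement.\<close>
  define a where "a = (\<Sum>b\<in>Basis. jt b *\<^sub>R b)"
  define a' where "a' = (\<Sum>b\<in>Basis. jt (w * b) *\<^sub>R b)"
  have lin: "linear (\<lambda>x. jt (w * x))"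
    by (rule linearI) (simp_all add: jordan_bilinear jt_linear_simps)
  have rep: "f x = (\<Sum>b\<in>Basis. f b *\<^sub>R b) \<bullet> x" if f: "linear f" for f :: "'a \<Rightarrow> real" and x
  proof -
    have "f x = f (\<Sum>b\<in>Basis. (x \<bullet> b) *\<^sub>R b)" by (simp add: euclidean_representation)
    also have "\<dots> = (\<Sum>b\<in>Basis. (x \<bullet> b) * f b)" by (simp add: linear_sum[OF f] linear_scale[OF f])
    finally show ?thesis by (simp add: inner_sum_left inner_sum_right inner_commute mult.commute)
  qed
  have a: "jt x = a \<bullet> x" for x unfolding a_def by (rule rep[OF linear_jt])
  have a': "jt (w * x) = a' \<bullet> x" for x unfolding a'_def by (rule rep[OF lin])
  have "a \<noteq> a'" using a[of 1] a'[of 1] w0 jt_one by (auto simp: jordan_bilinear)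
  have "independent {a, a'}"
  proof -
    have "a' \<noteq> 0" using a'[of w] ww by auto
    moreover have "a \<notin> span {a'}"
    proof
      assume "a \<in> span {a'}"
      then obtain k where "a = k *\<^sub>R a'" by (auto simp: span_singleton)
      then have "jt 1 = k * jt (w * 1)" by (simp only: a[of 1] a'[of 1] inner_scaleR_left)
      then show False using w0 jt_one by (simp add: jordan_bilinear)
    qed
    ultimately show ?thesis by (simp add: independent_insert \<open>a \<noteq> a'\<close>)
  qed
  then have "dim (span {a, a'}) = 2" using \<open>a \<noteq> a'\<close> by (simp add: dim_eq_card_independent)
  moreover have "{y \<in> UNIV. \<forall>x\<in>span {a, a'}. orthogonal x y} = peirce_space c 1 2"
  proof -
    have "peirce_space c 1 2 = {x. a \<bullet> x = 0 \<and> a' \<bullet> x = 0}" unfolding P by (simp add: a[symmetric] a'[symmetric])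
    moreover have "orthogonal x y" if "x \<in> span {a, a'}" "a \<bullet> y = 0" "a' \<bullet> y = 0" for x y
      using orthogonal_to_span[OF that(1), of y] that(2,3) by (auto simp: orthogonal_def inner_commute)
    moreover have "a \<in> span {a, a'}" "a' \<in> span {a, a'}" by (simp_all add: span_base)
    ultimately show ?thesis by (auto simp: orthogonal_def)
  qed
  moreover have "dim {y \<in> (UNIV::'a set). \<forall>x\<in>span {a, a'}. orthogonal x y} + dim (span {a, a'}) = dim (UNIV::'a set)"
    by (rule dim_subspace_orthogonal_to_vectors) auto
  ultimately show ?thesis by simp
qed

lemma peirce_const_eq: "peirce_const TYPE('a) + 2 = DIM('a)"
proof -
  obtain c0 :: "nat \<Rightarrow> 'a" where c0: "jordan_frame c0" using exists_jordan_frame by blast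
  have ij: "(1 \<le> i \<and> i < j \<and> j \<le> (2::nat)) \<longleftrightarrow> i = 1 \<and> j = 2" for i j by auto
  have "peirce_const TYPE('a) = DIM('a) - 2"
    unfolding peirce_const_def rank ij
  proof (rule the_equality)
    show "\<forall>c :: nat \<Rightarrow> 'a. jordan_frame c \<longrightarrow> (\<forall>i j. i = 1 \<and> j = 2 \<longrightarrow> dim (peirce_space c i j) = DIM('a) - 2)"
      using dim_peirce_space by fastforce
    fix d assume "\<forall>c :: nat \<Rightarrow> 'a. jordan_frame c \<longrightarrow> (\<forall>i j. i = 1 \<and> j = 2 \<longrightarrow> dim (peirce_space c i j) = d)"
    then show "d = DIM('a) - 2" using dim_peirce_space[OF c0] c0 by auto
  qed
  then show ?thesis using dim_peirce_space[OF c0] by simp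
qed

end

subsection \<open>The functional equation\<close>

text \<open>Gram-Schmidt for \<tau>, started at v. Prescribing the image of e serves to place the
  unit of the algebra on the distinguished axis of \<open>lorentz\<close>.\<close>

lemma exists_orthonormal_isometry:
  fixes \<tau> :: "'a::euclidean_space \<Rightarrow> 'a \<Rightarrow> real" and e v :: 'a
  assumes lin: "\<And>y. linear (\<lambda>x. \<tau> x y)" and sym: "\<And>x y. \<tau> x y = \<tau> y x" and pos: "\<And>x. x \<noteq> 0 \<Longrightarrow> \<tau> x x > 0"
    and v: "\<tau> v v = 1" and e: "e \<in> Basis"
  shows "\<exists>T. linear T \<and> (\<forall>x y. \<tau> (T x) (T y) = x \<bullet> y) \<and> T e = v"
proof -
  have lin2: "linear (\<tau> x)" for x
  proof -
    have "\<tau> x = (\<lambda>y. \<tau> y x)" using sym by auto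
    then show ?thesis using lin by metis
  qed
  define on where "on S \<longleftrightarrow> (\<forall>u\<in>S. \<forall>w\<in>S. \<tau> u w = (if u = w then 1 else 0))" for S
  have "\<exists>S. finite S \<and> v \<in> S \<and> on S \<and> card S = Suc m" if "Suc m \<le> DIM('a)" for m
    using that
  proof (induction m)
    case 0
    show ?case by (rule exI[of _ "{v}"]) (simp add: on_def v)
  next
    case (Suc m)
    then obtain S where S: "finite S" "v \<in> S" "on S" "card S = Suc m" by auto
    have "dim (span S) < DIM('a)" using dim_le_card[of S S] S Suc.prems by (simp add: span_superset)
    then have "span S \<noteq> UNIV" by (metis dim_UNIV less_irrefl)
    then obtain x where x: "x \<notin> span S" by blast
    define y where "y = x - (\<Sum>u\<in>S. \<tau> x u *\<^sub>R u)"
    have "y \<noteq> 0"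
    proof
      assume "y = 0"
      then have "x = (\<Sum>u\<in>S. \<tau> x u *\<^sub>R u)" by (simp add: y_def)
      also have "\<dots> \<in> span S" by (intro span_sum span_scale span_base)
      finally show False using x by simp
    qed
    then have py: "\<tau> y y > 0" by (rule pos)
    have yw: "\<tau> y w = 0" if w: "w \<in> S" for w
    proof -
      have "\<tau> y w = \<tau> x w - (\<Sum>u\<in>S. \<tau> x u * \<tau> u w)"
        unfolding y_def by (simp add: linear_diff[OF lin] linear_sum[OF lin] linear_scale[OF lin])
      also have "(\<Sum>u\<in>S. \<tau> x u * \<tau> u w) = (\<Sum>u\<in>S. if u = w then \<tau> x u else 0)"
        by (intro sum.cong) (use S w in \<open>auto simp: on_def\<close>)
      also have "\<dots> = \<tau> x w" using S w by simp
      finally show ?thesis by simp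
    qed
    define z where "z = (1 / sqrt (\<tau> y y)) *\<^sub>R y"
    have zw: "\<tau> z w = 0" "\<tau> w z = 0" if "w \<in> S" for w
      using yw[OF that] sym by (simp_all add: z_def linear_scale[OF lin] linear_scale[OF lin2])
    have zz: "\<tau> z z = 1"
      using py by (simp add: z_def linear_scale[OF lin] linear_scale[OF lin2])
    have "z \<notin> S" using zw zz by fastforce
    have "on (insert z S)" using S(3) zw zz unfolding on_def by auto
    then show ?case using S \<open>z \<notin> S\<close> by (intro exI[of _ "insert z S"]) auto
  qed
  from this[of "DIM('a) - 1"] obtain S where S: "finite S" "v \<in> S" "on S" "card S = DIM('a)"
    by (auto simp: Suc_le_eq)
  have "card (Basis - {e}) = card (S - {v})" using S e by (simp add: card_Diff_singleton)
  then obtain q where q: "bij_betw q (Basis - {e}) (S - {v})"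
    using S(1) by (metis finite_Basis finite_Diff finite_same_card_bij)
  define p where "p b = (if b = e then v else q b)" for b
  have pS: "p b \<in> S" if "b \<in> Basis" for b
    using that S(2) bij_betw_apply[OF q, of b] by (auto simp: p_def)
  have pi: "p b = p b' \<longleftrightarrow> b = b'" if "b \<in> Basis" "b' \<in> Basis" for b b'
    using that bij_betw_apply[OF q, of b] bij_betw_apply[OF q, of b'] bij_betw_imp_inj_on[OF q]
    by (auto simp: p_def inj_on_def)
  define T where "T x = (\<Sum>b\<in>Basis. (x \<bullet> b) *\<^sub>R p b)" for x
  have "linear T"
    by (rule linearI) (simp_all add: T_def inner_add_left scaleR_add_left sum.distrib scaleR_sum_right)
  moreover have "\<tau> (T x) (T y) = x \<bullet> y" for x y
  proof -
    have "\<tau> (T x) (T y) = (\<Sum>b\<in>Basis. (x \<bullet> b) * (\<Sum>b'\<in>Basis. (y \<bullet> b') * \<tau> (p b) (p b')))"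
    proof -
      have t1: "\<tau> (T x) z = (\<Sum>b\<in>Basis. (x \<bullet> b) * \<tau> (p b) z)" for z
        unfolding T_def by (simp add: linear_sum[OF lin] linear_scale[OF lin])
      have t2: "\<tau> z (T y) = (\<Sum>b\<in>Basis. (y \<bullet> b) * \<tau> z (p b))" for z
        unfolding T_def by (simp add: linear_sum[OF lin2] linear_scale[OF lin2])
      show ?thesis by (simp only: t1) (simp only: t2)
    qed
    also have "\<dots> = (\<Sum>b\<in>Basis. (x \<bullet> b) * (\<Sum>b'\<in>Basis. if b' = b then y \<bullet> b' else 0))"
      by (intro sum.cong arg_cong2[where f = "(*)"] refl) (use S(3) pS pi in \<open>auto simp: on_def\<close>)
    also have "\<dots> = x \<bullet> y" by (simp add: euclidean_inner[of x y])
    finally show ?thesis .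
  qed
  moreover have "T e = v"
  proof -
    have "T e = (\<Sum>b\<in>Basis. if b = e then p b else 0)"
      unfolding T_def by (intro sum.cong) (use e in \<open>auto simp: inner_Basis\<close>)
    then show ?thesis using e by (simp add: p_def)
  qed
  ultimately show ?thesis by blast
qed

text \<open>Two isometries differ by an orthogonal map, which preserves Lebesgue measure. The
  arbitrary choice in \<open>jlebesgue\<close> may thus be replaced by an isometry adapted to the
  unit.\<close>

lemma lborel_distr_isometry_unique:
  fixes T0 T :: "'a::euclidean_space \<Rightarrow> 'a" and \<tau> :: "'a \<Rightarrow> 'a \<Rightarrow> real"
  assumes T0: "linear T0" "\<And>x y. \<tau> (T0 x) (T0 y) = x \<bullet> y" and T: "linear T" "\<And>x y. \<tau> (T x) (T y) = x \<bullet> y"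
    and pos: "\<tau> 0 0 = 0"
  shows "distr lborel borel T0 = distr lborel borel T"
proof -
  have inj: "inj T"
  proof (rule linear_injective_0[OF T(1), THEN iffD2], intro allI impI)
    fix x assume "T x = 0"
    then have "x \<bullet> x = 0" using T(2)[of x x] pos by simp
    then show "x = 0" by simp
  qed
  then obtain S where S: "linear S" "\<And>x. S (T x) = x" "\<And>x. T (S x) = x"
    using linear_injective_isomorphism[OF T(1)] by blast
  have U: "orthogonal_transformation (S \<circ> T0)"
    unfolding orthogonal_transformation_def
    using linear_compose[OF T0(1) S(1)] T0(2) T(2)[of "S (T0 _)" "S (T0 _)"] S(3) by simp
  have m: "T \<in> borel_measurable borel" "S \<circ> T0 \<in> borel_measurable borel"
    using T(1) linear_compose[OF T0(1) S(1)] by (auto intro: linear_borel_measurable)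
  have "distr lborel borel T0 = distr lborel borel (T \<circ> (S \<circ> T0))" using S(3) by (simp add: o_def)
  also have "\<dots> = distr (distr lborel borel (S \<circ> T0)) borel T"
    by (rule distr_distr[symmetric]) (use m in auto)
  also have "\<dots> = distr lborel borel T" unfolding lborel_distr_orthogonal[OF U] ..
  finally show ?thesis .
qed

primrec parity_fun :: "parity \<Rightarrow> real \<Rightarrow> complex" where
  "parity_fun Plus = parity_one"
| "parity_fun Minus = parity_sgn"

lemma jdet_powr_eq: "jdet_powr \<epsilon> s x = parity_fun \<epsilon> (jdet x) * of_real \<bar>jdet x\<bar> powr s"
  by (cases \<epsilon>) (simp_all add: parity_one_def parity_sgn_def)

lemma parity_fun_measurable [measurable]: "parity_fun \<epsilon> \<in> borel_measurable borel"
  by (cases \<epsilon>) (simp_all add: parity_measurable)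

section \<open>Transport of measure, determinant and Fourier transform to Euclidean
  coordinates\<close>

context rank_two
begin

lemma linear_jt_mult: "linear (\<lambda>x. jt (x * y))"
  by (rule linearI) (simp_all add: jordan_bilinear jt_linear_simps)

lemma jdet_conv_jtau: "jdet (x::'a) = (jtau x 1)\<^sup>2 / 2 - jtau x x / 2"
  by (simp add: jdet_eq jtau_eq jordan_unit_right power_mult_distrib)

lemma exists_jtau_isometry:
  assumes "e \<in> Basis"
  shows "\<exists>T::'a \<Rightarrow> 'a. linear T \<and> (\<forall>x y. jtau (T x) (T y) = x \<bullet> y) \<and> T e = (1 / sqrt 2) *\<^sub>R 1"
proof (rule exists_orthonormal_isometry[OF _ _ _ _ assms])
  show "linear (\<lambda>x::'a. jtau x y)" for y
    unfolding jtau_eq using linear_compose_scale_right[OF linear_jt_mult, of 2 y] by simp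
  show "jtau x y = jtau y (x::'a)" for x y by (simp add: jtau_def jordan_mult_commute)
  show "jtau x x > 0" if "x \<noteq> 0" for x :: 'a using jt_square_pos[OF that] by (simp add: jtau_eq)
  show "jtau ((1 / sqrt 2) *\<^sub>R 1) ((1 / sqrt 2) *\<^sub>R (1::'a)) = 1"
    by (simp add: jtau_eq jordan_bilinear jt_linear_simps jt_one)
qed

lemma jlebesgue_eq:
  fixes T :: "'a \<Rightarrow> 'a"
  assumes T: "linear T" "\<And>x y. jtau (T x) (T y) = x \<bullet> y"
  shows "jlebesgue = distr lborel borel T"
proof -
  define T0 where "T0 = (SOME T::'a \<Rightarrow> 'a. linear T \<and> (\<forall>x y. jtau (T x) (T y) = x \<bullet> y))"
  have "linear T0 \<and> (\<forall>x y. jtau (T0 x) (T0 y) = x \<bullet> y)"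
    unfolding T0_def by (rule someI[of _ T]) (use T in blast)
  then have "distr lborel borel T0 = distr lborel borel T"
    using T by (intro lborel_distr_isometry_unique[where \<tau> = jtau]) (auto simp: jtau_eq jordan_bilinear jt_linear_simps)
  then show ?thesis unfolding jlebesgue_def T0_def .
qed

text \<open>The determinant involves only the trace form and the trace, which is pairing with the
  unit; as the unit is sqrt 2 times T e, the trace of T x is sqrt 2 times the e-coordinate of
  x.\<close>

lemma jdet_isometry:
  fixes T :: "'a \<Rightarrow> 'a"
  assumes T: "\<And>x y. jtau (T x) (T y :: 'a) = x \<bullet> y" and Te: "T e = (1 / sqrt 2) *\<^sub>R 1" and e: "e \<in> Basis"
  shows "jdet (T x) = lorentz e x"
proof -
  have one: "1 = sqrt 2 *\<^sub>R T e" using Te by simp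
  have "jtau (T x) 1 = sqrt 2 * jtau (T x) (T e)"
    by (subst one) (simp add: jtau_eq jordan_scaleR_right jt_linear_simps)
  then show ?thesis
    unfolding jdet_conv_jtau lorentz_altdef[OF e] T by (simp add: power_mult_distrib power2_norm_eq_inner)
qed

lemma jdet_measurable: "jdet \<in> borel_measurable (borel :: 'a measure)"
proof -
  have "real_polynomial_function (jdet :: 'a \<Rightarrow> real)"
    unfolding jdet_eq using real_polynomial_function_jt real_polynomial_function_jt_square
    by (intro real_polynomial_function_diff real_polynomial_function.intros(4) real_polynomial_function.intros(2) real_polynomial_function_power)
  then show ?thesis
    by (intro borel_measurable_continuous_onI continuous_at_imp_continuous_on ballI continuous_real_polymonial_function)
qed

lemma jfourier_isometry:
  fixes T :: "'a \<Rightarrow> 'a"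
  assumes T: "linear T" "\<And>x y. jtau (T x) (T y :: 'a) = x \<bullet> y" and f: "f \<in> borel_measurable borel"
  shows "jfourier f (T x) = fourier (\<lambda>y. f (T y)) x"
proof -
  have Tm: "T \<in> measurable lborel borel"
    using T(1) by (simp add: linear_borel_measurable)
  have "linear (\<lambda>y. jtau (T x) y)"
    unfolding jtau_def jordan_mult_commute[of "T x"] jtr_eq using linear_compose_scale_right[OF linear_jt_mult, of 2 "T x"] by simp
  then have [measurable]: "(\<lambda>y. jtau (T x) y) \<in> borel_measurable borel"
    by (simp add: linear_borel_measurable)
  have [measurable]: "f \<in> borel_measurable borel" by fact
  have "jfourier f (T x) = (\<integral>y. exp (2 * \<i> * of_real pi * of_real (jtau (T x) (T y))) * f (T y) \<partial>lborel)"
    unfolding jfourier_def jlebesgue_eq[OF T] by (rule integral_distr[OF Tm]) measurable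
  then show ?thesis unfolding fourier_def T .
qed

lemma jzeta_integral_isometry:
  fixes T :: "'a \<Rightarrow> 'a"
  assumes T: "linear T" "\<And>x y. jtau (T x) (T y :: 'a) = x \<bullet> y" and Te: "T e = (1 / sqrt 2) *\<^sub>R 1" and e: "e \<in> Basis"
    and f: "f \<in> borel_measurable borel"
  shows "(LINT x|jlebesgue. f x * jdet_powr \<epsilon> s x) = lorentz_zeta e (parity_fun \<epsilon>) (\<lambda>y. f (T y)) s"
proof -
  have Tm: "T \<in> measurable lborel borel"
    using T(1) by (simp add: linear_borel_measurable)
  have [measurable]: "f \<in> borel_measurable borel" "jdet \<in> borel_measurable (borel :: 'a measure)"
    using f jdet_measurable by auto
  have "(LINT x|jlebesgue. f x * jdet_powr \<epsilon> s x) = (\<integral>y. f (T y) * jdet_powr \<epsilon> s (T y) \<partial>lborel)"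
    unfolding jlebesgue_eq[OF T] jdet_powr_eq by (rule integral_distr[OF Tm]) measurable
  then show ?thesis unfolding lorentz_zeta_def jdet_powr_eq jdet_isometry[OF T(2) Te e] .
qed

end

text \<open>The identity theorem together with the normalization at singularities: agreement on the
  half-plane forces agreement everywhere.\<close>

lemma jzeta_eqI:
  assumes Z: "Z nicely_meromorphic_on UNIV" and eq: "\<And>s. Re s > 0 \<Longrightarrow> Z s = (LINT x|jlebesgue. f x * jdet_powr \<epsilon> s x)"
  shows "jzeta \<epsilon> f = Z"
  unfolding jzeta_def
proof (rule the_equality)
  show "Z nicely_meromorphic_on UNIV \<and> (\<forall>s. 0 < Re s \<longrightarrow> Z s = (LINT x|jlebesgue. f x * jdet_powr \<epsilon> s x))"
    using Z eq by blast
  fix Y assume Y: "Y nicely_meromorphic_on UNIV \<and> (\<forall>s. 0 < Re s \<longrightarrow> Y s = (LINT x|jlebesgue. f x * jdet_powr \<epsilon> s x))"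
  have "\<forall>\<^sub>\<approx>s. Y s = Z s"
  proof (rule meromorphic_identity[where U = "{s. Re s > 0}"])
    show "\<forall>\<^sub>\<approx>s. s \<in> {s. 0 < Re s} \<longrightarrow> Y s = Z s" using Y eq by (intro always_eventually) auto
    show "1 \<in> {s. 0 < Re s}" by simp
  qed (use Y Z in \<open>auto simp: nicely_meromorphic_on_def open_halfspace_Re_gt\<close>)
  then show "Y = Z" by (rule nicely_meromorphic_identity[rotated 2]) (use Y Z in auto)
qed

lemma fe_factor_meromorphic: "fe_factor n meromorphic_on UNIV"
  unfolding fe_factor_def
  by (intro meromorphic_on_mult meromorphic_Gamma_compose)
     (auto intro!: analytic_on_imp_meromorphic_on analytic_intros simp: complex_nonpos_Reals_iff pi_not_le_zero)

text \<open>The two interpretations of \<open>dual_pair\<close> continue the zeta functions of both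
  g and its transform. The identity holds for Re s < - n / 2 by \<open>ext_left\<close>, and the
  identity theorem extends it to the plane.\<close>

lemma functional_equation:
  fixes e :: "'a::euclidean_space" and g :: "'a \<Rightarrow> complex"
  assumes e: "e \<in> Basis" and g: "schwartz g" and dim: "DIM('a) \<ge> 3"
    and \<theta>: "\<theta> = of_real (pi * (real DIM('a) - 2) / 4)"
    and \<beta>: "\<beta> = (\<lambda>s. of_real pi / 2 * (s + of_nat DIM('a) / 2))"
  obtains Wp Wm Vp Vm where
    "Wp nicely_meromorphic_on UNIV" "Wm nicely_meromorphic_on UNIV" "Vp nicely_meromorphic_on UNIV" "Vm nicely_meromorphic_on UNIV"
    "\<And>s. Re s > 0 \<Longrightarrow> Wp s = lorentz_zeta e parity_one (fourier g) s"
    "\<And>s. Re s > 0 \<Longrightarrow> Wm s = lorentz_zeta e parity_sgn (fourier g) s"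
    "\<And>s. Re s > 0 \<Longrightarrow> Vp s = lorentz_zeta e parity_one g s"
    "\<And>s. Re s > 0 \<Longrightarrow> Vm s = lorentz_zeta e parity_sgn g s"
    "\<forall>\<^sub>\<approx>s. Wp s = fe_factor DIM('a) s * sin (of_real pi * s / 2) *
      (cos \<theta> * cos (\<beta> s) * Vp (- s - of_nat DIM('a) / 2) - sin \<theta> * sin (\<beta> s) * Vm (- s - of_nat DIM('a) / 2))"
    "\<forall>\<^sub>\<approx>s. Wm s = fe_factor DIM('a) s * cos (of_real pi * s / 2) *
      (sin \<theta> * cos (\<beta> s) * Vp (- s - of_nat DIM('a) / 2) + cos \<theta> * sin (\<beta> s) * Vm (- s - of_nat DIM('a) / 2))"
proof -
  have rg: "rapidly_decaying g" and rf: "rapidly_decaying (fourier g)"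
    using g by (auto intro: schwartz_rapidly_decaying rapidly_decaying_fourier)
  have dual: "theta_dual e (fourier g) g"
    unfolding theta_dual_def
    using theta_fourier[OF e integrable_rapidly_decaying[OF rg] integrable_rapidly_decaying[OF rf]] by blast
  interpret W: dual_pair e "fourier g" g
    using e rg rf dual dim by unfold_locales
  interpret V: dual_pair e g "fourier g"
    using e rg rf theta_dual_sym[OF dual] dim by unfold_locales
  let ?n = "DIM('a)"
  have comp: "(\<lambda>s. f (- s - of_nat ?n / 2)) meromorphic_on UNIV" if "f nicely_meromorphic_on UNIV" for f :: "complex \<Rightarrow> complex"
  proof (rule meromorphic_on_compose[of f UNIV])
    show "f meromorphic_on UNIV" using that by (simp add: nicely_meromorphic_on_def)
  qed (auto intro!: analytic_intros)
  have an: "(\<lambda>s. sin (of_real pi * s / 2) :: complex) meromorphic_on UNIV" "(\<lambda>s. cos (of_real pi * s / 2) :: complex) meromorphic_on UNIV"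
    "(\<lambda>s. c * cos (\<beta> s)) meromorphic_on UNIV" "(\<lambda>s. c * sin (\<beta> s)) meromorphic_on UNIV" for c
    unfolding \<beta> by (auto intro!: analytic_on_imp_meromorphic_on analytic_intros)
  have op: "open {s::complex. Re s < - real ?n / 2}" by (rule open_halfspace_Re_lt)
  have pt: "of_real (- real ?n / 2 - 1) \<in> {s::complex. Re s < - real ?n / 2}" by simp
  have V: "V.ext_plus (- s - of_nat ?n / 2) = lorentz_zeta e parity_one g (- s - of_nat ?n / 2)"
    "V.ext_minus (- s - of_nat ?n / 2) = lorentz_zeta e parity_sgn g (- s - of_nat ?n / 2)" if "s \<in> {s. Re s < - real ?n / 2}" for s
    using that by (auto intro!: V.ext_right)
  show thesis
  proof (rule that[of W.ext_plus W.ext_minus V.ext_plus V.ext_minus])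
    show "\<forall>\<^sub>\<approx>s. W.ext_plus s = fe_factor ?n s * sin (of_real pi * s / 2) *
      (cos \<theta> * cos (\<beta> s) * V.ext_plus (- s - of_nat ?n / 2) - sin \<theta> * sin (\<beta> s) * V.ext_minus (- s - of_nat ?n / 2))"
    proof (rule meromorphic_identity[OF _ _ op pt])
      show "W.ext_plus meromorphic_on UNIV" using W.ext_nicely by (simp add: nicely_meromorphic_on_def)
      show "(\<lambda>s. fe_factor ?n s * sin (of_real pi * s / 2) *
        (cos \<theta> * cos (\<beta> s) * V.ext_plus (- s - of_nat ?n / 2) - sin \<theta> * sin (\<beta> s) * V.ext_minus (- s - of_nat ?n / 2))) meromorphic_on UNIV"
        by (intro meromorphic_on_mult meromorphic_on_diff fe_factor_meromorphic an comp V.ext_nicely meromorphic_on_const)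
      show "\<forall>\<^sub>\<approx>s. s \<in> {s. Re s < - real ?n / 2} \<longrightarrow> W.ext_plus s = fe_factor ?n s * sin (of_real pi * s / 2) *
        (cos \<theta> * cos (\<beta> s) * V.ext_plus (- s - of_nat ?n / 2) - sin \<theta> * sin (\<beta> s) * V.ext_minus (- s - of_nat ?n / 2))"
        using W.ext_left(1)[OF \<theta> \<beta>] by eventually_elim (use V in auto)
    qed
    show "\<forall>\<^sub>\<approx>s. W.ext_minus s = fe_factor ?n s * cos (of_real pi * s / 2) *
      (sin \<theta> * cos (\<beta> s) * V.ext_plus (- s - of_nat ?n / 2) + cos \<theta> * sin (\<beta> s) * V.ext_minus (- s - of_nat ?n / 2))"
    proof (rule meromorphic_identity[OF _ _ op pt])
      show "W.ext_minus meromorphic_on UNIV" using W.ext_nicely by (simp add: nicely_meromorphic_on_def)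
      show "(\<lambda>s. fe_factor ?n s * cos (of_real pi * s / 2) *
        (sin \<theta> * cos (\<beta> s) * V.ext_plus (- s - of_nat ?n / 2) + cos \<theta> * sin (\<beta> s) * V.ext_minus (- s - of_nat ?n / 2))) meromorphic_on UNIV"
        by (intro meromorphic_on_mult meromorphic_on_add fe_factor_meromorphic an comp V.ext_nicely meromorphic_on_const)
      show "\<forall>\<^sub>\<approx>s. s \<in> {s. Re s < - real ?n / 2} \<longrightarrow> W.ext_minus s = fe_factor ?n s * cos (of_real pi * s / 2) *
        (sin \<theta> * cos (\<beta> s) * V.ext_plus (- s - of_nat ?n / 2) + cos \<theta> * sin (\<beta> s) * V.ext_minus (- s - of_nat ?n / 2))"
        using W.ext_left(2)[OF \<theta> \<beta>] by eventually_elim (use V in auto)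
    qed
  qed (use W.ext_nicely V.ext_nicely W.ext_right V.ext_right in auto)
qed

section \<open>Constants and phases of the matrix A(s)\<close>

lemma fe_factor_eq_gindikin:
  fixes s :: complex
  assumes "n = d + 2"
  shows "2 * of_real (sqrt 2) * of_real (2 * pi) powr (- 2 * (s + of_nat n / 2)) *
      (of_real ((2 * pi) powr ((real n - 2) / 2)) * (Gamma (s + of_nat n / 2) * Gamma (s + of_nat n / 2 - of_nat d / 2)))
    = - (of_real (sqrt 2) / 2) * fe_factor n s"
proof -
  have r: "of_real ((2 * pi) powr ((real n - 2) / 2)) = of_real (2 * pi) powr (of_nat n / 2 - 1 :: complex)"
    using powr_of_real[of "2 * pi" "(real n - 2) / 2"] by (simp add: diff_divide_distrib)
  have "of_real (2 * pi) powr (- 2 * (s + of_nat n / 2)) * of_real (2 * pi) powr (of_nat n / 2 - 1 :: complex)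
    = of_real (2 * pi) powr (- 2 * (s + of_nat n / 2) + (of_nat n / 2 - 1))"
    by (rule powr_add[symmetric])
  also have "- 2 * (s + of_nat n / 2) + (of_nat n / 2 - 1) = (- 2 * s - of_nat n / 2) - 1" by (simp add: field_simps)
  also have "of_real (2 * pi) powr ((- 2 * s - of_nat n / 2) - 1) = of_real (2 * pi) powr (- 2 * s - of_nat n / 2) / of_real (2 * pi)"
    by (subst powr_diff) simp
  finally have p: "of_real (2 * pi) powr (- 2 * (s + of_nat n / 2)) * of_real (2 * pi) powr (of_nat n / 2 - 1 :: complex)
    = of_real (2 * pi) powr (- 2 * s - of_nat n / 2) / of_real (2 * pi)" .
  \<comment> \<open>Since n = d + 2, the second factor of the Gindikin function is the Gamma(1+s)
    that the reflection formula produced.\<close>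
  have g: "s + of_nat n / 2 - of_nat d / 2 = 1 + s" using assms by (simp add: add_divide_distrib)
  have "2 * of_real (sqrt 2) * of_real (2 * pi) powr (- 2 * (s + of_nat n / 2)) *
      (of_real ((2 * pi) powr ((real n - 2) / 2)) * (Gamma (s + of_nat n / 2) * Gamma (s + of_nat n / 2 - of_nat d / 2)))
    = 2 * of_real (sqrt 2) * (of_real (2 * pi) powr (- 2 * (s + of_nat n / 2)) * of_real (2 * pi) powr (of_nat n / 2 - 1)) *
      (Gamma (s + of_nat n / 2) * Gamma (1 + s))"
    unfolding r g by (simp only: mult_ac)
  also have "\<dots> = - (of_real (sqrt 2) / 2) * fe_factor n s"
    unfolding p fe_factor_def by (simp add: field_simps)
  finally show ?thesis .
qed

text \<open>With d = 4 k + 1 the angle \<theta> = pi d / 4 is k pi + pi / 4, so its cosine and sine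
  agree, while \<alpha> is pi s / 2 + (k + 1) pi. Multiplication by sqrt 2 removes the modulus of
  the phase.\<close>

lemma phase_mod_1:
  fixes s :: complex
  assumes d: "d mod 4 = 1" "n = d + 2" and \<theta>: "\<theta> = of_real (pi * (real n - 2) / 4)"
    and \<alpha>: "\<alpha> = of_real pi / 2 * (s + (of_nat n + 1) / 2)"
  shows "sin \<alpha> = - of_real (sqrt 2) * sin (of_real pi * s / 2) * cos \<theta>"
    "sin \<alpha> = - of_real (sqrt 2) * sin (of_real pi * s / 2) * sin \<theta>"
    "cos \<alpha> = - of_real (sqrt 2) * cos (of_real pi * s / 2) * cos \<theta>"
    "cos \<alpha> = - of_real (sqrt 2) * cos (of_real pi * s / 2) * sin \<theta>"
proof -
  define k where "k = d div 4"
  have "d = 4 * k + 1" using d(1) unfolding k_def by presburger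
  then have n: "real n = 4 * real k + 3" using d(2) by simp
  have t: "pi * (real n - 2) / 4 = real k * pi + pi / 4" unfolding n by (simp add: field_simps)
  have c: "cos \<theta> = of_real ((- 1) ^ k * (sqrt 2 / 2))" "sin \<theta> = of_real ((- 1) ^ k * (sqrt 2 / 2))"
    unfolding \<theta> t cos_of_real sin_of_real by (simp_all add: cos_add sin_add cos_npi sin_npi cos_45 sin_45)
  have "complex_of_nat n = of_real (4 * real k + 3)" using n by (metis of_real_of_nat_eq)
  then have a: "\<alpha> = of_real pi * s / 2 + of_real (real (Suc k) * pi)" unfolding \<alpha> by (simp add: field_simps)
  have sc: "sin \<alpha> = - ((- 1) ^ k) * sin (of_real pi * s / 2)" "cos \<alpha> = - ((- 1) ^ k) * cos (of_real pi * s / 2)"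
    unfolding a sin_add cos_add sin_of_real cos_of_real cos_npi sin_npi by simp_all
  have "complex_of_real (sqrt 2) * of_real (sqrt 2) = 2" by (simp flip: of_real_mult)
  then have *: "- of_real (sqrt 2) * x * of_real ((- 1) ^ k * (sqrt 2 / 2)) = - ((- 1) ^ k) * x" for x :: complex
    by (simp add: mult_ac)
  show "sin \<alpha> = - of_real (sqrt 2) * sin (of_real pi * s / 2) * cos \<theta>"
    "sin \<alpha> = - of_real (sqrt 2) * sin (of_real pi * s / 2) * sin \<theta>"
    "cos \<alpha> = - of_real (sqrt 2) * cos (of_real pi * s / 2) * cos \<theta>"
    "cos \<alpha> = - of_real (sqrt 2) * cos (of_real pi * s / 2) * sin \<theta>"
    unfolding c sc * by simp_all
qed

text \<open>With d = 4 k + 3 the angle \<theta> is (k + 1) pi - pi / 4, so its cosine and sine are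
  opposite; \<alpha> gains a quarter turn, which exchanges sine and cosine and hence the rows of the
  matrix.\<close>

lemma phase_mod_3:
  fixes s :: complex
  assumes d: "d mod 4 = 3" "n = d + 2" and \<theta>: "\<theta> = of_real (pi * (real n - 2) / 4)"
    and \<alpha>: "\<alpha> = of_real pi / 2 * (s + (of_nat n + 1) / 2)"
  shows "cos \<alpha> = - of_real (sqrt 2) * sin (of_real pi * s / 2) * cos \<theta>"
    "- cos \<alpha> = - of_real (sqrt 2) * sin (of_real pi * s / 2) * sin \<theta>"
    "sin \<alpha> = - of_real (sqrt 2) * cos (of_real pi * s / 2) * sin \<theta>"
    "- sin \<alpha> = - of_real (sqrt 2) * cos (of_real pi * s / 2) * cos \<theta>"
proof -
  define k where "k = d div 4"
  have "d = 4 * k + 3" using d(1) unfolding k_def by presburger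
  then have n: "real n = 4 * real k + 5" using d(2) by simp
  have t: "pi * (real n - 2) / 4 = real (Suc k) * pi - pi / 4" unfolding n by (simp add: field_simps)
  have c: "cos \<theta> = of_real (- ((- 1) ^ k) * (sqrt 2 / 2))" "sin \<theta> = of_real ((- 1) ^ k * (sqrt 2 / 2))"
    unfolding \<theta> t cos_of_real sin_of_real cos_diff sin_diff cos_npi sin_npi by (simp_all add: cos_45 sin_45)
  have "complex_of_nat n = of_real (4 * real k + 5)" using n by (metis of_real_of_nat_eq)
  then have a: "\<alpha> = of_real pi * s / 2 + of_real (real (Suc k) * pi + pi / 2)" unfolding \<alpha> by (simp add: field_simps)
  have sc: "sin \<alpha> = - ((- 1) ^ k) * cos (of_real pi * s / 2)" "cos \<alpha> = ((- 1) ^ k) * sin (of_real pi * s / 2)"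
    unfolding a sin_add[of _ "of_real _"] cos_add[of _ "of_real _"] sin_of_real cos_of_real sin_add[of "real _ * pi"] cos_add[of "real _ * pi"] cos_npi sin_npi by simp_all
  have "complex_of_real (sqrt 2) * of_real (sqrt 2) = 2" by (simp flip: of_real_mult)
  then have *: "- of_real (sqrt 2) * x * of_real ((- 1) ^ k * (sqrt 2 / 2)) = - ((- 1) ^ k) * x"
    "- of_real (sqrt 2) * x * of_real (- ((- 1) ^ k) * (sqrt 2 / 2)) = ((- 1) ^ k) * x" for x :: complex
    by (simp_all add: mult_ac)
  show "cos \<alpha> = - of_real (sqrt 2) * sin (of_real pi * s / 2) * cos \<theta>"
    "- cos \<alpha> = - of_real (sqrt 2) * sin (of_real pi * s / 2) * sin \<theta>"
    "sin \<alpha> = - of_real (sqrt 2) * cos (of_real pi * s / 2) * sin \<theta>"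
    "- sin \<alpha> = - of_real (sqrt 2) * cos (of_real pi * s / 2) * cos \<theta>"
    unfolding c sc * by simp_all
qed

text \<open>An identity of meromorphic functions is expressed as equality off a sparse set: at
  singularities of single factors, the product of their conventional values need not be the value of
  the product.\<close>

theorem theorem3p4:
  fixes f :: "'a::simple_euclidean_jordan_algebra \<Rightarrow> complex"
    and n d :: nat
  assumes "n = DIM('a)"
    and "jrank TYPE('a) = 2"
    and "d = peirce_const TYPE('a)"
    and "odd d"
    and "schwartz f"
  shows "\<forall>\<^sub>\<approx>s::complex.
    (vector [jzeta Plus (jfourier f) s, jzeta Minus (jfourier f) s] :: complex^2) =
      (2 * of_real (sqrt 2) * of_real (2 * pi) powr (- 2 * (s + of_nat n / 2)) *
         gindikin_gamma TYPE('a) (s + of_nat n / 2)) *s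
      (zeta_matrix n d s *v
        vector [jzeta Plus f (- s - of_nat n / 2), jzeta Minus f (- s - of_nat n / 2)])"
proof -
  interpret rank_two "TYPE('a)" by unfold_locales fact
  have n: "n = d + 2" using peirce_const_eq assms by simp
  have "d \<ge> 1" using assms(4) by (cases d) auto
  then have dim: "DIM('a) \<ge> 3" using n assms(1) by simp
  obtain e :: 'a where e: "e \<in> Basis" using nonempty_Basis by blast
  \<comment> \<open>In these coordinates \<open>jtau\<close> becomes the inner product,
    \<open>jlebesgue\<close> becomes \<open>lborel\<close> and \<open>jdet\<close> becomes
    \<open>lorentz e\<close>.\<close>
  obtain T :: "'a \<Rightarrow> 'a" where T: "linear T" "\<And>x y. jtau (T x) (T y) = x \<bullet> y" and Te: "T e = (1 / sqrt 2) *\<^sub>R 1"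
    using exists_jtau_isometry[OF e] by blast
  have inj: "inj T"
  proof (rule linear_injective_0[OF T(1), THEN iffD2], intro allI impI)
    fix x assume "T x = 0"
    then have "x \<bullet> x = 0" using T(2)[of x x] by (simp add: jtau_eq jordan_bilinear jt_linear_simps)
    then show "x = 0" by simp
  qed
  obtain S where S: "linear S" "\<And>x. S (T x) = x" "\<And>x. T (S x) = x"
    using linear_injective_isomorphism[OF T(1) inj] by blast
  define g where "g = (\<lambda>y. f (T y))"
  have g: "schwartz g" unfolding g_def by (rule schwartz_compose_linear[OF assms(5) T(1) inj])
  have fm: "f \<in> borel_measurable borel" by (rule schwartz_measurable[OF assms(5)])
  have F: "(\<lambda>y. jfourier f (T y)) = fourier g"
    unfolding g_def using jfourier_isometry[OF T fm] by auto
  have Fm: "jfourier f \<in> borel_measurable borel"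
  proof -
    have "jfourier f = (\<lambda>x. fourier g (S x))" using F S(3) by metis
    moreover have [measurable]: "fourier g \<in> borel_measurable borel" by (intro fourier_measurable schwartz_measurable g)
    moreover have [measurable]: "S \<in> borel_measurable borel"
      using S(1) by (simp add: linear_borel_measurable)
    ultimately show ?thesis by simp
  qed
  define \<theta> where "\<theta> = complex_of_real (pi * (real DIM('a) - 2) / 4)"
  define \<beta> where "\<beta> = (\<lambda>s::complex. of_real pi / 2 * (s + of_nat DIM('a) / 2))"
  obtain Wp Wm Vp Vm where nice: "Wp nicely_meromorphic_on UNIV" "Wm nicely_meromorphic_on UNIV" "Vp nicely_meromorphic_on UNIV" "Vm nicely_meromorphic_on UNIV"
    and W: "\<And>s. Re s > 0 \<Longrightarrow> Wp s = lorentz_zeta e parity_one (fourier g) s" "\<And>s. Re s > 0 \<Longrightarrow> Wm s = lorentz_zeta e parity_sgn (fourier g) s"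
    and V: "\<And>s. Re s > 0 \<Longrightarrow> Vp s = lorentz_zeta e parity_one g s" "\<And>s. Re s > 0 \<Longrightarrow> Vm s = lorentz_zeta e parity_sgn g s"
    and fe: "\<forall>\<^sub>\<approx>s. Wp s = fe_factor DIM('a) s * sin (of_real pi * s / 2) *
      (cos \<theta> * cos (\<beta> s) * Vp (- s - of_nat DIM('a) / 2) - sin \<theta> * sin (\<beta> s) * Vm (- s - of_nat DIM('a) / 2))"
    "\<forall>\<^sub>\<approx>s. Wm s = fe_factor DIM('a) s * cos (of_real pi * s / 2) *
      (sin \<theta> * cos (\<beta> s) * Vp (- s - of_nat DIM('a) / 2) + cos \<theta> * sin (\<beta> s) * Vm (- s - of_nat DIM('a) / 2))"
    using functional_equation[OF e g dim \<theta>_def \<beta>_def] by blast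
  have Z: "jzeta Plus (jfourier f) = Wp" "jzeta Minus (jfourier f) = Wm" "jzeta Plus f = Vp" "jzeta Minus f = Vm"
  proof -
    note I = jzeta_integral_isometry[OF T Te e fm, folded g_def] jzeta_integral_isometry[OF T Te e Fm, unfolded F]
    show "jzeta Plus (jfourier f) = Wp" by (rule jzeta_eqI[OF nice(1)]) (simp only: I W parity_fun.simps)
    show "jzeta Minus (jfourier f) = Wm" by (rule jzeta_eqI[OF nice(2)]) (simp only: I W parity_fun.simps)
    show "jzeta Plus f = Vp" by (rule jzeta_eqI[OF nice(3)]) (simp only: I V parity_fun.simps)
    show "jzeta Minus f = Vm" by (rule jzeta_eqI[OF nice(4)]) (simp only: I V parity_fun.simps)
  qed
  have gg: "gindikin_gamma TYPE('a) z = of_real ((2 * pi) powr ((real n - 2) / 2)) * (Gamma z * Gamma (z - of_nat d / 2))" for z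
    using assms by (simp add: gindikin_gamma_def numeral_2_eq_2)
  have \<theta>n: "\<theta> = of_real (pi * (real n - 2) / 4)" using assms(1) by (simp add: \<theta>_def)
  show ?thesis
    using fe
  proof eventually_elim
    case (elim s)
    define \<alpha> where "\<alpha> = of_real pi / 2 * (s + (of_nat n + 1) / 2)"
    have \<beta>s: "\<beta> s = of_real pi / 2 * (s + of_nat n / 2)" using assms(1) by (simp add: \<beta>_def)
    define X where "X = Vp (- s - of_nat n / 2)"
    define Y where "Y = Vm (- s - of_nat n / 2)"
    define K where "K = 2 * of_real (sqrt 2) * of_real (2 * pi) powr (- 2 * (s + of_nat n / 2)) * gindikin_gamma TYPE('a) (s + of_nat n / 2)"
    have K: "K = - (of_real (sqrt 2) / 2) * fe_factor n s"
      unfolding K_def gg by (rule fe_factor_eq_gindikin[OF n])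
    have "complex_of_real (sqrt 2) * of_real (sqrt 2) = 2" by (simp flip: of_real_mult)
    then have fK: "fe_factor n s = K * (- of_real (sqrt 2))" unfolding K by (simp add: mult_ac)
    \<comment> \<open>The factor - sqrt 2 is distributed over the trigonometric products, since in
      this grouping they are the left or right sides of the phase identities.\<close>
    have elim': "Wp s = K * (((- of_real (sqrt 2) * sin (of_real pi * s / 2) * cos \<theta>) * cos (\<beta> s)) * X
        - ((- of_real (sqrt 2) * sin (of_real pi * s / 2) * sin \<theta>) * sin (\<beta> s)) * Y)"
      "Wm s = K * (((- of_real (sqrt 2) * cos (of_real pi * s / 2) * sin \<theta>) * cos (\<beta> s)) * X
        + ((- of_real (sqrt 2) * cos (of_real pi * s / 2) * cos \<theta>) * sin (\<beta> s)) * Y)"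
      using elim unfolding assms(1)[symmetric] X_def[symmetric] Y_def[symmetric] fK by (simp_all add: algebra_simps)
    have "d mod 4 = 1 \<or> d mod 4 = 3" using assms(4) by presburger
    then have "Wp s = K * ((zeta_matrix n d s *v vector [X, Y]) $ 1) \<and> Wm s = K * ((zeta_matrix n d s *v vector [X, Y]) $ 2)"
    proof
      assume m: "d mod 4 = 1"
      note ph = phase_mod_1[OF m n \<theta>n \<alpha>_def, symmetric]
      show ?thesis
        unfolding elim' ph(1,2) ph(3,4)
        using m by (simp add: zeta_matrix_def Let_def matrix_vector_mult_def sum_2 vector_2 \<alpha>_def \<beta>s)
    next
      assume m: "d mod 4 = 3"
      note ph = phase_mod_3[OF m n \<theta>n \<alpha>_def, symmetric]
      show ?thesis
        unfolding elim' ph(1,2) ph(3,4)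
        using m by (simp add: zeta_matrix_def Let_def matrix_vector_mult_def sum_2 vector_2 \<alpha>_def \<beta>s)
    qed
    then show ?case
      unfolding Z X_def[symmetric] Y_def[symmetric] K_def[symmetric]
      by (simp add: vec_eq_iff forall_2 vector_2)
  qed
qed

end
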